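(* Let $n\geq 2$ and $d\geq 1$ be integers, let $Y\subset\mathbf{P}^{n-1}$ be a complex hypersurface of degree $d$, and let $Z\subset\mathbb{A}^n$ be the affine cone over $Y$. Let $r=\dim \mathrm{Sing}(Z)$. Then the log canonical threshold of the pair $(\mathbb{A}^n,Z)$ satisfies $$c(\mathbb{A}^n,Z)\geq\min\{(n-r)/d,\,1\}.$$
   Context: All schemes are over $\mathbb{C}$. A hypersurface $Y\subset\mathbf{P}^{n-1}$ of degree $d$ is the closed subscheme defined by a nonzero homogeneous polynomial $F\in\mathbb{C}[X_1,\ldots,X_n]$ of degree $d$ (arbitrary singularities are allowed). The affine cone over $Y$ is the hypersurface $Z=\mathrm{Spec}\,\mathbb{C}[X_1,\ldots,X_n]/(F)\subset\mathbb{A}^n$. $\mathrm{Sing}(Z)$ is the closed subset of points where $Z$ is not smooth, i.e. the common zero locus of $F$ and all $\partial F/\partial X_i$. (It contains the origin if $d\geq 2$; it is empty exactly when $d=1$, in which case we put $r=-1$.) Jet schemes: for a scheme $W$ of finite type over $\mathbb{C}$ and $m\geq 0$, the $m$th jet scheme $W_m$ is the scheme of finite type over $\mathbb{C}$ characterized by $\mathrm{Hom}(\mathrm{Spec}\,A,W_m)\simeq\mathrm{Hom}(\mathrm{Spec}\,A[t]/(t^{m+1}),W)$ for every $\mathbb{C}$-algebra $A$. Log canonical threshold: for a smooth connected variety $X$ of dimension $N$ over $\mathbb{C}$ and a nonzero effective divisor $D\subset X$, the log canonical threshold is defined here by $$c(X,D)=N-\sup_{m\geq 0}\frac{\dim D_m}{m+1}.$$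 By a theorem of Mustaţă this agrees with the usual log canonical threshold, i.e. the largest $c$ such that the pair $(X,cD)$ is log canonical. *)

theory Defs
  imports
    Complex_Main
    "HOL-Library.Extended_Real"
    "HOL-Library.Poly_Mapping"
    "HOL-Computational_Algebra.Polynomial"
    "HOL-Algebra.QuotRing"
begin

section \<open>Multivariate polynomials\<close>

text \<open>A monomial is a finitely supported exponent function on the type of variables, a polynomial a
  finitely supported function from monomials to coefficients; the multiplication of
  theory \<open>Poly_Mapping\<close> on this type is the product of polynomials.\<close>

type_synonym ('v, 'a) mpoly = "('v \<Rightarrow>\<^sub>0 nat) \<Rightarrow>\<^sub>0 'a"

definition Var :: "'v \<Rightarrow> ('v, 'a::zero_neq_one) mpoly" where
  "Var v = Poly_Mapping.single (Poly_Mapping.single v 1) 1"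

definition Const :: "'a \<Rightarrow> ('v, 'a::zero) mpoly" where
  "Const c = Poly_Mapping.single 0 c"

definition vars :: "('v, 'a::zero) mpoly \<Rightarrow> 'v set" where
  "vars p = (\<Union>s\<in>Poly_Mapping.keys p. Poly_Mapping.keys s)"

definition homogeneous :: "nat \<Rightarrow> ('v, 'a::zero) mpoly \<Rightarrow> bool" where
  "homogeneous d p \<longleftrightarrow> (\<forall>s\<in>Poly_Mapping.keys p. (\<Sum>v\<in>Poly_Mapping.keys s. Poly_Mapping.lookup s v) = d)"

text \<open>When \<open>v\<close> does not occur in \<open>s\<close>, the truncated difference of exponents is harmless, since the
  coefficient vanishes.\<close>

definition partial_deriv :: "'v \<Rightarrow> ('v, 'a::comm_semiring_1) mpoly \<Rightarrow> ('v, 'a) mpoly" where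
  "partial_deriv v p = (\<Sum>s\<in>Poly_Mapping.keys p.
     Poly_Mapping.single (s - Poly_Mapping.single v 1) (of_nat (Poly_Mapping.lookup s v) * Poly_Mapping.lookup p s))"

text \<open>The value of \<open>p\<close> at the point \<open>a\<close>, the coefficients being read through \<open>\<phi>\<close>.\<close>

definition mpoly_eval ::
    "('a::zero \<Rightarrow> 'b::comm_semiring_1) \<Rightarrow> ('v \<Rightarrow> 'b) \<Rightarrow> ('v, 'a) mpoly \<Rightarrow> 'b" where
  "mpoly_eval \<phi> a p = (\<Sum>s\<in>Poly_Mapping.keys p. \<phi> (Poly_Mapping.lookup p s) * (\<Prod>v\<in>Poly_Mapping.keys s. a v ^ Poly_Mapping.lookup s v))"

text \<open>The polynomial ring over the complex numbers in the variables from \<open>V\<close>.\<close>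

definition mpoly_ring :: "'v set \<Rightarrow> ('v, complex) mpoly ring" where
  "mpoly_ring V = \<lparr>carrier = {p. vars p \<subseteq> V}, monoid.mult = (*), one = 1, zero = 0, add = (+)\<rparr>"

section \<open>Dimension\<close>

definition Spec :: "('a, 'm) ring_scheme \<Rightarrow> 'a set set" where
  "Spec R = {P. primeideal P R}"

text \<open>The dimension of a closed subset \<open>T\<close> of a prime spectrum: the supremum of the lengths of chains
  of irreducible closed subsets of \<open>T\<close>, that is, of chains of primes in \<open>T\<close>.
  The empty set has dimension \<open>-1\<close>.\<close>

definition krull_dim :: "'a set set \<Rightarrow> ereal" where
  "krull_dim T = (if T = {} then -1 else
     (SUP l\<in>{l. \<exists>P::nat \<Rightarrow> 'a set. (\<forall>i\<le>l. P i \<in> T) \<and> (\<forall>i<l. P i \<subset> P (Suc i))}. ereal (real l)))"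

section \<open>Singular locus, jet schemes and log canonical threshold\<close>

text \<open>The singular locus of the hypersurface \<open>F = 0\<close> in affine \<open>n\<close>-space, with
  coordinates indexed by \<open>0, \<dots>, n - 1\<close>.\<close>

definition Sing :: "nat \<Rightarrow> (nat, complex) mpoly \<Rightarrow> (nat, complex) mpoly set set" where
  "Sing n F = {P \<in> Spec (mpoly_ring {..<n}). F \<in> P \<and> (\<forall>i<n. partial_deriv i F \<in> P)}"

text \<open>The \<open>m\<close>th jet scheme of the hypersurface \<open>F = 0\<close> is the closed subscheme of the affine space
  with coordinates \<open>x(i, j)\<close>, \<open>i < n\<close>, \<open>j \<le> m\<close>, given by the coefficients of
  \<open>1, t, \<dots>, t ^ m\<close> in \<open>F(x(t))\<close>, where \<open>x(t)\<close> is the universal jet with components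
  \<open>x(i, 0) + x(i, 1) t + \<dots> + x(i, m) t ^ m\<close>.
  Lemma \<open>jet_ideal_points\<close> below is its defining property on \<open>A\<close>-valued points.\<close>

definition universal_jet :: "nat \<Rightarrow> nat \<Rightarrow> (nat \<times> nat, complex) mpoly poly" where
  "universal_jet m i = (\<Sum>j\<le>m. Polynomial.monom (Var (i, j)) j)"

definition jet_coeff :: "nat \<Rightarrow> (nat, complex) mpoly \<Rightarrow> nat \<Rightarrow> (nat \<times> nat, complex) mpoly" where
  "jet_coeff m F k = poly.coeff (mpoly_eval (\<lambda>c. [:Const c:]) (universal_jet m) F) k"

abbreviation jet_coords :: "nat \<Rightarrow> nat \<Rightarrow> (nat \<times> nat) set" where
  "jet_coords n m \<equiv> {..<n} \<times> {..m}"

definition jet_ideal :: "nat \<Rightarrow> nat \<Rightarrow> (nat, complex) mpoly \<Rightarrow> (nat \<times> nat, complex) mpoly set" where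
  "jet_ideal n m F = genideal (mpoly_ring (jet_coords n m)) (jet_coeff m F ` {..m})"

definition jet_ring ::
    "nat \<Rightarrow> nat \<Rightarrow> (nat, complex) mpoly \<Rightarrow> (nat \<times> nat, complex) mpoly set ring" where
  "jet_ring n m F = mpoly_ring (jet_coords n m) Quot jet_ideal n m F"

text \<open>The log canonical threshold of affine \<open>n\<close>-space along the divisor \<open>F = 0\<close>.\<close>

definition lct :: "nat \<Rightarrow> (nat, complex) mpoly \<Rightarrow> ereal" where
  "lct n F = ereal (real n) - (SUP m. krull_dim (Spec (jet_ring n m F)) / ereal (real (m + 1)))"

section \<open>The polynomial ring and the points of the jet scheme\<close>

lemma keys_add_nat: "Poly_Mapping.keys (s + t) = Poly_Mapping.keys s \<union> Poly_Mapping.keys t" for s t :: "'v \<Rightarrow>\<^sub>0 nat"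
  by (auto simp: in_keys_iff lookup_add)

lemma vars_0 [simp]: "vars 0 = {}"
  and vars_1 [simp]: "vars (1 :: ('v, 'a::zero_neq_one) mpoly) = {}"
  by (auto simp: vars_def)

lemma vars_Var: "vars (Var v) = {v}"
  by (auto simp: vars_def Var_def)

lemma vars_Const [simp]: "vars (Const c) = {}"
  by (auto simp: vars_def Const_def split: if_splits)

lemma vars_add: "vars (p + q) \<subseteq> vars p \<union> vars q"
  using Poly_Mapping.keys_add[of p q] by (fastforce simp: vars_def)

lemma vars_uminus [simp]: "vars (- p) = vars p" for p :: "('v, 'a::ab_group_add) mpoly"
  by (simp add: vars_def keys_def)

lemma vars_mult: "vars (p * q) \<subseteq> vars p \<union> vars q" for p :: "('v, 'a::comm_semiring_0) mpoly"
proof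
  fix v assume "v \<in> vars (p * q)"
  then obtain s where s: "s \<in> Poly_Mapping.keys (p * q)" "v \<in> Poly_Mapping.keys s"
    by (auto simp: vars_def)
  then obtain a b where "a \<in> Poly_Mapping.keys p" "b \<in> Poly_Mapping.keys q" "s = a + b"
    using keys_mult[of p q] by blast
  with s(2) show "v \<in> vars p \<union> vars q"
    by (auto simp: vars_def keys_add_nat)
qed

lemma cring_mpoly_ring: "cring (mpoly_ring V)"
proof (rule cringI)
  show "abelian_group (mpoly_ring V)"
  proof (rule abelian_groupI)
    fix x assume x: "x \<in> carrier (mpoly_ring V)"
    then have "- x \<in> carrier (mpoly_ring V)"
      by (simp add: mpoly_ring_def)
    then show "\<exists>y\<in>carrier (mpoly_ring V). y \<oplus>\<^bsub>mpoly_ring V\<^esub> x = \<zero>\<^bsub>mpoly_ring V\<^esub>"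
      by (rule rev_bexI) (simp add: mpoly_ring_def)
  qed (auto simp: mpoly_ring_def ac_simps dest: subsetD[OF vars_add])
  show "comm_monoid (mpoly_ring V)"
    by (rule comm_monoidI) (auto simp: mpoly_ring_def ac_simps dest: subsetD[OF vars_mult])
qed (simp add: mpoly_ring_def algebra_simps)

lemma monom_value_add:
  fixes a :: "'v \<Rightarrow> 'b::comm_semiring_1" and s t :: "'v \<Rightarrow>\<^sub>0 nat"
  shows "(\<Prod>v\<in>Poly_Mapping.keys (s + t). a v ^ Poly_Mapping.lookup (s + t) v) =
    (\<Prod>v\<in>Poly_Mapping.keys s. a v ^ Poly_Mapping.lookup s v) * (\<Prod>v\<in>Poly_Mapping.keys t. a v ^ Poly_Mapping.lookup t v)"
proof -
  have "(\<Prod>v\<in>Poly_Mapping.keys s. a v ^ Poly_Mapping.lookup s v) = (\<Prod>v\<in>Poly_Mapping.keys s \<union> Poly_Mapping.keys t. a v ^ Poly_Mapping.lookup s v)"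
    by (rule prod.mono_neutral_left) (auto simp: in_keys_iff)
  moreover have "(\<Prod>v\<in>Poly_Mapping.keys t. a v ^ Poly_Mapping.lookup t v) = (\<Prod>v\<in>Poly_Mapping.keys s \<union> Poly_Mapping.keys t. a v ^ Poly_Mapping.lookup t v)"
    by (rule prod.mono_neutral_left) (auto simp: in_keys_iff)
  ultimately show ?thesis
    by (simp add: keys_add_nat lookup_add power_add prod.distrib)
qed

lemma mpoly_sum_single: "(\<Sum>s\<in>Poly_Mapping.keys p. Poly_Mapping.single s (Poly_Mapping.lookup p s)) = p"
  for p :: "('v, 'a::comm_monoid_add) mpoly"
proof (rule poly_mapping_eqI)
  fix k
  have "Poly_Mapping.lookup (\<Sum>s\<in>Poly_Mapping.keys p. Poly_Mapping.single s (Poly_Mapping.lookup p s)) k =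
      (\<Sum>s\<in>Poly_Mapping.keys p. if s = k then Poly_Mapping.lookup p s else 0)"
    by (simp add: lookup_sum lookup_single when_def)
  also have "\<dots> = Poly_Mapping.lookup p k"
    by (simp add: in_keys_iff)
  finally show "Poly_Mapping.lookup (\<Sum>s\<in>Poly_Mapping.keys p. Poly_Mapping.single s (Poly_Mapping.lookup p s)) k = Poly_Mapping.lookup p k" .
qed

context
  fixes \<phi> :: "'a::comm_semiring_1 \<Rightarrow> 'b::comm_semiring_1"
  assumes hom0: "\<phi> 0 = 0" and hom1: "\<phi> 1 = 1"
    and hom_add: "\<And>x y. \<phi> (x + y) = \<phi> x + \<phi> y"
    and hom_mult: "\<And>x y. \<phi> (x * y) = \<phi> x * \<phi> y"
begin

lemma hom_sum': "\<phi> (sum f A) = (\<Sum>x\<in>A. \<phi> (f x))"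
  by (induction A rule: infinite_finite_induct) (simp_all add: hom0 hom_add)

lemma hom_prod': "\<phi> (prod f A) = (\<Prod>x\<in>A. \<phi> (f x))"
  by (induction A rule: infinite_finite_induct) (simp_all add: hom1 hom_mult)

lemma hom_power': "\<phi> (x ^ k) = \<phi> x ^ k"
  by (induction k) (simp_all add: hom1 hom_mult)

lemma mpoly_eval_superset:
  assumes "finite S" "Poly_Mapping.keys p \<subseteq> S"
  shows "mpoly_eval \<phi> a p = (\<Sum>s\<in>S. \<phi> (Poly_Mapping.lookup p s) * (\<Prod>v\<in>Poly_Mapping.keys s. a v ^ Poly_Mapping.lookup s v))"
  unfolding mpoly_eval_def
  using assms by (intro sum.mono_neutral_left) (auto simp: in_keys_iff hom0)

lemma mpoly_eval_0: "mpoly_eval \<phi> a 0 = 0"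
  by (simp add: mpoly_eval_def)

lemma mpoly_eval_single:
  "mpoly_eval \<phi> a (Poly_Mapping.single s c) = \<phi> c * (\<Prod>v\<in>Poly_Mapping.keys s. a v ^ Poly_Mapping.lookup s v)"
  by (subst mpoly_eval_superset[of "{s}"]) auto

lemma mpoly_eval_1: "mpoly_eval \<phi> a 1 = 1"
  using mpoly_eval_single[of a 0 1] by (simp add: hom1)

lemma mpoly_eval_Const: "mpoly_eval \<phi> a (Const c) = \<phi> c"
  by (simp add: Const_def mpoly_eval_single)

lemma mpoly_eval_Var: "mpoly_eval \<phi> a (Var v) = a v"
  by (simp add: Var_def mpoly_eval_single hom1)

lemma mpoly_eval_add: "mpoly_eval \<phi> a (p + q) = mpoly_eval \<phi> a p + mpoly_eval \<phi> a q"
  using Poly_Mapping.keys_add[of p q]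
  by (subst (1 2 3) mpoly_eval_superset[of "Poly_Mapping.keys p \<union> Poly_Mapping.keys q"])
    (auto simp: lookup_add hom_add distrib_right sum.distrib)

lemma mpoly_eval_sum: "mpoly_eval \<phi> a (sum f A) = (\<Sum>x\<in>A. mpoly_eval \<phi> a (f x))"
  by (induction A rule: infinite_finite_induct) (simp_all add: mpoly_eval_0 mpoly_eval_add)

lemma mpoly_eval_mult: "mpoly_eval \<phi> a (p * q) = mpoly_eval \<phi> a p * mpoly_eval \<phi> a q"
proof -
  have "p * q = (\<Sum>s\<in>Poly_Mapping.keys p. \<Sum>t\<in>Poly_Mapping.keys q.
      Poly_Mapping.single (s + t) (Poly_Mapping.lookup p s * Poly_Mapping.lookup q t))"
    by (subst (1 2) mpoly_sum_single[symmetric]) (simp add: sum_product mult_single)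
  then have "mpoly_eval \<phi> a (p * q) = (\<Sum>s\<in>Poly_Mapping.keys p. \<Sum>t\<in>Poly_Mapping.keys q.
      (\<phi> (Poly_Mapping.lookup p s) * (\<Prod>v\<in>Poly_Mapping.keys s. a v ^ Poly_Mapping.lookup s v)) *
      (\<phi> (Poly_Mapping.lookup q t) * (\<Prod>v\<in>Poly_Mapping.keys t. a v ^ Poly_Mapping.lookup t v)))"
    by (simp add: mpoly_eval_sum mpoly_eval_single monom_value_add hom_mult ac_simps)
  then show ?thesis
    by (simp add: mpoly_eval_def sum_product)
qed

lemma hom_mpoly_eval: "\<phi> (mpoly_eval \<psi> b p) = mpoly_eval (\<lambda>c. \<phi> (\<psi> c)) (\<lambda>v. \<phi> (b v)) p"
  by (simp add: mpoly_eval_def hom_sum' hom_mult hom_prod' hom_power')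

lemma map_poly_hom_add: "map_poly \<phi> (p + q) = map_poly \<phi> p + map_poly \<phi> q"
  by (rule poly_eqI) (simp add: coeff_map_poly hom0 hom_add)

lemma map_poly_hom_mult: "map_poly \<phi> (p * q) = map_poly \<phi> p * map_poly \<phi> q"
  by (rule poly_eqI) (simp add: coeff_map_poly coeff_mult hom0 hom_sum' hom_mult)

lemma map_poly_hom_sum: "map_poly \<phi> (sum f A) = (\<Sum>x\<in>A. map_poly \<phi> (f x))"
  by (induction A rule: infinite_finite_induct) (simp_all add: map_poly_hom_add)

end

lemma vars_sum: "vars (sum f A) \<subseteq> (\<Union>x\<in>A. vars (f x))"
proof (induction A rule: infinite_finite_induct)
  case (insert x A)
  then show ?case
    using vars_add[of "f x" "sum f A"] by auto
qed auto

lemma coeff_vars_mult: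
  fixes p q :: "('v, complex) mpoly poly"
  assumes "\<And>k. vars (poly.coeff p k) \<subseteq> V" "\<And>k. vars (poly.coeff q k) \<subseteq> V"
  shows "vars (poly.coeff (p * q) k) \<subseteq> V"
  unfolding coeff_mult
  using assms by (intro order_trans[OF vars_sum] UN_least order_trans[OF vars_mult]) auto

lemma jet_coeff_carrier:
  assumes "F \<in> carrier (mpoly_ring {..<n})"
  shows "jet_coeff m F k \<in> carrier (mpoly_ring (jet_coords n m))"
proof -
  let ?V = "jet_coords n m"
  define good :: "(nat \<times> nat, complex) mpoly poly \<Rightarrow> bool"
    where "good p \<longleftrightarrow> (\<forall>k. vars (poly.coeff p k) \<subseteq> ?V)" for p
  have good_const: "good [:c:]" if "vars c \<subseteq> ?V" for c
    using that by (auto simp: good_def coeff_pCons split: nat.splits)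
  have good_1: "good 1"
    using good_const[of 1] by (simp add: one_pCons)
  have good_0: "good 0"
    by (simp add: good_def)
  have good_add: "good (p + q)" if "good p" "good q" for p q
    using that vars_add unfolding good_def coeff_add by (meson Un_least order_trans)
  have good_mult: "good (p * q)" if "good p" "good q" for p q
    using that coeff_vars_mult unfolding good_def by blast
  have good_sum: "good (sum f A)" if "\<And>x. x \<in> A \<Longrightarrow> good (f x)"
    for A and f :: "'x \<Rightarrow> (nat \<times> nat, complex) mpoly poly"
    using that by (induction A rule: infinite_finite_induct) (auto simp: good_0 good_add)
  have good_power: "good (p ^ l)" if "good p" for p l
    using that by (induction l) (auto simp: good_1 good_mult)
  have good_prod: "good (prod f A)" if "\<And>x. x \<in> A \<Longrightarrow> good (f x)"
    for A and f :: "nat \<Rightarrow> (nat \<times> nat, complex) mpoly poly"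
    using that by (induction A rule: infinite_finite_induct) (auto simp: good_1 good_mult)
  have good_jet: "good (universal_jet m i)" if "i < n" for i
    unfolding universal_jet_def
    by (rule good_sum) (use that in \<open>auto simp: good_def vars_Var split: if_splits\<close>)
  have "good (mpoly_eval (\<lambda>c. [:Const c:]) (universal_jet m) F)"
    unfolding mpoly_eval_def
    using assms
    by (intro good_sum good_mult good_prod good_power good_const good_jet)
      (auto simp: mpoly_ring_def vars_def Const_def split: if_splits)
  then show ?thesis
    by (auto simp: good_def jet_coeff_def mpoly_ring_def)
qed

text \<open>For every \<open>\<complex>\<close>-algebra \<open>\<phi> : \<complex> \<rightarrow> A\<close>, a family \<open>a(i, j)\<close> of elements of \<open>A\<close> is an
  \<open>A\<close>-point of the jet scheme if and only if \<open>i \<mapsto> \<Sum>j\<le>m. a(i, j) t ^ j\<close> is an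
  \<open>A[t]/(t ^ (m + 1))\<close>-point of the hypersurface.\<close>

lemma jet_ideal_points:
  fixes \<phi> :: "complex \<Rightarrow> 'a::comm_ring_1" and a :: "nat \<times> nat \<Rightarrow> 'a"
  assumes hom: "\<phi> 0 = 0" "\<phi> 1 = 1"
      "\<And>x y. \<phi> (x + y) = \<phi> x + \<phi> y" "\<And>x y. \<phi> (x * y) = \<phi> x * \<phi> y"
    and F: "F \<in> carrier (mpoly_ring {..<n})"
  shows "(\<forall>p\<in>jet_ideal n m F. mpoly_eval \<phi> a p = 0) \<longleftrightarrow>
    Polynomial.monom 1 (m + 1) dvd
      mpoly_eval (\<lambda>c. [:\<phi> c:]) (\<lambda>i. \<Sum>j\<le>m. Polynomial.monom (a (i, j)) j) F"
proof -
  let ?R = "mpoly_ring (jet_coords n m)"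
  let ?h = "mpoly_eval \<phi> a :: (nat \<times> nat, complex) mpoly \<Rightarrow> 'a"
  let ?x = "mpoly_eval (\<lambda>c. [:\<phi> c:]) (\<lambda>i. \<Sum>j\<le>m. Polynomial.monom (a (i, j)) j) F"
  interpret R: cring ?R
    by (rule cring_mpoly_ring)
  note h = mpoly_eval_0[of \<phi> a, OF hom] mpoly_eval_1[of \<phi> a, OF hom]
    mpoly_eval_add[of \<phi> a, OF hom] mpoly_eval_mult[of \<phi> a, OF hom]
  have gens: "jet_coeff m F ` {..m} \<subseteq> carrier ?R"
    using jet_coeff_carrier[OF F] by blast
  have coeff: "?h (jet_coeff m F k) = poly.coeff ?x k" for k
  proof -
    note mp = map_poly_hom_add[of ?h, OF h] map_poly_hom_mult[of ?h, OF h]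
    have "map_poly ?h (mpoly_eval (\<lambda>c. [:Const c:]) (universal_jet m) F) =
      mpoly_eval (\<lambda>c. map_poly ?h [:Const c:]) (\<lambda>i. map_poly ?h (universal_jet m i)) F"
      by (rule hom_mpoly_eval) (auto simp: mp h map_poly_pCons one_pCons)
    also have "(\<lambda>c. map_poly ?h [:Const c:]) = (\<lambda>c. [:\<phi> c:])"
      by (auto simp: map_poly_pCons h mpoly_eval_Const[of \<phi> a, OF hom])
    also have "(\<lambda>i. map_poly ?h (universal_jet m i)) =
        (\<lambda>i. \<Sum>j\<le>m. Polynomial.monom (a (i, j)) j)"
      by (simp add: universal_jet_def map_poly_hom_sum[of ?h, OF h] map_poly_monom h
          mpoly_eval_Var[of \<phi> a, OF hom])
    finally have "map_poly ?h (mpoly_eval (\<lambda>c. [:Const c:]) (universal_jet m) F) = ?x" .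
    from this[symmetric] show ?thesis
      by (simp only: jet_coeff_def coeff_map_poly[of ?h, OF h(1)])
  qed
  have ker: "ideal {p \<in> carrier ?R. ?h p = 0} ?R"
  proof (rule idealI[OF R.ring_axioms])
    have inv: "?h (\<ominus>\<^bsub>?R\<^esub> p) = 0" if "p \<in> carrier ?R" "?h p = 0" for p
    proof -
      have "\<ominus>\<^bsub>?R\<^esub> p \<oplus>\<^bsub>?R\<^esub> p = \<zero>\<^bsub>?R\<^esub>"
        using that(1) by (rule R.l_neg)
      then have "?h (\<ominus>\<^bsub>?R\<^esub> p + p) = 0"
        by (simp add: mpoly_ring_def h(1))
      then show ?thesis
        using that(2) by (simp add: h(3))
    qed
    show "subgroup {p \<in> carrier ?R. ?h p = 0} (add_monoid ?R)"
    proof (rule R.add.subgroupI)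
      show "{p \<in> carrier ?R. ?h p = 0} \<noteq> {}"
        using h(1) by (auto simp: mpoly_ring_def intro!: exI[of _ 0])
      show "p \<oplus>\<^bsub>?R\<^esub> q \<in> {p \<in> carrier ?R. ?h p = 0}"
        if "p \<in> {p \<in> carrier ?R. ?h p = 0}" "q \<in> {p \<in> carrier ?R. ?h p = 0}" for p q
        using that R.a_closed[of p q] by (simp add: mpoly_ring_def h(3))
    qed (use inv in auto)
  next
    fix p q assume "p \<in> {p \<in> carrier ?R. ?h p = 0}" "q \<in> carrier ?R"
    then show "q \<otimes>\<^bsub>?R\<^esub> p \<in> {p \<in> carrier ?R. ?h p = 0}"
        and "p \<otimes>\<^bsub>?R\<^esub> q \<in> {p \<in> carrier ?R. ?h p = 0}"
      using R.m_closed[of p q] R.m_closed[of q p] by (simp_all add: mpoly_ring_def h(4))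
  qed
  have "(\<forall>p\<in>jet_ideal n m F. ?h p = 0) \<longleftrightarrow> (\<forall>k\<le>m. ?h (jet_coeff m F k) = 0)"
  proof
    assume "\<forall>p\<in>jet_ideal n m F. ?h p = 0"
    then show "\<forall>k\<le>m. ?h (jet_coeff m F k) = 0"
      using R.genideal_self[OF gens] by (auto simp: jet_ideal_def)
  next
    assume "\<forall>k\<le>m. ?h (jet_coeff m F k) = 0"
    then have "jet_ideal n m F \<subseteq> {p \<in> carrier ?R. ?h p = 0}"
      unfolding jet_ideal_def using gens by (intro R.genideal_minimal ker) auto
    then show "\<forall>p\<in>jet_ideal n m F. ?h p = 0"
      by blast
  qed
  also have "\<dots> \<longleftrightarrow> (\<forall>k\<le>m. poly.coeff ?x k = 0)"
    by (simp add: coeff)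
  also have "\<dots> \<longleftrightarrow> Polynomial.monom 1 (m + 1) dvd ?x"
    by (simp add: monom_1_dvd_iff' less_Suc_eq_le)
  finally show ?thesis .
qed

end

(* Each prime in a chain of length l contributes one more element, so l polynomials are algebraically
   independent modulo the bottom prime; counting their monomials shows that l is at most the growth
   order of the Hilbert function. Conversely, for a homogeneous ideal I all of whose chains have length
   at most r, Noetherian induction gives growth of order at most r: if I is not prime, pass to I + (a)
   and I + (b) with a b in I; if it is, divide by a variable, which lowers the chain length.

   Let D(m) bound the chains of the m-th jet scheme, and let P be the bottom prime of such a chain. If
   some partial derivative G at x(0) is not in P, then modulo P, and after inverting G, the equations
   F_1, ..., F_m eliminate one coordinate of each of x(1), ..., x(m), so the length is at most
   (m + 1) (n - 1). Otherwise P lies over the singular locus, which contributes r. The jets over a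
   singular point degenerate to those over the origin, because the part of F_k of top degree in
   x(1), ..., x(m) is its value at x(0) = 0; and since F(t y) = t^d F(y), the jets over the origin
   contribute n m if m < d, and D(m - d) + n (d - 1) if m >= d. By induction D(m) <= (m + 1) s with
   s = max (n - 1) (n - (n - r) / d). *)

theory Submission
  imports Defs "HOL-Library.Product_Lexorder"
begin

text \<open>Why both chains and growth: dimension is defined by chains of primes, but a degeneration
  controls only the top-degree part of each relation, and chain lengths do not follow it. Spanning
  sets do, since a monomial may be rewritten up to terms of smaller degree in the chosen variables.
  So chain bounds are turned into growth bounds, combined there, and turned back.

  The bottom prime P need not be homogeneous, hence growth means graded sets that span modulo P. The
  passage from chains to growth is applied only to homogeneous ideals: (F), the ideal of the
  singular locus, and the jet ideal of order m - d.

  The constant s is dictated by two costs. Over the smooth locus each order contributes n - 1. Over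
  the singular locus d further orders contribute r + n (d - 1) beyond D(m - d), and this must be at
  most d s; the second entry of the maximum is the value of s with equality. The same inequality
  settles m < d because r is at most n. Finally n - s is exactly the minimum in the theorem.\<close>

abbreviation "keys \<equiv> Poly_Mapping.keys"
abbreviation "lookup \<equiv> Poly_Mapping.lookup"
abbreviation "single \<equiv> Poly_Mapping.single"

abbreviation Pol :: "'v set \<Rightarrow> ('v, complex) mpoly set" where
  "Pol V \<equiv> carrier (mpoly_ring V)"

abbreviation mon :: "('v \<Rightarrow>\<^sub>0 nat) \<Rightarrow> ('v, complex) mpoly" where
  "mon s \<equiv> single s 1"

subsection \<open>Graded polynomials\<close>

definition tdeg :: "('v \<Rightarrow>\<^sub>0 nat) \<Rightarrow> nat" where
  "tdeg s = (\<Sum>v\<in>keys s. lookup s v)"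

lemma homogeneous_tdeg: "homogeneous d p \<longleftrightarrow> (\<forall>s\<in>keys p. tdeg s = d)"
  by (simp add: homogeneous_def tdeg_def)

lemma tdeg_superset:
  assumes "finite S" "keys s \<subseteq> S"
  shows "tdeg s = (\<Sum>v\<in>S. lookup s v)"
  unfolding tdeg_def using assms by (intro sum.mono_neutral_left) (auto simp: in_keys_iff)

lemma tdeg_add [simp]: "tdeg (s + t) = tdeg s + tdeg t"
  by (subst (1 2 3) tdeg_superset[of "keys s \<union> keys t"])
    (auto simp: keys_add_nat lookup_add sum.distrib)

lemma tdeg_0 [simp]: "tdeg 0 = 0"
  by (simp add: tdeg_def)

lemma tdeg_single [simp]: "tdeg (single v k) = k"
  by (simp add: tdeg_def)

lemma tdeg_eq_0_iff [simp]: "tdeg s = 0 \<longleftrightarrow> s = 0"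
  by (auto simp: tdeg_def in_keys_iff intro!: poly_mapping_eqI)

lemma lookup_le_tdeg: "lookup s v \<le> tdeg s"
  by (cases "v \<in> keys s") (auto simp: tdeg_def in_keys_iff intro!: member_le_sum)

lemma Pol_iff: "p \<in> Pol V \<longleftrightarrow> (\<forall>s\<in>keys p. keys s \<subseteq> V)"
  by (auto simp: mpoly_ring_def vars_def)

lemma Const_simps [simp]:
  "Const 0 = 0" "Const 1 = 1"
  by (simp_all add: Const_def)

lemma Const_add: "Const (a + b) = Const a + Const (b :: complex)"
  and Const_mult: "Const (a * b) = Const a * Const b"
  and Const_uminus: "Const (- a) = - Const a"
  by (simp_all add: Const_def single_add mult_single single_uminus)

lemma lookup_Const_mult [simp]: "lookup (Const c * p) s = c * lookup p s"
  for p :: "('v, complex) mpoly"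
  unfolding Const_def mult_map_scale_conv_mult[symmetric]
  by (simp add: Poly_Mapping.map.rep_eq when_def)

lemma Pol_0 [simp]: "0 \<in> Pol V" and Pol_1 [simp]: "1 \<in> Pol V" and Pol_Const [simp]: "Const c \<in> Pol V"
  by (simp_all add: mpoly_ring_def)

lemma Pol_Var [simp]: "Var v \<in> Pol V \<longleftrightarrow> v \<in> V"
  by (simp add: mpoly_ring_def vars_Var)

lemma Pol_mon [simp]: "mon s \<in> Pol V \<longleftrightarrow> keys s \<subseteq> V"
  by (simp add: Pol_iff)

lemma Pol_uminus [simp]: "- p \<in> Pol V \<longleftrightarrow> p \<in> Pol V"
  by (simp add: mpoly_ring_def)

lemma Pol_add [simp, intro]: "p \<in> Pol V \<Longrightarrow> q \<in> Pol V \<Longrightarrow> p + q \<in> Pol V"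
  using vars_add[of p q] by (auto simp: mpoly_ring_def)

lemma Pol_mult [simp, intro]: "p \<in> Pol V \<Longrightarrow> q \<in> Pol V \<Longrightarrow> p * q \<in> Pol V"
  using vars_mult[of p q] by (auto simp: mpoly_ring_def)

lemma Pol_diff [simp, intro]: "p \<in> Pol V \<Longrightarrow> q \<in> Pol V \<Longrightarrow> p - q \<in> Pol V"
  using Pol_add[of p V "- q"] by simp

lemma Pol_power [simp, intro]: "p \<in> Pol V \<Longrightarrow> p ^ k \<in> Pol V"
  by (induction k) auto

lemma Pol_sum [simp, intro]: "(\<And>x. x \<in> A \<Longrightarrow> f x \<in> Pol V) \<Longrightarrow> sum f A \<in> Pol V"
  by (induction A rule: infinite_finite_induct) auto

lemma Pol_mono: "V \<subseteq> W \<Longrightarrow> p \<in> Pol V \<Longrightarrow> p \<in> Pol W"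
  by (auto simp: mpoly_ring_def)

lemma single_conv: "single s c = Const c * mon s"
  by (simp add: Const_def mult_single)

lemma mon_add: "mon (s + t) = mon s * mon t"
  by (simp add: mult_single)

lemma mpoly_sum_mon: "p = (\<Sum>s\<in>keys p. Const (lookup p s) * mon s)"
  by (simp only: single_conv[symmetric] mpoly_sum_single)

lemma mpoly_ring_simps [simp]:
  "\<zero>\<^bsub>mpoly_ring V\<^esub> = 0" "\<one>\<^bsub>mpoly_ring V\<^esub> = 1"
  "p \<oplus>\<^bsub>mpoly_ring V\<^esub> q = p + q" "p \<otimes>\<^bsub>mpoly_ring V\<^esub> q = p * q"
  by (simp_all add: mpoly_ring_def)

lemma mon_induct [consumes 1, case_names 0 Var]:
  fixes s :: "'v \<Rightarrow>\<^sub>0 nat"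
  assumes "keys s \<subseteq> V" "P 0" "\<And>s v. v \<in> V \<Longrightarrow> keys s \<subseteq> V \<Longrightarrow> P s \<Longrightarrow> P (s + single v 1)"
  shows "P s"
  using assms(1)
proof (induction "tdeg s" arbitrary: s)
  case 0
  then show ?case using assms(2) by simp
next
  case (Suc k)
  then have "s \<noteq> 0" by auto
  then obtain v where v: "v \<in> keys s" by fastforce
  define t where "t = s - single v 1"
  have s: "s = t + single v 1"
    using v by (intro poly_mapping_eqI)
      (auto simp: t_def lookup_add lookup_minus lookup_single when_def in_keys_iff)
  have "P t"
    using Suc s by (intro Suc(1)) (auto simp: keys_add_nat)
  moreover have "keys t \<subseteq> V" "v \<in> V"
    using Suc(3) s by (auto simp: keys_add_nat)
  ultimately show ?case
    unfolding s by (intro assms(3)) (use Suc s in \<open>auto simp: keys_add_nat\<close>)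
qed

lemma mpoly_induct [consumes 1, case_names Const Var add mult]:
  assumes "p \<in> Pol V" "\<And>c. P (Const c)" "\<And>v. v \<in> V \<Longrightarrow> P (Var v)"
    "\<And>p q. p \<in> Pol V \<Longrightarrow> q \<in> Pol V \<Longrightarrow> P p \<Longrightarrow> P q \<Longrightarrow> P (p + q)"
    "\<And>p q. p \<in> Pol V \<Longrightarrow> q \<in> Pol V \<Longrightarrow> P p \<Longrightarrow> P q \<Longrightarrow> P (p * q)"
  shows "P p"
proof -
  have mon: "P (mon s)" if "keys s \<subseteq> V" for s
    using that
  proof (induction rule: mon_induct)
    case 0
    then show ?case using assms(2)[of 1] by (simp only: Const_simps single_one)
  next
    case (Var s v)
    then show ?case
      unfolding mon_add using assms(3)[of v] by (intro assms(5)) (auto simp: Var_def)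
  qed
  have "P (\<Sum>s\<in>A. Const (lookup p s) * mon s)" if "finite A" "A \<subseteq> keys p" for A
    using that
  proof (induction A)
    case empty
    then show ?case using assms(2)[of 0] by simp
  next
    case (insert s A)
    then show ?case using assms(1)
      by (auto simp: Pol_iff[of p] subset_iff intro!: assms(4) assms(5) assms(2) mon Pol_mult Pol_sum)
  qed
  from this[of "keys p"] show ?thesis
    by (simp flip: mpoly_sum_mon)
qed

text \<open>The predicate carries the degree, so a claim that depends on it can be built up from
  constants and variables. The case \<open>zero\<close> stands apart because the zero polynomial is
  homogeneous of every degree.\<close>

lemma homogeneous_induct [consumes 2, case_names zero Const Var add mult]:
  assumes "p \<in> Pol V" "homogeneous d p" "P d 0" "\<And>c. P 0 (Const c)" "\<And>v. v \<in> V \<Longrightarrow> P 1 (Var v)"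
    "\<And>p q d. P d p \<Longrightarrow> P d q \<Longrightarrow> P d (p + q)"
    "\<And>p q d e. P d p \<Longrightarrow> P e q \<Longrightarrow> P (d + e) (p * q)"
  shows "P d p"
proof -
  have mon: "P (tdeg s) (mon s)" if "keys s \<subseteq> V" for s
    using that
  proof (induction rule: mon_induct)
    case 0
    then show ?case using assms(4)[of 1] by simp
  next
    case (Var s v)
    then show ?case
      unfolding mon_add tdeg_add using assms(5)[of v] by (intro assms(7)) (auto simp: Var_def)
  qed
  have "P d (\<Sum>s\<in>A. Const (lookup p s) * mon s)" if "finite A" "A \<subseteq> keys p" for A
    using that
  proof (induction A)
    case empty
    then show ?case using assms(3) by simp
  next
    case (insert s A)
    have "P (0 + tdeg s) (Const (lookup p s) * mon s)"
      using insert(4) assms(1) by (intro assms(7) assms(4) mon) (auto simp: Pol_iff)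
    then have "P d (Const (lookup p s) * mon s)"
      using insert(4) assms(2) by (auto simp: homogeneous_tdeg)
    then show ?case using insert by (auto intro!: assms(6))
  qed
  from this[of "keys p"] show ?thesis
    by (simp flip: mpoly_sum_mon)
qed

lemma homogeneous_0 [simp]: "homogeneous d 0"
  by (simp add: homogeneous_tdeg)

lemma homogeneous_mon [simp]: "homogeneous d (mon s) \<longleftrightarrow> tdeg s = d"
  by (simp add: homogeneous_tdeg)

lemma homogeneous_Const [simp]: "homogeneous 0 (Const c)"
  by (simp add: homogeneous_tdeg Const_def)

lemma homogeneous_1 [simp]: "homogeneous 0 (1 :: ('v, complex) mpoly)"
  by (simp add: homogeneous_tdeg)

lemma homogeneous_Var [simp]: "homogeneous (Suc 0) (Var v :: ('v, complex) mpoly)"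
  by (simp add: homogeneous_tdeg Var_def)

lemma homogeneous_uminus [simp]: "homogeneous d (- p) \<longleftrightarrow> homogeneous d p"
  for p :: "('v, 'a::ab_group_add) mpoly"
  by (simp add: homogeneous_tdeg keys_def)

lemma homogeneous_add: "homogeneous d p \<Longrightarrow> homogeneous d q \<Longrightarrow> homogeneous d (p + q)"
  using Poly_Mapping.keys_add[of p q] by (auto simp: homogeneous_tdeg)

lemma homogeneous_diff: "homogeneous d p \<Longrightarrow> homogeneous d q \<Longrightarrow> homogeneous d (p - q)"
  for p :: "('v, 'a::ab_group_add) mpoly"
  using homogeneous_add[of d p "- q"] by simp

lemma homogeneous_sum: "(\<And>x. x \<in> A \<Longrightarrow> homogeneous d (f x)) \<Longrightarrow> homogeneous d (sum f A)"
  by (induction A rule: infinite_finite_induct) (auto intro: homogeneous_add)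

lemma homogeneous_mult: "homogeneous d p \<Longrightarrow> homogeneous e q \<Longrightarrow> homogeneous (d + e) (p * q)"
  for p :: "('v, complex) mpoly"
  using keys_mult[of p q] by (fastforce simp: homogeneous_tdeg)

lemma homogeneous_power: "homogeneous d p \<Longrightarrow> homogeneous (k * d) (p ^ k)"
  for p :: "('v, complex) mpoly"
  by (induction k) (auto intro: homogeneous_mult)

section \<open>Homogeneous components\<close>

definition hcomp :: "nat \<Rightarrow> ('v, complex) mpoly \<Rightarrow> ('v, complex) mpoly" where
  "hcomp N p = Poly_Mapping.mapp (\<lambda>s c. if tdeg s = N then c else 0) p"

lemma lookup_hcomp: "lookup (hcomp N p) s = (if tdeg s = N then lookup p s else 0)"
  by (auto simp: hcomp_def lookup_mapp when_def in_keys_iff)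

lemma keys_hcomp: "keys (hcomp N p) = {s\<in>keys p. tdeg s = N}"
  by (auto simp: in_keys_iff lookup_hcomp split: if_splits)

lemma homogeneous_hcomp [simp]: "homogeneous N (hcomp N p)"
  by (simp add: homogeneous_tdeg keys_hcomp)

lemma Pol_hcomp [simp, intro]: "p \<in> Pol V \<Longrightarrow> hcomp N p \<in> Pol V"
  by (auto simp: Pol_iff keys_hcomp)

lemma hcomp_add: "hcomp N (p + q) = hcomp N p + hcomp N q"
  by (auto intro!: poly_mapping_eqI simp: lookup_hcomp lookup_add)

lemma hcomp_0 [simp]: "hcomp N 0 = 0"
  by (auto intro!: poly_mapping_eqI simp: lookup_hcomp)

lemma hcomp_sum: "hcomp N (sum f A) = (\<Sum>x\<in>A. hcomp N (f x))"
  by (induction A rule: infinite_finite_induct) (auto simp: hcomp_add)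

lemma hcomp_homogeneous: "homogeneous d p \<Longrightarrow> hcomp N p = (if N = d then p else 0)"
  by (intro poly_mapping_eqI) (auto simp: lookup_hcomp homogeneous_tdeg in_keys_iff)

lemma sum_hcomp:
  assumes "finite A" "tdeg ` keys p \<subseteq> A"
  shows "p = (\<Sum>N\<in>A. hcomp N p)"
proof (rule poly_mapping_eqI)
  fix s
  show "lookup p s = lookup (\<Sum>N\<in>A. hcomp N p) s"
    using assms by (cases "s \<in> keys p") (auto simp: lookup_sum lookup_hcomp in_keys_iff)
qed

lemma hcomp_mult: "hcomp N (p * q) = (\<Sum>a\<le>N. hcomp a p * hcomp (N - a) q)"
proof -
  \<comment> \<open>One index set for both factors; it includes \<open>{..N}\<close> so that the
    partner degree \<open>N - a\<close> is always available.\<close>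
  define A where "A = tdeg ` keys p \<union> tdeg ` keys q \<union> {..N}"
  have A: "finite A" "tdeg ` keys p \<subseteq> A" "tdeg ` keys q \<subseteq> A"
    by (auto simp: A_def)
  have "hcomp N (p * q) = hcomp N ((\<Sum>a\<in>A. hcomp a p) * (\<Sum>b\<in>A. hcomp b q))"
    by (simp flip: sum_hcomp[OF A(1,2)] sum_hcomp[OF A(1,3)])
  also have "\<dots> = (\<Sum>a\<in>A. \<Sum>b\<in>A. if N = a + b then hcomp a p * hcomp b q else 0)"
    unfolding sum_product hcomp_sum
    by (intro sum.cong refl hcomp_homogeneous[OF homogeneous_mult]) auto
  also have "\<dots> = (\<Sum>a\<in>A. if a \<le> N then hcomp a p * hcomp (N - a) q else 0)"
  proof (rule sum.cong[OF refl])
    fix a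
    have "(\<Sum>b\<in>A. if N = a + b then hcomp a p * hcomp b q else 0) =
      (\<Sum>b\<in>A. if b = N - a then (if a \<le> N then hcomp a p * hcomp (N - a) q else 0) else 0)"
      by (rule sum.cong) auto
    also have "\<dots> = (if a \<le> N then hcomp a p * hcomp (N - a) q else 0)"
      using A(1) by (auto simp: A_def)
    finally show "(\<Sum>b\<in>A. if N = a + b then hcomp a p * hcomp b q else 0) = \<dots>" .
  qed
  also have "\<dots> = (\<Sum>a\<in>{..N}. hcomp a p * hcomp (N - a) q)"
    using A(1) by (subst sum.inter_filter[symmetric]) (auto simp: A_def intro!: sum.cong)
  finally show ?thesis .
qed

lemma hcomp_homogeneous_mult:
  assumes "homogeneous d p"
  shows "hcomp N (p * q) = (if d \<le> N then p * hcomp (N - d) q else 0)"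
proof -
  have "hcomp N (p * q) = (\<Sum>a\<le>N. if a = d then p * hcomp (N - d) q else 0)"
    unfolding hcomp_mult by (intro sum.cong) (auto simp: hcomp_homogeneous[OF assms])
  then show ?thesis by simp
qed

subsection \<open>Ideals\<close>

lemma minus_mpoly_ring: "p \<in> Pol V \<Longrightarrow> \<ominus>\<^bsub>mpoly_ring V\<^esub> p = - p"
proof -
  interpret cring "mpoly_ring V" by (rule cring_mpoly_ring)
  assume "p \<in> Pol V"
  then show ?thesis
    using minus_equality[of "- p" p] by simp
qed

lemma ideal_mpoly_iff:
  "ideal I (mpoly_ring V) \<longleftrightarrow> I \<subseteq> Pol V \<and> 0 \<in> I \<and> (\<forall>p\<in>I. \<forall>q\<in>I. p + q \<in> I) \<and> (\<forall>p\<in>Pol V. \<forall>q\<in>I. p * q \<in> I)"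
proof
  assume "ideal I (mpoly_ring V)"
  then interpret ideal I "mpoly_ring V" .
  show "I \<subseteq> Pol V \<and> 0 \<in> I \<and> (\<forall>p\<in>I. \<forall>q\<in>I. p + q \<in> I) \<and> (\<forall>p\<in>Pol V. \<forall>q\<in>I. p * q \<in> I)"
    using a_subset I_l_closed additive_subgroup.zero_closed[OF is_additive_subgroup]
      additive_subgroup.a_closed[OF is_additive_subgroup] by auto
next
  interpret cring "mpoly_ring V" by (rule cring_mpoly_ring)
  assume I: "I \<subseteq> Pol V \<and> 0 \<in> I \<and> (\<forall>p\<in>I. \<forall>q\<in>I. p + q \<in> I) \<and> (\<forall>p\<in>Pol V. \<forall>q\<in>I. p * q \<in> I)"
  then have neg: "- p \<in> I" if "p \<in> I" for p
    using that mult_minus_left[of 1 p] by (metis Pol_1 Pol_uminus mult_1)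
  show "ideal I (mpoly_ring V)"
  proof (rule idealI[OF ring_axioms])
    show "subgroup I (add_monoid (mpoly_ring V))"
    proof (rule add.subgroupI)
      show "\<ominus>\<^bsub>mpoly_ring V\<^esub> p \<in> I" if "p \<in> I" for p
        using that I neg by (subst minus_mpoly_ring) auto
    qed (use I in auto)
  next
    fix a x assume "a \<in> I" "x \<in> Pol V"
    with I have "x * a \<in> I" by blast
    then show "x \<otimes>\<^bsub>mpoly_ring V\<^esub> a \<in> I" "a \<otimes>\<^bsub>mpoly_ring V\<^esub> x \<in> I"
      by (simp_all add: mult.commute)
  qed
qed

lemma
  assumes "ideal I (mpoly_ring V)"
  shows ideal_subset: "p \<in> I \<Longrightarrow> p \<in> Pol V"
    and ideal_0: "0 \<in> I"
    and ideal_add: "p \<in> I \<Longrightarrow> q \<in> I \<Longrightarrow> p + q \<in> I"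
    and ideal_mult: "p \<in> Pol V \<Longrightarrow> q \<in> I \<Longrightarrow> p * q \<in> I"
    and ideal_mult_right: "p \<in> Pol V \<Longrightarrow> q \<in> I \<Longrightarrow> q * p \<in> I"
  using assms by (auto simp: ideal_mpoly_iff mult.commute)

lemma ideal_uminus: "ideal I (mpoly_ring V) \<Longrightarrow> p \<in> I \<Longrightarrow> - p \<in> I"
  using ideal_mult[of I V "- 1" p] by simp

lemma ideal_diff: "ideal I (mpoly_ring V) \<Longrightarrow> p \<in> I \<Longrightarrow> q \<in> I \<Longrightarrow> p - q \<in> I"
  using ideal_add[of I V p "- q"] ideal_uminus by auto

lemma ideal_sum: "ideal I (mpoly_ring V) \<Longrightarrow> (\<And>x. x \<in> A \<Longrightarrow> f x \<in> I) \<Longrightarrow> sum f A \<in> I"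
  by (induction A rule: infinite_finite_induct) (auto intro: ideal_0 ideal_add)

lemma ideal_1_imp: "ideal I (mpoly_ring V) \<Longrightarrow> 1 \<in> I \<Longrightarrow> p \<in> Pol V \<Longrightarrow> p \<in> I"
  using ideal_mult[of I V p 1] by simp

lemma primeideal_mpoly_iff:
  "primeideal P (mpoly_ring V) \<longleftrightarrow> ideal P (mpoly_ring V) \<and> 1 \<notin> P \<and>
     (\<forall>p\<in>Pol V. \<forall>q\<in>Pol V. p * q \<in> P \<longrightarrow> p \<in> P \<or> q \<in> P)"
proof
  assume "primeideal P (mpoly_ring V)"
  then interpret primeideal P "mpoly_ring V" .
  show "ideal P (mpoly_ring V) \<and> 1 \<notin> P \<and>
     (\<forall>p\<in>Pol V. \<forall>q\<in>Pol V. p * q \<in> P \<longrightarrow> p \<in> P \<or> q \<in> P)"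
    using is_ideal I_prime one_imp_carrier I_notcarr by auto
next
  assume *: "ideal P (mpoly_ring V) \<and> 1 \<notin> P \<and>
     (\<forall>p\<in>Pol V. \<forall>q\<in>Pol V. p * q \<in> P \<longrightarrow> p \<in> P \<or> q \<in> P)"
  show "primeideal P (mpoly_ring V)"
    by (rule primeidealI[OF _ cring_mpoly_ring]) (use * Pol_1 in auto)
qed

lemma
  assumes "primeideal P (mpoly_ring V)"
  shows prime_ideal: "ideal P (mpoly_ring V)"
    and prime_1: "1 \<notin> P"
    and prime_mult: "p \<in> Pol V \<Longrightarrow> q \<in> Pol V \<Longrightarrow> p * q \<in> P \<Longrightarrow> p \<in> P \<or> q \<in> P"
  using assms by (auto simp: primeideal_mpoly_iff)

lemma prime_power:
  assumes "primeideal P (mpoly_ring V)" "p \<in> Pol V" "p \<notin> P"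
  shows "p ^ k \<notin> P"
  using assms by (induction k) (auto simp: prime_1 dest: prime_mult[OF assms(1)] intro: Pol_power)

lemma genideal_induct [consumes 2, case_names gen 0 add mult]:
  assumes "p \<in> genideal (mpoly_ring V) A" "A \<subseteq> Pol V"
    and "\<And>p. p \<in> A \<Longrightarrow> P p" "P 0" "\<And>p q. p \<in> Pol V \<Longrightarrow> q \<in> Pol V \<Longrightarrow> P p \<Longrightarrow> P q \<Longrightarrow> P (p + q)"
    "\<And>p q. p \<in> Pol V \<Longrightarrow> q \<in> Pol V \<Longrightarrow> P q \<Longrightarrow> P (p * q)"
  shows "P p"
proof -
  interpret cring "mpoly_ring V" by (rule cring_mpoly_ring)
  have "ideal {p \<in> Pol V. P p} (mpoly_ring V)"
    using assms by (auto simp: ideal_mpoly_iff)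
  then have "genideal (mpoly_ring V) A \<subseteq> {p \<in> Pol V. P p}"
    by (rule genideal_minimal) (use assms in auto)
  then show ?thesis using assms by auto
qed

lemma genideal_ideal: "A \<subseteq> Pol V \<Longrightarrow> ideal (genideal (mpoly_ring V) A) (mpoly_ring V)"
  and genideal_gen: "A \<subseteq> Pol V \<Longrightarrow> p \<in> A \<Longrightarrow> p \<in> genideal (mpoly_ring V) A"
  using ring.genideal_ideal[of "mpoly_ring V" A] ring.genideal_self[of "mpoly_ring V" A] cring_mpoly_ring[of V]
  by (auto simp: cring_def)

definition hom_ideal :: "'v set \<Rightarrow> ('v, complex) mpoly set \<Rightarrow> bool" where
  "hom_ideal V I \<longleftrightarrow> ideal I (mpoly_ring V) \<and> (\<forall>p\<in>I. \<forall>N. hcomp N p \<in> I)"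

lemma hom_ideal_genideal:
  assumes "A \<subseteq> Pol V" "\<And>p. p \<in> A \<Longrightarrow> \<exists>d. homogeneous d p"
  shows "hom_ideal V (genideal (mpoly_ring V) A)"
proof -
  let ?I = "genideal (mpoly_ring V) A"
  note I = genideal_ideal[OF assms(1)]
  have "\<forall>N. hcomp N p \<in> ?I" if "p \<in> ?I" for p
    using that assms(1)
  proof (induction rule: genideal_induct)
    case (gen p)
    with assms(2) obtain d where "homogeneous d p" by blast
    with gen show ?case
      using genideal_gen[OF assms(1)] ideal_0[OF I] by (simp add: hcomp_homogeneous)
  qed (auto simp: hcomp_add hcomp_mult ideal_0[OF I] intro!: ideal_add[OF I] ideal_sum[OF I] ideal_mult[OF I] Pol_hcomp)
  with I show ?thesis by (auto simp: hom_ideal_def)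
qed

subsection \<open>Spans modulo an ideal\<close>

interpretation mp: vector_space "\<lambda>c p :: ('v, complex) mpoly. Const c * p"
  by unfold_locales (auto simp: Const_add Const_mult algebra_simps)

lemma ideal_subspace: "ideal I (mpoly_ring V) \<Longrightarrow> mp.subspace I"
  by (auto simp: mp.subspace_def ideal_0 ideal_add ideal_mult)

lemma ideal_span: "ideal I (mpoly_ring V) \<Longrightarrow> mp.span I = I"
  by (simp add: ideal_subspace)

lemma Pol_subspace: "mp.subspace (Pol V)"
  by (auto simp: mp.subspace_def)

lemma homogeneous_subspace: "mp.subspace {p :: ('v, complex) mpoly. homogeneous d p}"
  using homogeneous_mult[of 0 "Const _"] by (auto simp: mp.subspace_def homogeneous_add)

lemma span_Un_ideal:
  assumes "ideal I (mpoly_ring V)" "p \<in> mp.span (B \<union> I)"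
  obtains b i where "b \<in> mp.span B" "i \<in> I" "p = b + i"
  using assms by (auto simp: mp.span_Un ideal_span)

lemma span_mult_left:
  assumes "p \<in> mp.span A" "\<And>a. a \<in> A \<Longrightarrow> q * a \<in> mp.span B"
  shows "q * p \<in> mp.span B"
  using assms(1)
proof (induction rule: mp.span_induct_alt)
  case base
  then show ?case by (simp add: mp.span_zero)
next
  case (step c x y)
  then show ?case
    using mp.span_add[OF mp.span_scale[OF assms(2)[of x], of c]] by (simp add: algebra_simps)
qed

lemma mpoly_in_span:
  assumes "\<And>s. s \<in> keys p \<Longrightarrow> mon s \<in> mp.span B"
  shows "p \<in> mp.span B"
  by (subst mpoly_sum_mon) (intro mp.span_sum mp.span_scale assms)

text \<open>Replace each \<open>e x\<close> by a representative in the span of B. A linear relation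
  among representatives is a relation modulo I, so they are distinct and independent, and the
  exchange lemma bounds their number.\<close>

lemma card_le_of_independent_mod:
  assumes "ideal I (mpoly_ring V)" "finite K" "finite B" "\<And>x. x \<in> K \<Longrightarrow> e x \<in> mp.span (B \<union> I)"
    and indep: "\<And>c. (\<Sum>x\<in>K. Const (c x) * e x) \<in> I \<Longrightarrow> \<forall>x\<in>K. c x = 0"
  shows "card K \<le> card B"
proof -
  have "\<exists>b. b \<in> mp.span B \<and> e x - b \<in> I" if x: "x \<in> K" for x
    using span_Un_ideal[OF assms(1) assms(4)[OF x]] by (metis add_diff_cancel_left')
  then obtain b where b: "\<And>x. x \<in> K \<Longrightarrow> b x \<in> mp.span B" "\<And>x. x \<in> K \<Longrightarrow> e x - b x \<in> I"
    by metis
  have *: "\<forall>x\<in>K. c x = 0" if "(\<Sum>x\<in>K. Const (c x) * b x) = 0" for c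
  proof (rule indep)
    have "(\<Sum>x\<in>K. Const (c x) * e x) = (\<Sum>x\<in>K. Const (c x) * (e x - b x)) + (\<Sum>x\<in>K. Const (c x) * b x)"
      by (simp add: algebra_simps flip: sum.distrib)
    also have "\<dots> \<in> I"
      unfolding that using b(2) by (auto intro!: ideal_sum[OF assms(1)] ideal_mult[OF assms(1)])
    finally show "(\<Sum>x\<in>K. Const (c x) * e x) \<in> I" .
  qed
  have inj: "inj_on b K"
  proof (rule inj_onI, rule ccontr)
    fix x y assume xy: "x \<in> K" "y \<in> K" "b x = b y" "x \<noteq> y"
    let ?c = "\<lambda>z. if z = x then 1 else if z = y then - 1 else 0"
    have "(\<Sum>z\<in>K. Const (?c z) * b z) = (\<Sum>z\<in>{x, y}. Const (?c z) * b z)"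
      using xy assms(2) by (intro sum.mono_neutral_right) auto
    also have "\<dots> = 0"
      using xy by (simp add: Const_uminus)
    finally show False
      using *[of ?c] xy by auto
  qed
  have "mp.independent (b ` K)"
  proof (rule mp.independent_if_scalars_zero)
    fix f x assume f: "(\<Sum>x\<in>b ` K. Const (f x) * x) = 0" and x: "x \<in> b ` K"
    have "(\<Sum>x\<in>K. Const (f (b x)) * b x) = 0"
      using f by (simp add: sum.reindex[OF inj])
    from *[OF this] x show "f x = 0" by auto
  qed (use assms in auto)
  then have "card (b ` K) \<le> card B"
    using mp.independent_span_bound[of B "b ` K"] assms(3) b(1) by auto
  then show ?thesis by (simp add: card_image[OF inj])
qed

subsection \<open>Chains of primes and linear independence\<close>

definition prime_chain :: "'v set \<Rightarrow> ('v, complex) mpoly set \<Rightarrow> nat \<Rightarrow> (nat \<Rightarrow> ('v, complex) mpoly set) \<Rightarrow> bool" where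
  "prime_chain V I l P \<longleftrightarrow> (\<forall>i\<le>l. primeideal (P i) (mpoly_ring V) \<and> I \<subseteq> P i) \<and> (\<forall>i<l. P i \<subset> P (Suc i))"

text \<open>The elements separating two primes of a chain need not be homogeneous, so the counting
  of their products uses the filtration by degree instead of the grading.\<close>

definition dle :: "nat \<Rightarrow> ('v, complex) mpoly \<Rightarrow> bool" where
  "dle N p \<longleftrightarrow> (\<forall>s\<in>keys p. tdeg s \<le> N)"

lemma dle_mult: "dle M p \<Longrightarrow> dle N q \<Longrightarrow> dle (M + N) (p * q)"
  using keys_mult[of p q] by (fastforce simp: dle_def intro: add_mono)

lemma dle_1 [simp]: "dle M 1"
  by (simp add: dle_def)

lemma dle_power: "dle M p \<Longrightarrow> dle (k * M) (p ^ k)"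
  by (induction k) (auto intro: dle_mult)

lemma dle_mono: "dle M p \<Longrightarrow> M \<le> N \<Longrightarrow> dle N p"
  by (auto simp: dle_def)

lemma ex_dle: "\<exists>M. dle M p"
  by (rule exI[of _ "\<Sum>s\<in>keys p. tdeg s"]) (auto simp: dle_def intro!: member_le_sum)

fun power_product :: "('v, complex) mpoly list \<Rightarrow> nat list \<Rightarrow> ('v, complex) mpoly" where
  "power_product (g # gs) (k # ks) = g ^ k * power_product gs ks"
| "power_product _ _ = 1"

lemma power_product_Pol: "set gs \<subseteq> Pol V \<Longrightarrow> power_product gs ks \<in> Pol V"
  by (induction gs ks rule: power_product.induct) auto

lemma power_product_dle:
  assumes "\<forall>g\<in>set gs. dle D g" "set ks \<subseteq> {..N}" "length ks = length gs"
  shows "dle (length gs * (N * D)) (power_product gs ks)"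
  using assms
proof (induction gs ks rule: power_product.induct)
  case (1 g gs k ks)
  then have "dle (N * D) (g ^ k)"
    by (auto intro: dle_mono[OF dle_power])
  from dle_mult[OF this 1(1)] 1 show ?case by auto
qed auto

text \<open>Modulo Q only the term \<open>h 0\<close> survives, so it vanishes. What remains is
  divisible by g, which can be cancelled because P is prime and g lies outside it; then
  repeat.\<close>

lemma prime_powers_independent:
  assumes "primeideal P (mpoly_ring V)" "P \<subset> Q" "g \<in> Pol V" "g \<notin> P" "g \<in> Q" "ideal Q (mpoly_ring V)"
    and "\<And>k. h k \<in> Pol V" "\<And>k. h k \<in> Q \<Longrightarrow> h k = 0"
    and "(\<Sum>k\<le>N. g ^ k * h k) \<in> P"
  shows "\<forall>k\<le>N. h k = 0"
  using assms(7-)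
proof (induction N arbitrary: h)
  case 0
  then show ?case using assms(2) by auto
next
  case (Suc N)
  define r where "r = (\<Sum>k\<le>N. g ^ k * h (Suc k))"
  have r: "r \<in> Pol V"
    unfolding r_def using Suc(2) assms(3) by (intro Pol_sum Pol_mult Pol_power)
  have eq: "(\<Sum>k\<le>Suc N. g ^ k * h k) = h 0 + r * g"
    unfolding sum.atMost_Suc_shift r_def sum_distrib_right by (simp add: algebra_simps)
  have "h 0 + r * g \<in> Q"
    using Suc(4) assms(2) unfolding eq by blast
  from ideal_diff[OF assms(6) this ideal_mult[OF assms(6) r assms(5)]] have h0: "h 0 = 0"
    using Suc(3) by simp
  have "r \<in> P"
    using prime_mult[OF assms(1) r assms(3)] Suc(4) assms(4) unfolding eq h0 by simp
  then have "\<forall>k\<le>N. h (Suc k) = 0"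
    unfolding r_def using Suc by (intro Suc.IH) auto
  with h0 show ?case
    using le_Suc_eq less_Suc_eq_0_disj by (metis not0_implies_Suc Suc_le_mono)
qed

text \<open>An element of \<open>P 1\<close> outside \<open>P 0\<close> is put in front of a list
  already independent modulo \<open>P 1\<close>. Sorted by powers of the new element, a relation
  modulo \<open>P 0\<close> has coefficients that are combinations of the old products, so a
  coefficient in \<open>P 1\<close> is zero. Exponents fill a box to make the products easy to
  count.\<close>

lemma prime_chain_power_products:
  assumes "prime_chain V I l P"
  shows "\<exists>gs. length gs = l \<and> set gs \<subseteq> Pol V \<and>
    (\<forall>N c. (\<Sum>ks | set ks \<subseteq> {..N} \<and> length ks = l. Const (c ks) * power_product gs ks) \<in> P 0 \<longrightarrow>
      (\<forall>ks. set ks \<subseteq> {..N} \<and> length ks = l \<longrightarrow> c ks = 0))"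
  using assms
proof (induction l arbitrary: P)
  case 0
  have prime: "primeideal (P 0) (mpoly_ring V)"
    using 0 by (auto simp: prime_chain_def)
  have eq: "{ks. ks = [] \<and> set ks \<subseteq> {..N}} = {[]}" for N :: nat
    by auto
  have "c [] = 0" if "Const (c []) \<in> P 0" for c :: "nat list \<Rightarrow> complex"
  proof (rule ccontr)
    assume "c [] \<noteq> 0"
    then have "Const (1 / c []) * Const (c []) = (1 :: ('a, complex) mpoly)"
      by (simp flip: Const_mult)
    then show False
      using ideal_mult[OF prime_ideal[OF prime] Pol_Const that, of "1 / c []"] prime_1[OF prime] by metis
  qed
  then show ?case by (intro exI[of _ "[]"]) (simp add: eq)
next
  case (Suc l)
  define Q where "Q = P 1"
  have P: "primeideal (P 0) (mpoly_ring V)" and Q: "primeideal Q (mpoly_ring V)" and sub: "P 0 \<subset> Q"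
    using Suc(2) by (auto simp: prime_chain_def Q_def)
  have "prime_chain V I l (\<lambda>i. P (Suc i))"
    using Suc(2) by (auto simp: prime_chain_def)
  from Suc(1)[OF this] obtain gs where gs: "length gs = l" "set gs \<subseteq> Pol V"
    and indep: "\<And>N c ks. (\<Sum>ks | set ks \<subseteq> {..N} \<and> length ks = l. Const (c ks) * power_product gs ks) \<in> Q \<Longrightarrow>
      set ks \<subseteq> {..N} \<and> length ks = l \<Longrightarrow> c ks = 0"
    unfolding Q_def by force
  from sub obtain g where g: "g \<in> Q" "g \<notin> P 0" by blast
  then have gV: "g \<in> Pol V"
    using ideal_subset[OF prime_ideal[OF Q]] by blast
  have "c ks = 0" if c: "(\<Sum>ks | set ks \<subseteq> {..N} \<and> length ks = Suc l. Const (c ks) * power_product (g # gs) ks) \<in> P 0"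
    and ks: "set ks \<subseteq> {..N}" "length ks = Suc l" for N c ks
  proof -
    let ?K = "{ks. set ks \<subseteq> {..N} \<and> length ks = l}"
    define h where "h k = (\<Sum>ks\<in>?K. Const (c (k # ks)) * power_product gs ks)" for k
    have hV: "h k \<in> Pol V" for k
      unfolding h_def using gs by (intro Pol_sum Pol_mult power_product_Pol Pol_Const)
    have hQ: "h k = 0" if "h k \<in> Q" for k
      using indep[where N = N and c = "\<lambda>ks. c (k # ks)"] that unfolding h_def by (intro sum.neutral) auto
    have bij: "bij_betw (\<lambda>(k, ks). k # ks) ({..N} \<times> ?K) {ks. set ks \<subseteq> {..N} \<and> length ks = Suc l}"
      by (rule bij_betwI[of _ _ _ "\<lambda>ks. (hd ks, tl ks)"]) (auto simp: length_Suc_conv)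
    have "(\<Sum>k\<le>N. g ^ k * h k) = (\<Sum>(k, ks)\<in>{..N} \<times> ?K. Const (c (k # ks)) * power_product (g # gs) (k # ks))"
      unfolding h_def sum_distrib_left sum.cartesian_product by (intro sum.cong) (auto simp: algebra_simps)
    also have "\<dots> = (\<Sum>ks | set ks \<subseteq> {..N} \<and> length ks = Suc l. Const (c ks) * power_product (g # gs) ks)"
      by (subst sum.reindex_bij_betw[OF bij, symmetric]) (simp add: case_prod_unfold)
    finally have "(\<Sum>k\<le>N. g ^ k * h k) \<in> P 0"
      using c by simp
    from prime_powers_independent[OF P sub gV g(2,1) prime_ideal[OF Q], of h, OF hV hQ this]
    have "\<forall>k\<le>N. h k = 0" .
    moreover obtain k ks' where "ks = k # ks'"
      using ks(2) by (cases ks) auto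
    ultimately show "c ks = 0"
      using indep[where N = N and c = "\<lambda>ks. c (k # ks)" and ks = ks'] ks ideal_0[OF prime_ideal[OF Q]]
      by (auto simp: h_def)
  qed
  then show ?case
    using gs gV by (intro exI[of _ "g # gs"]) auto
qed

lemma power_growth_le:
  fixes C :: nat
  assumes "\<And>N. (N + 1) ^ l \<le> C * (N * D + 1) ^ \<delta>"
  shows "l \<le> \<delta>"
proof (rule ccontr)
  assume "\<not> l \<le> \<delta>"
  then have l: "l = \<delta> + Suc (l - \<delta> - 1)" by simp
  \<comment> \<open>With this value \<open>C * ((D + 1) * (N + 1)) ^ \<delta>\<close> is
    \<open>N * (N + 1) ^ \<delta>\<close>, strictly below
    \<open>(N + 1) ^ (\<delta> + 1)\<close>.\<close>
  define N where "N = C * (D + 1) ^ \<delta>"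
  have "(N + 1) ^ (\<delta> + 1) \<le> (N + 1) ^ l"
    using l by (intro power_increasing) auto
  also have "\<dots> \<le> C * (N * D + 1) ^ \<delta>" by (rule assms)
  also have "\<dots> \<le> C * ((D + 1) * (N + 1)) ^ \<delta>"
    by (intro mult_left_mono power_mono) (auto simp: algebra_simps)
  also have "\<dots> = N * (N + 1) ^ \<delta>"
    unfolding N_def power_mult_distrib by (simp only: mult_ac)
  also have "\<dots> < (N + 1) ^ (\<delta> + 1)" by simp
  finally show False by simp
qed

text \<open>The multiplier u plays the role of a common denominator: outside the prime
  \<open>P 0\<close>, multiplication by it is injective modulo \<open>P 0\<close> and preserves
  independence. The box of exponents gives (N + 1)^l products whose degree is linear in N, which a
  growth of order \<delta> can hold only if l is at most \<delta>.\<close>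

lemma prime_chain_length_le:
  assumes "prime_chain V I l P"
    and bound: "\<And>N. \<exists>u B. u \<in> Pol V \<and> u \<notin> P 0 \<and> finite B \<and> card B \<le> C * (N + 1) ^ \<delta> \<and>
      (\<forall>p\<in>Pol V. dle N p \<longrightarrow> u * p \<in> mp.span (B \<union> P 0))"
  shows "l \<le> \<delta>"
proof -
  have P: "primeideal (P 0) (mpoly_ring V)"
    using assms by (auto simp: prime_chain_def)
  from prime_chain_power_products[OF assms(1)] obtain gs where gs: "length gs = l" "set gs \<subseteq> Pol V"
    and indep: "\<And>N c ks. (\<Sum>ks | set ks \<subseteq> {..N} \<and> length ks = l. Const (c ks) * power_product gs ks) \<in> P 0 \<Longrightarrow>
      set ks \<subseteq> {..N} \<and> length ks = l \<Longrightarrow> c ks = 0"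
    by force
  have "\<forall>g\<in>set gs. \<exists>D. dle D g" using ex_dle by blast
  then obtain Df where Df: "\<And>g. g \<in> set gs \<Longrightarrow> dle (Df g) g" by metis
  define D where "D = (\<Sum>g\<in>set gs. Df g)"
  have D: "\<forall>g\<in>set gs. dle D g"
    unfolding D_def by (auto intro!: dle_mono[OF Df] member_le_sum)
  have "(N + 1) ^ l \<le> C * (N * (l * D) + 1) ^ \<delta>" for N
  proof -
    let ?K = "{ks. set ks \<subseteq> {..N} \<and> length ks = l}"
    from bound[of "l * (N * D)"] obtain u B where u: "u \<in> Pol V" "u \<notin> P 0" "finite B"
      "card B \<le> C * (l * (N * D) + 1) ^ \<delta>" "\<And>p. p \<in> Pol V \<Longrightarrow> dle (l * (N * D)) p \<Longrightarrow> u * p \<in> mp.span (B \<union> P 0)"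
      by blast
    have "card ?K \<le> card B"
    proof (rule card_le_of_independent_mod[OF prime_ideal[OF P]])
      show "u * power_product gs ks \<in> mp.span (B \<union> P 0)" if "ks \<in> ?K" for ks
        using that power_product_dle[OF D, of ks N] gs by (intro u) (auto intro: power_product_Pol)
      fix c assume "(\<Sum>ks\<in>?K. Const (c ks) * (u * power_product gs ks)) \<in> P 0"
      moreover have "(\<Sum>ks\<in>?K. Const (c ks) * (u * power_product gs ks)) =
          u * (\<Sum>ks\<in>?K. Const (c ks) * power_product gs ks)"
        by (simp add: sum_distrib_left algebra_simps)
      moreover have Pol: "(\<Sum>ks\<in>?K. Const (c ks) * power_product gs ks) \<in> Pol V"
        using gs by (intro Pol_sum Pol_mult power_product_Pol Pol_Const)
      ultimately have "(\<Sum>ks\<in>?K. Const (c ks) * power_product gs ks) \<in> P 0"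
        using prime_mult[OF P u(1) Pol] u(2) by simp
      from indep[OF this] show "\<forall>ks\<in>?K. c ks = 0" by simp
    qed (use u finite_lists_length_eq[of "{..N}" l] in auto)
    then show ?thesis
      using u(4) card_lists_length_eq[of "{..N}" l] by (simp add: algebra_simps)
  qed
  then show ?thesis by (rule power_growth_le)
qed

subsection \<open>The ascending chain condition\<close>

lemma monotone_subsequence_nat:
  fixes s :: "nat \<Rightarrow> nat"
  shows "\<exists>f. strict_mono f \<and> incseq (\<lambda>k. s (f k))"
proof -
  obtain f where f: "strict_mono f" "monoseq (\<lambda>k. s (f k))"
    using seq_monosub by blast
  show ?thesis
  proof (cases "incseq (\<lambda>k. s (f k))")
    case False
    then have dec: "\<And>i j. i \<le> j \<Longrightarrow> s (f j) \<le> s (f i)"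
      using f(2) by (auto simp: monoseq_def incseq_def)
    \<comment> \<open>A decreasing sequence of natural numbers is constant from its least value
      on.\<close>
    obtain K where K: "\<And>k. s (f K) \<le> s (f k)"
      using ex_has_least_nat[of "\<lambda>_. True" 0 "\<lambda>k. s (f k)"] by auto
    have "s (f (k + K)) = s (f K)" for k
      using dec[of K "k + K"] K by (auto intro: antisym)
    then have "incseq (\<lambda>k. s (f (k + K)))" by simp
    moreover have "strict_mono (\<lambda>k. f (k + K))"
      using f(1) by (auto simp: strict_mono_def)
    ultimately show ?thesis by blast
  qed (use f in blast)
qed

lemma dickson_subsequence:
  fixes s :: "nat \<Rightarrow> 'v \<Rightarrow>\<^sub>0 nat"
  assumes "finite V"
  shows "\<exists>f. strict_mono f \<and> (\<forall>v\<in>V. incseq (\<lambda>k. lookup (s (f k)) v))"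
  using assms
proof (induction V)
  case empty
  show ?case by (intro exI[of _ id]) (auto simp: strict_mono_def)
next
  case (insert v V)
  then obtain f where f: "strict_mono f" "\<forall>v\<in>V. incseq (\<lambda>k. lookup (s (f k)) v)" by blast
  obtain g where g: "strict_mono g" "incseq (\<lambda>k. lookup (s (f (g k))) v)"
    using monotone_subsequence_nat[of "\<lambda>k. lookup (s (f k)) v"] by blast
  have "incseq (\<lambda>k. lookup (s (f (g k))) w)" if "w \<in> V" for w
    using f(2) that g(1) unfolding incseq_def by (simp add: strict_mono_less_eq)
  then show ?case
    using f(1) g by (intro exI[of _ "\<lambda>k. f (g k)"]) (auto simp: strict_mono_def)
qed

lemma lookup_outside: "keys s \<subseteq> V \<Longrightarrow> v \<notin> V \<Longrightarrow> lookup s v = 0"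
  by (auto simp: in_keys_iff)

lemma dickson:
  fixes s :: "nat \<Rightarrow> 'v \<Rightarrow>\<^sub>0 nat"
  assumes "finite V" "\<And>k. keys (s k) \<subseteq> V"
  obtains i j t where "i < j" "s j = t + s i"
proof -
  obtain f where f: "strict_mono f" "\<And>v. v \<in> V \<Longrightarrow> incseq (\<lambda>k. lookup (s (f k)) v)"
    using dickson_subsequence[OF assms(1)] by blast
  have "s (f 1) = (s (f 1) - s (f 0)) + s (f 0)"
  proof (rule poly_mapping_eqI)
    fix v
    have "lookup (s (f 0)) v \<le> lookup (s (f 1)) v"
      using f(2)[of v] lookup_outside[OF assms(2), of v] by (cases "v \<in> V") (auto simp: incseq_def)
    then show "lookup (s (f 1)) v = lookup (s (f 1) - s (f 0) + s (f 0)) v"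
      by (simp add: lookup_add lookup_minus)
  qed
  moreover have "f 0 < f 1" using f(1) by (simp add: strict_mono_def)
  ultimately show ?thesis using that by blast
qed

lemma lookup_mon_mult_add [simp]: "lookup (mon t * p) (t + s) = lookup p s"
proof -
  have "mon t * p = (\<Sum>u\<in>keys p. Const (lookup p u) * mon (t + u))"
    by (subst (2) mpoly_sum_mon) (simp add: sum_distrib_left mon_add algebra_simps)
  then have "lookup (mon t * p) (t + s) = (\<Sum>u\<in>keys p. lookup p u * (if u = s then 1 else 0))"
    by (simp add: lookup_sum lookup_single when_def)
  also have "\<dots> = (\<Sum>u\<in>keys p. if u = s then lookup p s else 0)"
    by (rule sum.cong) auto
  finally show ?thesis by (simp add: in_keys_iff)
qed

lemma finite_monomials: "finite V \<Longrightarrow> finite {s :: 'v \<Rightarrow>\<^sub>0 nat. keys s \<subseteq> V \<and> tdeg s \<le> N}"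
  and card_monomials: "finite V \<Longrightarrow> card {s :: 'v \<Rightarrow>\<^sub>0 nat. keys s \<subseteq> V \<and> tdeg s \<le> N} \<le> (N + 1) ^ card V"
proof -
  assume V: "finite V"
  let ?A = "{s :: 'v \<Rightarrow>\<^sub>0 nat. keys s \<subseteq> V \<and> tdeg s \<le> N}"
  have inj: "inj_on (\<lambda>s. restrict (lookup s) V) ?A"
  proof (intro inj_onI poly_mapping_eqI)
    fix s t v assume st: "s \<in> ?A" "t \<in> ?A" and eq: "restrict (lookup s) V = restrict (lookup t) V"
    show "lookup s v = lookup t v"
    proof (cases "v \<in> V")
      case True
      have "restrict (lookup s) V v = restrict (lookup t) V v" by (simp only: eq)
      with True show ?thesis by (simp only: restrict_apply')
    qed (use st in \<open>auto simp: lookup_outside\<close>)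
  qed
  have sub: "(\<lambda>s. restrict (lookup s) V) ` ?A \<subseteq> V \<rightarrow>\<^sub>E {..N}"
    by (auto intro: order_trans[OF lookup_le_tdeg])
  show "finite ?A"
    using inj sub finite_PiE[OF V, of "\<lambda>_. {..N}"] by (meson finite_atMost inj_on_finite)
  show "card ?A \<le> (N + 1) ^ card V"
    using card_inj_on_le[OF inj sub] finite_PiE[OF V, of "\<lambda>_. {..N}"] card_PiE[OF V, of "\<lambda>_. {..N}"]
    by simp
qed

section \<open>Ascending chains of homogeneous ideals\<close>

lemma hom_idealD:
  assumes "hom_ideal V I"
  shows "ideal I (mpoly_ring V)" "p \<in> I \<Longrightarrow> hcomp N p \<in> I"
  using assms by (auto simp: hom_ideal_def)

lemma ideal_hcompI:
  assumes "ideal I (mpoly_ring V)" "\<And>N. hcomp N p \<in> I"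
  shows "p \<in> I"
  by (subst sum_hcomp[of "tdeg ` keys p"]) (auto intro: ideal_sum assms)

text \<open>Choosing homogeneous elements of successive differences with least leading monomial, Dickson's lemma
  lets one of them reduce a later one.\<close>

lemma no_ascending_hom_ideals:
  fixes J :: "nat \<Rightarrow> ('v::linorder, complex) mpoly set"
  assumes "finite V" "\<And>k. hom_ideal V (J k)" "\<And>k. J k \<subset> J (Suc k)"
  shows False
proof -
  note id = hom_idealD(1)[OF assms(2)]
  have mono: "J i \<subseteq> J j" if "i \<le> j" for i j
    using that by (rule lift_Suc_mono_le[rotated]) (use assms(3) in blast)
  \<comment> \<open>\<open>Max\<close> refers to the lexicographic order on exponent functions,
    which is compatible with addition.\<close>
  define lm :: "('v, complex) mpoly \<Rightarrow> 'v \<Rightarrow>\<^sub>0 nat" where "lm p = Max (keys p)" for p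
  have lm_in: "lm p \<in> keys p" if "p \<noteq> 0" for p
    unfolding lm_def using that by (intro Max_in) auto
  have lm_ge: "s \<le> lm p" if "s \<in> keys p" for s p
    unfolding lm_def using that by (intro Max_ge) auto
  \<comment> \<open>Only finitely many monomials share a degree, so \<open>card (below u)\<close> is
    a natural number that ranks u among them and can be minimised.\<close>
  define below where "below u = {s. keys s \<subseteq> V \<and> tdeg s = tdeg u \<and> s < u}" for u
  have fin: "finite (below u)" for u
    by (rule finite_subset[OF _ finite_monomials[OF assms(1), of "tdeg u"]]) (auto simp: below_def)
  define good where "good k p \<longleftrightarrow> p \<in> J (Suc k) - J k \<and> (\<exists>e. homogeneous e p)" for k p
  have "\<exists>p. good k p" for k
  proof -
    obtain p where p: "p \<in> J (Suc k)" "p \<notin> J k" using assms(3) by blast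
    then obtain N where "hcomp N p \<notin> J k" using ideal_hcompI[OF id] by blast
    then have "good k (hcomp N p)"
      using p(1) assms(2)[of "Suc k"] homogeneous_hcomp unfolding good_def hom_ideal_def by blast
    then show ?thesis by blast
  qed
  then have "\<exists>p. good k p \<and> (\<forall>q. good k q \<longrightarrow> card (below (lm p)) \<le> card (below (lm q)))" for k
    using ex_has_least_nat[of "good k" _ "\<lambda>p. card (below (lm p))"] by blast
  then obtain p where p: "\<And>k. good k (p k)"
    and least: "\<And>k q. good k q \<Longrightarrow> card (below (lm (p k))) \<le> card (below (lm q))"
    by metis
  have Pol: "p k \<in> Pol V" for k
    using p ideal_subset[OF id] by (auto simp: good_def)
  have nz: "p k \<noteq> 0" for k
    using p[of k] ideal_0[OF id, of k] by (auto simp: good_def)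
  have lmV: "keys (lm (p k)) \<subseteq> V" for k
    using lm_in[OF nz] Pol by (auto simp: Pol_iff)
  obtain i j t where ij: "i < j" and t: "lm (p j) = t + lm (p i)"
    using dickson[OF assms(1), of "\<lambda>k. lm (p k)"] lmV by blast
  have tV: "keys t \<subseteq> V" using lmV[of j] by (simp add: t keys_add_nat)
  \<comment> \<open>Chosen to cancel the leading term of \<open>p j\<close> against that of the
    multiple of \<open>p i\<close>.\<close>
  define c where "c = lookup (p j) (lm (p j)) / lookup (p i) (lm (p i))"
  define r where "r = Const c * (mon t * p i)"
  define q where "q = p j - r"
  obtain e e' where e: "homogeneous e (p j)" and e': "homogeneous e' (p i)"
    using p unfolding good_def by blast
  have ej: "e = tdeg (lm (p j))" and ei: "e' = tdeg (lm (p i))"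
    using lm_in[OF nz] e e' by (auto simp: homogeneous_tdeg)
  have r_hom: "homogeneous e r"
    unfolding r_def ej t tdeg_add ei[symmetric]
    using homogeneous_mult[OF homogeneous_Const homogeneous_mult[OF _ e'], of "tdeg t"] by fastforce
  then have q_hom: "homogeneous e q"
    unfolding q_def using e by (intro homogeneous_diff)
  \<comment> \<open>As i < j, the correction r already lies in \<open>J j\<close>; subtracting it
    leaves q in the same difference of ideals as \<open>p j\<close>, but with a smaller leading
    monomial.\<close>
  have "p i \<in> J (Suc i)" using p by (auto simp: good_def)
  then have "r \<in> J (Suc i)"
    unfolding r_def using tV by (intro ideal_mult[OF id]) auto
  then have r: "r \<in> J j" using mono[of "Suc i" j] ij by auto
  have "good j q"
  proof -
    have "q \<in> J (Suc j)"
      unfolding q_def using p[of j] r mono[of j "Suc j"] by (intro ideal_diff[OF id]) (auto simp: good_def)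
    moreover have "q \<notin> J j"
      using ideal_add[OF id _ r, of q] p[of j] by (auto simp: q_def good_def)
    ultimately show ?thesis
      using q_hom by (auto simp: good_def)
  qed
  then have qnz: "q \<noteq> 0" and q_in: "q \<in> Pol V"
    using ideal_0[OF id] ideal_subset[OF id] by (auto simp: good_def)
  have "lookup q (lm (p j)) = 0"
    using lm_in[OF nz, of i] by (simp add: q_def r_def lookup_minus c_def in_keys_iff) (simp add: t)
  moreover have "lm q \<le> lm (p j)"
  proof -
    have "s \<le> lm (p j)" if "s \<in> keys r" for s
    proof -
      from that have "s \<in> keys (mon t * p i)" by (auto simp: r_def in_keys_iff)
      then obtain u where "u \<in> keys (p i)" "s = t + u"
        using keys_mult[of "mon t" "p i"] by auto
      then show ?thesis
        unfolding t using lm_ge by (auto intro: add_left_mono)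
    qed
    moreover have "lm q \<in> keys (p j) \<or> lm q \<in> keys r"
      using lm_in[OF qnz] by (auto simp: q_def in_keys_iff lookup_minus)
    ultimately show ?thesis using lm_ge by blast
  qed
  ultimately have less: "lm q < lm (p j)"
    using lm_in[OF qnz] by (auto simp: in_keys_iff order.order_iff_strict)
  have deg: "tdeg (lm q) = tdeg (lm (p j))"
    using q_hom lm_in[OF qnz] ej by (auto simp: homogeneous_tdeg)
  have "below (lm q) \<subset> below (lm (p j))"
    using less deg lm_in[OF qnz] q_in by (auto simp: below_def Pol_iff)
  then have "card (below (lm q)) < card (below (lm (p j)))"
    by (rule psubset_card_mono[OF fin])
  with least[OF \<open>good j q\<close>] show False by simp
qed

text \<open>The order on the variables is there for the leading monomials; on jet coordinates it is
  the lexicographic order of pairs.\<close>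

lemma wf_hom_ideals:
  fixes V :: "'v::linorder set"
  assumes "finite V"
  shows "wf {(J, I). hom_ideal V J \<and> hom_ideal V I \<and> I \<subset> J}"
  unfolding wf_iff_no_infinite_down_chain
proof
  assume "\<exists>f. \<forall>i. (f (Suc i), f i) \<in> {(J, I). hom_ideal V J \<and> hom_ideal V I \<and> I \<subset> J}"
  then obtain f where "\<And>i. hom_ideal V (f i)" "\<And>i. f i \<subset> f (Suc i)" by blast
  then show False by (rule no_ascending_hom_ideals[OF assms])
qed

subsection \<open>Growth of graded quotients\<close>

text \<open>A bound on the Hilbert function in terms of spanning sets instead of dimensions of
  quotients: I need not be homogeneous, and it may be an ideal of a polynomial ring in more
  variables than V. Counting cumulatively makes products, shifts and the case of growth order 0
  uniform.\<close>

definition hilbert_data ::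
    "'v set \<Rightarrow> ('v, complex) mpoly set \<Rightarrow> nat \<Rightarrow> (nat \<Rightarrow> ('v, complex) mpoly set) \<Rightarrow> nat \<Rightarrow> bool" where
  "hilbert_data V I \<delta> B C \<longleftrightarrow>
     (\<forall>N. finite (B N) \<and> B N \<subseteq> Pol V \<and> (\<forall>b\<in>B N. homogeneous N b)) \<and>
     (\<forall>s. keys s \<subseteq> V \<longrightarrow> mon s \<in> mp.span (B (tdeg s) \<union> I)) \<and>
     (\<forall>N. (\<Sum>j\<le>N. card (B j)) \<le> C * (N + 1) ^ \<delta>)"

definition hilbert_bound :: "'v set \<Rightarrow> ('v, complex) mpoly set \<Rightarrow> nat \<Rightarrow> bool" where
  "hilbert_bound V I \<delta> \<longleftrightarrow> (\<exists>B C. hilbert_data V I \<delta> B C)"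

lemma hilbert_boundI:
  assumes "\<And>N. finite (B N)" "\<And>N b. b \<in> B N \<Longrightarrow> b \<in> Pol V" "\<And>N b. b \<in> B N \<Longrightarrow> homogeneous N b"
    "\<And>s. keys s \<subseteq> V \<Longrightarrow> mon s \<in> mp.span (B (tdeg s) \<union> I)"
    "\<And>N. (\<Sum>j\<le>N. card (B j)) \<le> C * (N + 1) ^ \<delta>"
  shows "hilbert_bound V I \<delta>"
  unfolding hilbert_bound_def hilbert_data_def using assms by (intro exI[of _ B] exI[of _ C]) auto

lemma hilbert_dataD:
  assumes "hilbert_data V I \<delta> B C"
  shows "finite (B N)" "b \<in> B N \<Longrightarrow> b \<in> Pol V" "b \<in> B N \<Longrightarrow> homogeneous N b"
    "keys s \<subseteq> V \<Longrightarrow> mon s \<in> mp.span (B (tdeg s) \<union> I)"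
    "(\<Sum>j\<le>N. card (B j)) \<le> C * (N + 1) ^ \<delta>"
  using assms unfolding hilbert_data_def by blast+

lemma hilbert_data_span:
  assumes "hilbert_data V I \<delta> B C" "p \<in> Pol V" "homogeneous N p"
  shows "p \<in> mp.span (B N \<union> I)"
proof (rule mpoly_in_span)
  fix s assume "s \<in> keys p"
  with assms(2,3) have "keys s \<subseteq> V" "tdeg s = N" by (auto simp: Pol_iff homogeneous_tdeg)
  with hilbert_dataD(4)[OF assms(1), of s] show "mon s \<in> mp.span (B N \<union> I)" by simp
qed

lemma hilbert_bound_free:
  assumes "finite V"
  shows "hilbert_bound V I (card V)"
proof (rule hilbert_boundI[of "\<lambda>N. mon ` {s. keys s \<subseteq> V \<and> tdeg s = N}"])
  let ?M = "\<lambda>N. {s :: 'a \<Rightarrow>\<^sub>0 nat. keys s \<subseteq> V \<and> tdeg s = N}"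
  have fin: "finite (?M N)" for N
    by (rule finite_subset[OF _ finite_monomials[OF assms, of N]]) auto
  then show "finite (mon ` ?M N)" for N by simp
  show "(\<Sum>j\<le>N. card (mon ` ?M j)) \<le> 1 * (N + 1) ^ card V" for N
  proof -
    have "(\<Sum>j\<le>N. card (mon ` ?M j)) \<le> (\<Sum>j\<le>N. card (?M j))"
      by (intro sum_mono card_image_le fin)
    also have "\<dots> = card (\<Union>j\<in>{..N}. ?M j)"
      by (rule card_UN_disjoint[symmetric]) (auto simp: fin)
    also have "(\<Union>j\<in>{..N}. ?M j) = {s. keys s \<subseteq> V \<and> tdeg s \<le> N}" by auto
    also have "card \<dots> \<le> (N + 1) ^ card V" by (rule card_monomials[OF assms])
    finally show ?thesis by simp
  qed
qed (auto intro: mp.span_base)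

lemma hilbert_data_span_dle:
  assumes "hilbert_data V I \<delta> B C" "p \<in> Pol V" "dle N p"
  shows "p \<in> mp.span ((\<Union>j\<le>N. B j) \<union> I)"
proof (rule mpoly_in_span)
  fix s assume "s \<in> keys p"
  then have "keys s \<subseteq> V" "tdeg s \<le> N" using assms(2,3) by (auto simp: Pol_iff dle_def)
  then show "mon s \<in> mp.span ((\<Union>j\<le>N. B j) \<union> I)"
    using hilbert_dataD(4)[OF assms(1), of s] mp.span_mono[of "B (tdeg s) \<union> I" "(\<Union>j\<le>N. B j) \<union> I"]
    by auto
qed

section \<open>Adjoining a homogeneous element to an ideal\<close>

definition ideal_plus :: "'v set \<Rightarrow> ('v, complex) mpoly set \<Rightarrow> ('v, complex) mpoly \<Rightarrow> ('v, complex) mpoly set" where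
  "ideal_plus V I a = {i + a * q | i q. i \<in> I \<and> q \<in> Pol V}"

lemma
  assumes "hom_ideal V I" "homogeneous d a" "a \<in> Pol V"
  shows hom_ideal_plus: "hom_ideal V (ideal_plus V I a)"
    and ideal_plus_superset: "I \<subseteq> ideal_plus V I a"
    and ideal_plus_gen: "a \<in> ideal_plus V I a"
proof -
  note I = hom_idealD(1)[OF assms(1)]
  show "I \<subseteq> ideal_plus V I a"
    unfolding ideal_plus_def by (force intro: exI[of _ 0])
  show "a \<in> ideal_plus V I a"
    unfolding ideal_plus_def using ideal_0[OF I] by (force intro: exI[of _ 1])
  have mem: "i + a * q \<in> ideal_plus V I a" if "i \<in> I" "q \<in> Pol V" for i q
    using that by (auto simp: ideal_plus_def)
  have "ideal (ideal_plus V I a) (mpoly_ring V)"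
    unfolding ideal_mpoly_iff
  proof (intro conjI ballI subsetI)
    show "0 \<in> ideal_plus V I a" using mem[of 0 0] ideal_0[OF I] by simp
  next
    fix p assume "p \<in> ideal_plus V I a"
    then show "p \<in> Pol V"
      using ideal_subset[OF I] assms(3) by (auto simp: ideal_plus_def)
  next
    fix p q assume "p \<in> ideal_plus V I a" "q \<in> ideal_plus V I a"
    then obtain i j p' q' where "i \<in> I" "j \<in> I" "p' \<in> Pol V" "q' \<in> Pol V" "p = i + a * p'" "q = j + a * q'"
      by (auto simp: ideal_plus_def)
    then show "p + q \<in> ideal_plus V I a"
      using mem[of "i + j" "p' + q'"] ideal_add[OF I] by (simp add: algebra_simps Pol_add)
  next
    fix p q assume p: "p \<in> Pol V" and "q \<in> ideal_plus V I a"
    then obtain j q' where "j \<in> I" "q' \<in> Pol V" "q = j + a * q'"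
      by (auto simp: ideal_plus_def)
    then show "p * q \<in> ideal_plus V I a"
      using mem[of "p * j" "p * q'"] ideal_mult[OF I p] p by (simp add: algebra_simps Pol_mult)
  qed
  moreover have "hcomp N (i + a * q) \<in> ideal_plus V I a" if "i \<in> I" "q \<in> Pol V" for i q N
    using mem[of "hcomp N i" "if d \<le> N then hcomp (N - d) q else 0"] that hom_idealD(2)[OF assms(1)]
    by (auto simp: hcomp_add hcomp_homogeneous_mult[OF assms(2)] split: if_splits)
  ultimately show "hom_ideal V (ideal_plus V I a)"
    by (auto simp: hom_ideal_def) (auto simp: ideal_plus_def)
qed

text \<open>Take components of degree N in any representation. Below degree d the truncated
  \<open>N - d\<close> would be 0, so the vanishing of q is recorded separately there.\<close>

lemma ideal_plus_homogeneousE: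
  assumes "hom_ideal V I" "homogeneous d a" "p \<in> ideal_plus V I a" "homogeneous N p"
  obtains i q where "i \<in> I" "q \<in> Pol V" "homogeneous (N - d) q" "p = i + a * q" "N < d \<Longrightarrow> q = 0"
proof -
  obtain i q where iq: "i \<in> I" "q \<in> Pol V" "p = i + a * q"
    using assms(3) by (auto simp: ideal_plus_def)
  have "p = hcomp N p"
    using hcomp_homogeneous[OF assms(4)] by simp
  also have "\<dots> = hcomp N i + a * (if d \<le> N then hcomp (N - d) q else 0)"
    unfolding iq(3) hcomp_add hcomp_homogeneous_mult[OF assms(2)] by simp
  finally show ?thesis
    using that[of "hcomp N i" "if d \<le> N then hcomp (N - d) q else 0"] iq hom_idealD(2)[OF assms(1)] by auto
qed

text \<open>If a and b lie outside I, take their components of highest degrees i and j outside I. In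
  the component of degree i + j of the product, every other summand has a factor of higher degree,
  hence in I.\<close>

lemma primeideal_homogeneousI:
  assumes I: "hom_ideal V I" "1 \<notin> I"
    and prime: "\<And>a b d e. a \<in> Pol V \<Longrightarrow> b \<in> Pol V \<Longrightarrow> homogeneous d a \<Longrightarrow> homogeneous e b \<Longrightarrow>
      a * b \<in> I \<Longrightarrow> a \<in> I \<or> b \<in> I"
  shows "primeideal I (mpoly_ring V)"
proof -
  note id = hom_idealD(1)[OF I(1)]
  have "a \<in> I \<or> b \<in> I" if ab: "a \<in> Pol V" "b \<in> Pol V" "a * b \<in> I" for a b
  proof (rule ccontr)
    assume nI: "\<not> (a \<in> I \<or> b \<in> I)"
    have fin: "finite {N. hcomp N p \<notin> I}" for p
    proof (rule finite_subset)
      show "{N. hcomp N p \<notin> I} \<subseteq> tdeg ` keys p"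
      proof
        fix N assume "N \<in> {N. hcomp N p \<notin> I}"
        then have "hcomp N p \<noteq> 0" using ideal_0[OF id] by auto
        then have "keys (hcomp N p) \<noteq> {}" by simp
        then show "N \<in> tdeg ` keys p" by (auto simp: keys_hcomp)
      qed
    qed simp
    have ne: "{N. hcomp N p \<notin> I} \<noteq> {}" if "p \<notin> I" for p
      using ideal_hcompI[OF id] that by blast
    define i where "i = Max {N. hcomp N a \<notin> I}"
    define j where "j = Max {N. hcomp N b \<notin> I}"
    have i: "hcomp i a \<notin> I" and j: "hcomp j b \<notin> I"
      using Max_in[OF fin ne] nI unfolding i_def j_def by blast+
    have gi: "hcomp k a \<in> I" if "k > i" for k
      using Max_ge[OF fin, of k a] that unfolding i_def by (metis (mono_tags, lifting) mem_Collect_eq not_le)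
    have gj: "hcomp k b \<in> I" if "k > j" for k
      using Max_ge[OF fin, of k b] that unfolding j_def by (metis (mono_tags, lifting) mem_Collect_eq not_le)
    have rest: "(\<Sum>k\<in>{..i + j} - {i}. hcomp k a * hcomp (i + j - k) b) \<in> I"
    proof (rule ideal_sum[OF id])
      fix k assume "k \<in> {..i + j} - {i}"
      then consider "k > i" | "i + j - k > j" by force
      then show "hcomp k a * hcomp (i + j - k) b \<in> I"
        using ideal_mult[OF id Pol_hcomp[OF ab(1)] gj] ideal_mult_right[OF id Pol_hcomp[OF ab(2)] gi]
        by cases auto
    qed
    have "hcomp (i + j) (a * b) = hcomp i a * hcomp j b + (\<Sum>k\<in>{..i + j} - {i}. hcomp k a * hcomp (i + j - k) b)"
      unfolding hcomp_mult by (subst sum.remove[of _ i]) auto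
    then have "hcomp i a * hcomp j b \<in> I"
      using ideal_diff[OF id hom_idealD(2)[OF I(1) ab(3), of "i + j"] rest] by simp
    then show False
      using prime[of "hcomp i a" "hcomp j b" i j] i j ab by auto
  qed
  then show ?thesis
    using id I(2) by (auto simp: primeideal_mpoly_iff)
qed

lemma sum_shift_le: "(\<Sum>j\<le>N. if d \<le> j then f (j - d) else 0) \<le> (\<Sum>j\<le>N. f j)"
  for f :: "nat \<Rightarrow> nat"
proof -
  have "(\<Sum>j\<le>N. if d \<le> j then f (j - d) else 0) = (\<Sum>j\<in>{d..N}. f (j - d))"
    by (intro sum.mono_neutral_cong_right) auto
  also have "\<dots> = sum f ((\<lambda>j. j - d) ` {d..N})"
    by (subst sum.reindex) (auto simp: inj_on_def)
  also have "\<dots> \<le> (\<Sum>j\<le>N. f j)"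
    by (rule sum_mono2) auto
  finally show ?thesis .
qed

lemma span_homogeneous: "(\<And>b. b \<in> B \<Longrightarrow> homogeneous d b) \<Longrightarrow> p \<in> mp.span B \<Longrightarrow> homogeneous d p"
  using mp.span_minimal[OF _ homogeneous_subspace, of B d] by auto

lemma hilbert_data_ideal_plusE:
  assumes "hom_ideal V I" "homogeneous d a" "a \<in> Pol V" "hilbert_data V (ideal_plus V I a) \<delta> B C"
    and "p \<in> Pol V" "homogeneous N p"
  obtains b i q where "b \<in> mp.span (B N)" "i \<in> I" "q \<in> Pol V" "homogeneous (N - d) q"
    "p = b + i + a * q" "N < d \<Longrightarrow> q = 0"
proof -
  note plus = hom_idealD(1)[OF hom_ideal_plus[OF assms(1-3)]]
  obtain b j where bj: "b \<in> mp.span (B N)" "j \<in> ideal_plus V I a" "p = b + j"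
    by (rule span_Un_ideal[OF plus hilbert_data_span[OF assms(4-6)]])
  have "homogeneous N b"
    using hilbert_dataD(3)[OF assms(4)] bj(1) by (rule span_homogeneous)
  then have "homogeneous N j"
    using homogeneous_diff[OF assms(6), of b] bj(3) by simp
  from ideal_plus_homogeneousE[OF assms(1,2) bj(2) this] obtain i q where
    "i \<in> I" "q \<in> Pol V" "homogeneous (N - d) q" "j = i + a * q" "N < d \<Longrightarrow> q = 0"
    by blast
  with bj show ?thesis by (intro that[of b i q]) (auto simp: algebra_simps)
qed

text \<open>Modulo I, the ideal generated by a is killed by b, so it is a quotient of the ring
  modulo I + (b), shifted by d. Together with a spanning set modulo I + (a), this spans modulo
  I.\<close>

lemma hilbert_bound_mult:
  assumes I: "hom_ideal V I" and a: "homogeneous d a" "a \<in> Pol V" and b: "homogeneous e b" "b \<in> Pol V"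
    and ab: "a * b \<in> I"
    and bounds: "hilbert_bound V (ideal_plus V I a) \<delta>" "hilbert_bound V (ideal_plus V I b) \<delta>"
  shows "hilbert_bound V I \<delta>"
proof -
  note id = hom_idealD(1)[OF I]
  obtain B1 C1 where B1: "hilbert_data V (ideal_plus V I a) \<delta> B1 C1"
    using bounds(1) by (auto simp: hilbert_bound_def)
  obtain B2 C2 where B2: "hilbert_data V (ideal_plus V I b) \<delta> B2 C2"
    using bounds(2) by (auto simp: hilbert_bound_def)
  define B where "B N = B1 N \<union> (if d \<le> N then (*) a ` B2 (N - d) else {})" for N
  show ?thesis
  proof (rule hilbert_boundI[of B _ _ "C1 + C2"])
    show "finite (B N)" for N
      using hilbert_dataD(1)[OF B1] hilbert_dataD(1)[OF B2] by (simp add: B_def)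
    show "p \<in> Pol V" if "p \<in> B N" for p N
      using that hilbert_dataD(2)[OF B1] hilbert_dataD(2)[OF B2] a by (auto simp: B_def split: if_splits)
    show "homogeneous N p" if "p \<in> B N" for p N
    proof (cases "p \<in> B1 N")
      case False
      with that obtain q where "d \<le> N" "q \<in> B2 (N - d)" "p = a * q"
        by (auto simp: B_def split: if_splits)
      then show ?thesis
        using homogeneous_mult[OF a(1) hilbert_dataD(3)[OF B2, of q "N - d"]] by simp
    qed (use hilbert_dataD(3)[OF B1] in auto)
    show "(\<Sum>j\<le>N. card (B j)) \<le> (C1 + C2) * (N + 1) ^ \<delta>" for N
    proof -
      have "card (B j) \<le> card (B1 j) + (if d \<le> j then card (B2 (j - d)) else 0)" for j
        unfolding B_def using card_Un_le[of "B1 j" "(*) a ` B2 (j - d)"]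
          card_image_le[OF hilbert_dataD(1)[OF B2], of "(*) a" "j - d"] by auto
      then have "(\<Sum>j\<le>N. card (B j)) \<le> (\<Sum>j\<le>N. card (B1 j)) + (\<Sum>j\<le>N. if d \<le> j then card (B2 (j - d)) else 0)"
        by (simp add: sum_mono flip: sum.distrib)
      also have "\<dots> \<le> C1 * (N + 1) ^ \<delta> + C2 * (N + 1) ^ \<delta>"
        using hilbert_dataD(5)[OF B1, of N] hilbert_dataD(5)[OF B2, of N]
          sum_shift_le[of d "\<lambda>j. card (B2 j)" N] by linarith
      finally show ?thesis by (simp add: algebra_simps)
    qed
    fix s :: "_ \<Rightarrow>\<^sub>0 nat" assume s: "keys s \<subseteq> V"
    define N where "N = tdeg s"
    obtain b1 i q where q: "b1 \<in> mp.span (B1 N)" "i \<in> I" "q \<in> Pol V" "homogeneous (N - d) q"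
        "mon s = b1 + i + a * q" "N < d \<Longrightarrow> q = 0"
      by (rule hilbert_data_ideal_plusE[OF I a B1, of "mon s" N]) (use s in \<open>auto simp: N_def\<close>)
    have "b1 \<in> mp.span (B N \<union> I)"
      using q(1) mp.span_mono[of "B1 N" "B N \<union> I"] unfolding B_def by blast
    moreover have "i \<in> mp.span (B N \<union> I)"
      using q(2) by (auto intro: mp.span_base)
    moreover have "a * q \<in> mp.span (B N \<union> I)"
    proof (cases "d \<le> N")
      case True
      show ?thesis
      proof (rule span_mult_left[OF hilbert_data_span[OF B2 q(3,4)]])
        fix x assume x: "x \<in> B2 (N - d) \<union> ideal_plus V I b"
        show "a * x \<in> mp.span (B N \<union> I)"
        proof (cases "x \<in> B2 (N - d)")
          case True
          with \<open>d \<le> N\<close> show ?thesis by (intro mp.span_base) (auto simp: B_def)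
        next
          case False
          with x obtain j r where "j \<in> I" "r \<in> Pol V" "x = j + b * r"
            by (auto simp: ideal_plus_def)
          then have "a * x = a * j + (a * b) * r" "a * j + (a * b) * r \<in> I"
            using ideal_add[OF id ideal_mult[OF id a(2)] ideal_mult_right[OF id _ ab]]
            by (simp_all only: distrib_left mult.assoc)
          then show ?thesis by (intro mp.span_base) auto
        qed
      qed
    qed (use q(6) in \<open>auto simp: mp.span_zero\<close>)
    ultimately show "mon s \<in> mp.span (B (tdeg s) \<union> I)"
      unfolding q(5) N_def[symmetric] by (intro mp.span_add)
  qed
qed

text \<open>Repeated division by v writes an element of degree N as a combination of v^(N - j) times
  basis elements of degree j modulo I + (v). Hence one degree modulo I is as large as the cumulative
  count modulo I + (v), and summing over degrees costs one more factor N + 1.\<close>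

lemma hilbert_bound_Var:
  assumes I: "hom_ideal V I" and v: "v \<in> V"
    and bound: "hilbert_bound V (ideal_plus V I (Var v)) \<delta>"
  shows "hilbert_bound V I (Suc \<delta>)"
proof -
  note id = hom_idealD(1)[OF I]
  obtain B C where B: "hilbert_data V (ideal_plus V I (Var v)) \<delta> B C"
    using bound by (auto simp: hilbert_bound_def)
  define E where "E N = (\<Union>j\<le>N. (*) (Var v ^ (N - j)) ` B j)" for N
  have E: "p \<in> mp.span (E N \<union> I)" if "p \<in> Pol V" "homogeneous N p" for p N
    using that
  proof (induction N arbitrary: p)
    case 0
    obtain b i q where q: "b \<in> mp.span (B 0)" "i \<in> I" "p = b + i + Var v * q" "(0::nat) < Suc 0 \<Longrightarrow> q = 0"
      by (rule hilbert_data_ideal_plusE[OF I homogeneous_Var _ B 0]) (use v in auto)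
    have "b \<in> mp.span (E 0 \<union> I)"
      using q(1) mp.span_mono[of "B 0" "E 0 \<union> I"] by (auto simp: E_def)
    with q show ?case by (auto intro!: mp.span_add intro: mp.span_base)
  next
    case (Suc N)
    obtain b i q where q: "b \<in> mp.span (B (Suc N))" "i \<in> I" "q \<in> Pol V" "homogeneous N q" "p = b + i + Var v * q"
      by (rule hilbert_data_ideal_plusE[OF I homogeneous_Var _ B Suc.prems]) (use v in auto)
    have "B (Suc N) \<subseteq> E (Suc N)"
      unfolding E_def by (rule UN_upper[THEN subset_trans[rotated], of "Suc N"]) auto
    then have "b \<in> mp.span (E (Suc N) \<union> I)"
      using q(1) mp.span_mono[of "B (Suc N)" "E (Suc N) \<union> I"] by auto
    moreover have "Var v * q \<in> mp.span (E (Suc N) \<union> I)"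
    proof (rule span_mult_left[OF Suc.IH[OF q(3,4)]])
      fix x assume "x \<in> E N \<union> I"
      then show "Var v * x \<in> mp.span (E (Suc N) \<union> I)"
      proof
        assume "x \<in> E N"
        then obtain j y where "j \<le> N" "y \<in> B j" "x = Var v ^ (N - j) * y" by (auto simp: E_def)
        then have "Var v * x = Var v ^ (Suc N - j) * y" "j \<le> Suc N"
          by (auto simp: Suc_diff_le)
        with \<open>y \<in> B j\<close> have "Var v * x \<in> E (Suc N)" by (auto simp: E_def)
        then show ?thesis by (auto intro: mp.span_base)
      next
        assume "x \<in> I"
        then show ?thesis using ideal_mult[OF id _ \<open>x \<in> I\<close>, of "Var v"] v by (auto intro: mp.span_base)
      qed
    qed
    ultimately show ?case
      unfolding q(5) using q(2) by (intro mp.span_add) (auto intro: mp.span_base)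
  qed
  show ?thesis
  proof (rule hilbert_boundI[of E _ _ C])
    show "finite (E N)" for N
      using hilbert_dataD(1)[OF B] by (simp add: E_def)
    show "p \<in> Pol V" if "p \<in> E N" for p N
      using that hilbert_dataD(2)[OF B] v by (auto simp: E_def)
    show "homogeneous N p" if pE: "p \<in> E N" for p N
    proof -
      obtain j b where jb: "j \<le> N" "b \<in> B j" "p = Var v ^ (N - j) * b"
        using pE by (auto simp: E_def)
      have "homogeneous ((N - j) * Suc 0 + j) p"
        unfolding jb(3) by (intro homogeneous_mult homogeneous_power homogeneous_Var hilbert_dataD(3)[OF B jb(2)])
      with jb(1) show ?thesis by simp
    qed
    show "mon s \<in> mp.span (E (tdeg s) \<union> I)" if "keys s \<subseteq> V" for s
      using that by (intro E) auto
    show "(\<Sum>j\<le>N. card (E j)) \<le> C * (N + 1) ^ Suc \<delta>" for N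
    proof -
      have "card (E k) \<le> C * (N + 1) ^ \<delta>" if "k \<le> N" for k
      proof -
        have "card (E k) \<le> (\<Sum>j\<le>k. card ((*) (Var v ^ (k - j)) ` B j))"
          unfolding E_def by (rule card_UN_le) simp
        also have "\<dots> \<le> (\<Sum>j\<le>k. card (B j))"
          by (intro sum_mono card_image_le hilbert_dataD(1)[OF B])
        also have "\<dots> \<le> C * (k + 1) ^ \<delta>" by (rule hilbert_dataD(5)[OF B])
        also have "\<dots> \<le> C * (N + 1) ^ \<delta>"
          using that by (intro mult_left_mono power_mono) auto
        finally show ?thesis .
      qed
      then have "(\<Sum>j\<le>N. card (E j)) \<le> (\<Sum>j\<le>N. C * (N + 1) ^ \<delta>)"
        by (intro sum_mono) auto
      then show ?thesis by (simp add: algebra_simps)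
    qed
  qed
qed

lemma keys_splitE:
  fixes s :: "'v \<Rightarrow>\<^sub>0 nat"
  assumes "v \<in> keys s"
  obtains t where "s = t + single v 1" "keys t \<subseteq> keys s"
proof -
  have "s = (s - single v 1) + single v 1"
    using assms by (intro poly_mapping_eqI)
      (auto simp: lookup_add lookup_minus lookup_single when_def in_keys_iff)
  moreover from this have "keys (s - single v 1) \<subseteq> keys s"
    by (metis keys_add_nat Un_upper1)
  ultimately show ?thesis using that by blast
qed

section \<open>Constant terms and the maximal ideal of the origin\<close>

lemma hcomp_0_eq: "hcomp 0 p = Const (lookup p 0)"
  by (intro poly_mapping_eqI) (auto simp: lookup_hcomp Const_def lookup_single when_def)

lemma Const_eq_0_iff [simp]: "Const c = 0 \<longleftrightarrow> c = 0"
  unfolding Const_def by (metis lookup_single_eq lookup_zero single_zero)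

lemma lookup_0_mult: "lookup (p * q) 0 = lookup p 0 * lookup q 0"
  for p q :: "('v, complex) mpoly"
proof -
  have "hcomp 0 (p * q) = hcomp 0 p * hcomp 0 q" by (simp add: hcomp_mult)
  then have "(Const (lookup (p * q) 0) :: ('v, complex) mpoly) = Const (lookup p 0 * lookup q 0)"
    by (simp add: hcomp_0_eq Const_mult)
  then show ?thesis
    unfolding Const_def by (metis lookup_single_eq)
qed

lemma ideal_Const_imp_1:
  assumes "ideal I (mpoly_ring V)" "Const c \<in> I" "c \<noteq> 0"
  shows "1 \<in> I"
proof -
  have "Const (1 / c) * Const c \<in> I" using assms by (intro ideal_mult[OF assms(1)]) auto
  then show ?thesis using assms(3) by (simp flip: Const_mult)
qed

text \<open>The maximal ideal of the origin. It contains every proper homogeneous ideal, since a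
  nonzero constant component would put 1 into the ideal.\<close>

lemma primeideal_irrelevant: "primeideal {p \<in> Pol V. hcomp 0 p = 0} (mpoly_ring V)"
  unfolding primeideal_mpoly_iff ideal_mpoly_iff
  by (auto simp: hcomp_0_eq lookup_add lookup_0_mult)

lemma prime_chain_mono: "prime_chain V J l P \<Longrightarrow> I \<subseteq> J \<Longrightarrow> prime_chain V I l P"
  by (auto simp: prime_chain_def)

lemma prime_chain_Suc:
  assumes "prime_chain V J l P" "primeideal I (mpoly_ring V)" "I \<subset> P 0"
  shows "prime_chain V I (Suc l) (\<lambda>i. case i of 0 \<Rightarrow> I | Suc i \<Rightarrow> P i)"
  unfolding prime_chain_def
proof (intro conjI allI impI)
  have le: "P 0 \<subseteq> P i" if "i \<le> l" for i
    using that
  proof (induction i)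
    case (Suc i)
    then have "P i \<subset> P (Suc i)" using assms(1) by (auto simp: prime_chain_def)
    with Suc show ?case by auto
  qed auto
  fix i
  show "primeideal (case i of 0 \<Rightarrow> I | Suc i \<Rightarrow> P i) (mpoly_ring V)" if "i \<le> Suc l"
    using assms that by (auto simp: prime_chain_def split: nat.splits)
  show "I \<subseteq> (case i of 0 \<Rightarrow> I | Suc i \<Rightarrow> P i)" if "i \<le> Suc l"
    using assms(3) le[of "i - 1"] that by (cases i) auto
  show "(case i of 0 \<Rightarrow> I | Suc i \<Rightarrow> P i) \<subset> (case Suc i of 0 \<Rightarrow> I | Suc i \<Rightarrow> P i)" if "i < Suc l"
    using assms that by (auto simp: prime_chain_def split: nat.splits)
qed

theorem hilbert_bound_of_prime_chains:
  fixes V :: "'v::linorder set"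
  assumes "finite V" "hom_ideal V I" "\<And>l P. prime_chain V I l P \<Longrightarrow> l \<le> r"
  shows "hilbert_bound V I r"
  using assms(2,3)
proof (induction I arbitrary: r rule: wf_induct_rule[OF wf_hom_ideals[OF assms(1)]])
  case (1 I)
  note id = hom_idealD(1)[OF 1(2)]
  have IH: "hilbert_bound V (ideal_plus V I a) k"
    if "a \<in> Pol V" "homogeneous d a" "a \<notin> I" "\<And>l P. prime_chain V (ideal_plus V I a) l P \<Longrightarrow> l \<le> k" for a d k
    using that 1(2) hom_ideal_plus[OF 1(2) that(2,1)] ideal_plus_superset[OF 1(2) that(2,1)]
      ideal_plus_gen[OF 1(2) that(2,1)]
    by (intro 1(1)) blast+
  consider "1 \<in> I" | a b d e where "a \<in> Pol V" "b \<in> Pol V" "homogeneous d a" "homogeneous e b" "a * b \<in> I" "a \<notin> I" "b \<notin> I"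
    | "1 \<notin> I" "primeideal I (mpoly_ring V)"
    using primeideal_homogeneousI[OF 1(2)] by blast
  then show ?case
  proof cases
    case 1
    then show ?thesis
      by (intro hilbert_boundI[of "\<lambda>_. {}" _ _ 0]) (auto simp: ideal_span[OF id] intro: ideal_1_imp[OF id])
  next
    case 2
    have "hilbert_bound V (ideal_plus V I x) r" if "x \<in> Pol V" "homogeneous k x" "x \<notin> I" for x k
      using that ideal_plus_superset[OF 1(2) that(2,1)]
      by (intro IH[of x k]) (auto intro: 1(3) prime_chain_mono)
    with 2 show ?thesis by (intro hilbert_bound_mult[OF 1(2)]) auto
  next
    case 3
    show ?thesis
    proof (cases "\<forall>v\<in>V. Var v \<in> I")
      case True
      \<comment> \<open>The quotient consists of the constants, so 1 spans it and the count is
        bounded for every r.\<close>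
      show ?thesis
      proof (rule hilbert_boundI[of "\<lambda>N. if N = 0 then {1} else {}" _ _ 1])
        fix s :: "'v \<Rightarrow>\<^sub>0 nat" assume s: "keys s \<subseteq> V"
        show "mon s \<in> mp.span ((if tdeg s = 0 then {1} else {}) \<union> I)"
        proof (cases "s = 0")
          case False
          then obtain v where v: "v \<in> keys s" by fastforce
          then obtain t where t: "s = t + single v 1" "keys t \<subseteq> keys s" by (rule keys_splitE)
          have "mon t * Var v \<in> I"
            using s v t True by (intro ideal_mult[OF id]) auto
          then show ?thesis unfolding t(1) mon_add by (intro mp.span_base) (auto simp: Var_def)
        qed (auto intro: mp.span_base)
      qed (auto split: if_splits simp: if_distrib sum.If_cases cong: if_cong)
    next
      case False
      then obtain v where v: "v \<in> V" "Var v \<notin> I" by blast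
      \<comment> \<open>The maximal ideal of the origin lies strictly above I; this chain of length
        1 makes r positive, so that \<open>r - 1\<close> is not truncated.\<close>
      let ?M = "{p \<in> Pol V. hcomp 0 p = 0}"
      have "I \<subseteq> ?M"
        using ideal_subset[OF id] hom_idealD(2)[OF 1(2), of _ 0] ideal_Const_imp_1[OF id] 3(1)
        by (auto simp: hcomp_0_eq)
      moreover have "Var v \<in> ?M"
        using v(1) by (simp add: hcomp_homogeneous[OF homogeneous_Var])
      ultimately have "I \<subset> ?M" using v by blast
      then have "prime_chain V I (Suc 0) (\<lambda>i. case i of 0 \<Rightarrow> I | Suc i \<Rightarrow> ?M)"
        using 3(2) primeideal_irrelevant by (intro prime_chain_Suc[of V ?M]) (auto simp: prime_chain_def)
      then have r: "Suc 0 \<le> r" by (rule 1(3))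
      have "hilbert_bound V (ideal_plus V I (Var v)) (r - 1)"
      proof (rule IH[OF _ homogeneous_Var v(2)])
        fix l P assume P: "prime_chain V (ideal_plus V I (Var v)) l P"
        \<comment> \<open>A chain above I + (v) can be prolonged downwards by the prime I itself,
          whence the loss of one.\<close>
        have "I \<subset> ideal_plus V I (Var v)"
          using ideal_plus_superset[OF 1(2) homogeneous_Var] ideal_plus_gen[OF 1(2) homogeneous_Var] v by auto
        moreover have "ideal_plus V I (Var v) \<subseteq> P 0"
          using P by (auto simp: prime_chain_def)
        ultimately have "I \<subset> P 0" by blast
        from 1(3)[OF prime_chain_Suc[OF P 3(2) this]] show "l \<le> r - 1" by simp
      qed (use v in auto)
      from hilbert_bound_Var[OF 1(2) v(1) this] r show ?thesis by simp
    qed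
  qed
qed

subsection \<open>Combining growth bounds\<close>

lemma monomial_split:
  fixes s :: "'v \<Rightarrow>\<^sub>0 nat"
  assumes "keys s \<subseteq> V \<union> W"
  obtains t u where "s = t + u" "keys t \<subseteq> V" "keys u \<subseteq> W"
proof -
  have "\<exists>t u. s = t + u \<and> keys t \<subseteq> V \<and> keys u \<subseteq> W"
    using assms
  proof (induction rule: mon_induct)
    case (Var s v)
    then obtain t u where tu: "s = t + u" "keys t \<subseteq> V" "keys u \<subseteq> W" by blast
    show ?case
    proof (cases "v \<in> V")
      case True
      with tu show ?thesis by (intro exI[of _ "t + single v 1"] exI[of _ u]) (auto simp: keys_add_nat ac_simps)
    next
      case False
      with tu Var show ?thesis by (intro exI[of _ t] exI[of _ "u + single v 1"]) (auto simp: keys_add_nat ac_simps)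
    qed
  qed (auto intro: exI[of _ 0])
  then show ?thesis using that by blast
qed

lemma sum_convolution_le:
  fixes f g :: "nat \<Rightarrow> nat"
  shows "(\<Sum>k\<le>N. \<Sum>i\<le>k. f i * g (k - i)) \<le> (\<Sum>i\<le>N. f i) * (\<Sum>i\<le>N. g i)"
proof -
  have "(\<Sum>k\<le>N. \<Sum>i\<le>k. f i * g (k - i)) = (\<Sum>(i, j)\<in>{(i, j). i + j \<le> N}. f i * g j)"
    by (rule sum.triangle_reindex_eq[symmetric])
  also have "\<dots> \<le> (\<Sum>(i, j)\<in>{..N} \<times> {..N}. f i * g j)"
    by (intro sum_mono2) auto
  also have "\<dots> = (\<Sum>i\<le>N. f i) * (\<Sum>i\<le>N. g i)"
    by (simp add: sum_product sum.cartesian_product)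
  finally show ?thesis .
qed

text \<open>The hypothesis on \<open>V1\<close> asks for a relation modulo \<open>I\<close> only up to terms \<open>q\<close> of positive
  degree in \<open>V0\<close>, that is, of smaller degree in \<open>V1\<close>: the bound passes from an initial ideal to \<open>I\<close>.\<close>

lemma hilbert_bound_degeneration:
  assumes I: "ideal I (mpoly_ring W)" and V: "V0 \<inter> V1 = {}" "V0 \<union> V1 \<subseteq> W"
    and bound: "hilbert_bound V0 I \<delta>0"
    and B: "\<And>N. finite (B N)" "\<And>N b. b \<in> B N \<Longrightarrow> b \<in> Pol V1" "\<And>N b. b \<in> B N \<Longrightarrow> homogeneous N b"
      "\<And>N. (\<Sum>j\<le>N. card (B j)) \<le> C1 * (N + 1) ^ \<delta>1"
    and initial: "\<And>s. keys s \<subseteq> V1 \<Longrightarrow> \<exists>b\<in>mp.span (B (tdeg s)). \<exists>q\<in>Pol (V0 \<union> V1). homogeneous (tdeg s) q \<and>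
      (\<forall>u\<in>keys q. keys u \<inter> V0 \<noteq> {}) \<and> mon s - b - q \<in> I"
  shows "hilbert_bound (V0 \<union> V1) I (\<delta>0 + \<delta>1)"
proof -
  obtain A C0 where A: "hilbert_data V0 I \<delta>0 A C0"
    using bound by (auto simp: hilbert_bound_def)
  define E where "E N = (\<Union>k\<le>N. (\<lambda>(a, b). a * b) ` (A k \<times> B (N - k)))" for N
  have E_mem: "a * b \<in> E (k + l)" if "a \<in> A k" "b \<in> B l" for a b k l
    unfolding E_def by (rule UN_I[of k]) (use that in auto)
  \<comment> \<open>Induction on the degree in V1: each monomial of q has a factor from V0, so its
    part in V1 is smaller, while the total degree, and with it the target span, stays the
    same.\<close>
  have main: "mon (s + t) \<in> mp.span (E (tdeg s + tdeg t) \<union> I)"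
    if "keys s \<subseteq> V0" "keys t \<subseteq> V1" for s t
    using that
  proof (induction "tdeg t" arbitrary: s t rule: less_induct)
    case less
    let ?S = "mp.span (E (tdeg s + tdeg t) \<union> I)"
    obtain b q where bq: "b \<in> mp.span (B (tdeg t))" "q \<in> Pol (V0 \<union> V1)" "homogeneous (tdeg t) q"
      "\<And>u. u \<in> keys q \<Longrightarrow> keys u \<inter> V0 \<noteq> {}" "mon t - b - q \<in> I"
      using initial[OF less(3)] by blast
    have sW: "mon s \<in> Pol W" using less(2) V by auto
    have "mon s * b \<in> ?S"
    proof (rule span_mult_left[OF bq(1)])
      fix b' assume b': "b' \<in> B (tdeg t)"
      have "b' * mon s \<in> ?S"
      proof (rule span_mult_left[OF hilbert_dataD(4)[OF A less(2)]])
        fix a assume "a \<in> A (tdeg s) \<union> I"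
        moreover have "b' \<in> Pol W" using B(2)[OF b'] V(2) Pol_mono[of V1 W] by auto
        ultimately have "b' * a \<in> E (tdeg s + tdeg t) \<union> I"
          using E_mem[of a "tdeg s" b' "tdeg t"] b' ideal_mult[OF I, of b' a] by (auto simp: mult.commute)
        then show "b' * a \<in> ?S" by (rule mp.span_base)
      qed
      then show "mon s * b' \<in> ?S" by (simp add: mult.commute)
    qed
    moreover have "mon s * q \<in> ?S"
    proof (rule span_mult_left)
      show "q \<in> mp.span (mon ` keys q)"
        by (rule mpoly_in_span) (auto intro: mp.span_base)
      fix x assume "x \<in> mon ` keys q"
      then obtain u where u: "u \<in> keys q" "x = mon u" by blast
      then have "keys u \<subseteq> V0 \<union> V1" using bq(2) by (auto simp: Pol_iff)
      then obtain u0 u1 where split: "u = u0 + u1" "keys u0 \<subseteq> V0" "keys u1 \<subseteq> V1"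
        by (rule monomial_split)
      have "u0 \<noteq> 0" using bq(4)[OF u(1)] split V(1) by auto
      then have "0 < tdeg u0" by (metis gr0I tdeg_eq_0_iff)
      moreover have "tdeg u = tdeg t" using bq(3) u(1) by (auto simp: homogeneous_tdeg)
      ultimately have "tdeg u1 < tdeg t" "tdeg (s + u0) + tdeg u1 = tdeg s + tdeg t"
        using split(1) by auto
      with less(1)[of u1 "s + u0"] split less(2) show "mon s * x \<in> ?S"
        by (simp add: u(2) keys_add_nat add.assoc flip: mon_add)
    qed
    moreover have "mon s * (mon t - b - q) \<in> ?S"
      by (intro mp.span_base UnI2 ideal_mult[OF I] sW bq(5))
    ultimately have "mon s * b + mon s * q + mon s * (mon t - b - q) \<in> ?S"
      by (intro mp.span_add)
    moreover have "mon s * b + mon s * q + mon s * (mon t - b - q) = mon (s + t)"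
      by (simp add: mon_add algebra_simps)
    ultimately show ?case by simp
  qed
  show ?thesis
  proof (rule hilbert_boundI[of E _ _ "C0 * C1"])
    show "finite (E N)" for N
      using hilbert_dataD(1)[OF A] B(1) by (auto simp: E_def)
    show "p \<in> Pol (V0 \<union> V1)" if pE: "p \<in> E N" for p N
    proof -
      obtain k a b where ab: "a \<in> A k" "b \<in> B (N - k)" "p = a * b"
        using pE by (auto simp: E_def)
      show ?thesis
        unfolding ab(3) using Pol_mono[OF _ hilbert_dataD(2)[OF A ab(1)]] Pol_mono[OF _ B(2)[OF ab(2)]]
        by (intro Pol_mult) auto
    qed
    show "homogeneous N p" if pE: "p \<in> E N" for p N
    proof -
      obtain k a b where "k \<le> N" "a \<in> A k" "b \<in> B (N - k)" "p = a * b"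
        using pE by (auto simp: E_def)
      then show ?thesis
        using homogeneous_mult[OF hilbert_dataD(3)[OF A, of a k] B(3)[of b "N - k"]] by simp
    qed
    show "mon s \<in> mp.span (E (tdeg s) \<union> I)" if "keys s \<subseteq> V0 \<union> V1" for s
      using monomial_split[OF that] main tdeg_add by metis
    show "(\<Sum>j\<le>N. card (E j)) \<le> C0 * C1 * (N + 1) ^ (\<delta>0 + \<delta>1)" for N
    proof -
      have "card (E k) \<le> (\<Sum>i\<le>k. card (A i) * card (B (k - i)))" for k
      proof -
        have "card (E k) \<le> (\<Sum>i\<le>k. card ((\<lambda>(a, b). a * b) ` (A i \<times> B (k - i))))"
          unfolding E_def by (rule card_UN_le) simp
        also have "\<dots> \<le> (\<Sum>i\<le>k. card (A i \<times> B (k - i)))"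
          by (intro sum_mono card_image_le finite_cartesian_product hilbert_dataD(1)[OF A] B(1))
        finally show ?thesis by (simp add: card_cartesian_product)
      qed
      then have "(\<Sum>j\<le>N. card (E j)) \<le> (\<Sum>k\<le>N. \<Sum>i\<le>k. card (A i) * card (B (k - i)))"
        by (intro sum_mono)
      also have "\<dots> \<le> (\<Sum>i\<le>N. card (A i)) * (\<Sum>i\<le>N. card (B i))"
        by (rule sum_convolution_le)
      also have "\<dots> \<le> (C0 * (N + 1) ^ \<delta>0) * (C1 * (N + 1) ^ \<delta>1)"
        by (intro mult_mono hilbert_dataD(5)[OF A] B(4)) auto
      finally show ?thesis by (simp add: power_add mult_ac)
    qed
  qed
qed

text \<open>The undegenerate case q = 0: products of the two spanning sets span, and growth orders
  add.\<close>

lemma hilbert_bound_Un: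
  assumes I: "ideal I (mpoly_ring W)" and V: "V0 \<inter> V1 = {}" "V0 \<union> V1 \<subseteq> W"
    and bounds: "hilbert_bound V0 I \<delta>0" "hilbert_bound V1 I \<delta>1"
  shows "hilbert_bound (V0 \<union> V1) I (\<delta>0 + \<delta>1)"
proof -
  obtain B C where B: "hilbert_data V1 I \<delta>1 B C"
    using bounds(2) by (auto simp: hilbert_bound_def)
  show ?thesis
  proof (rule hilbert_bound_degeneration[OF I V bounds(1) hilbert_dataD(1,2,3,5)[OF B]])
    fix s :: "_ \<Rightarrow>\<^sub>0 nat" assume "keys s \<subseteq> V1"
    from span_Un_ideal[OF I hilbert_dataD(4)[OF B this]]
    obtain b i where "b \<in> mp.span (B (tdeg s))" "i \<in> I" "mon s = b + i" .
    then show "\<exists>b\<in>mp.span (B (tdeg s)). \<exists>q\<in>Pol (V0 \<union> V1). homogeneous (tdeg s) q \<and>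
      (\<forall>u\<in>keys q. keys u \<inter> V0 \<noteq> {}) \<and> mon s - b - q \<in> I"
      by (intro bexI[of _ b] bexI[of _ 0]) auto
  qed
qed

text \<open>After inverting \<open>G\<close>, the residue ring modulo \<open>P 0\<close> is generated by the variables in \<open>S\<close>.\<close>

lemma prime_chain_le_localized:
  assumes chain: "prime_chain V I l P" and V: "finite V" "S \<subseteq> V"
    and G: "G \<in> Pol S" "G \<notin> P 0"
    and vars: "\<And>v. v \<in> V \<Longrightarrow> \<exists>c q. q \<in> Pol S \<and> G ^ c * Var v - q \<in> P 0"
    and bound: "hilbert_bound S (P 0) \<delta>"
  shows "l \<le> \<delta>"
proof -
  have P: "primeideal (P 0) (mpoly_ring V)"
    using chain by (auto simp: prime_chain_def)
  note id = prime_ideal[OF P]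
  have SV: "p \<in> Pol V" if "p \<in> Pol S" for p
    using that V(2) Pol_mono by blast
  obtain c q where cq: "\<And>v. v \<in> V \<Longrightarrow> q v \<in> Pol S" "\<And>v. v \<in> V \<Longrightarrow> G ^ c v * Var v - q v \<in> P 0"
    using vars by metis
  \<comment> \<open>One exponent that serves all variables.\<close>
  define c' where "c' = (\<Sum>v\<in>V. c v)"
  define q' where "q' v = G ^ (c' - c v) * q v" for v
  have c': "c v \<le> c'" if "v \<in> V" for v
    unfolding c'_def using that V(1) by (intro member_le_sum) auto
  have q'S: "q' v \<in> Pol S" if "v \<in> V" for v
    using that cq(1) G(1) by (auto simp: q'_def)
  have q'P: "G ^ c' * Var v - q' v \<in> P 0" if v: "v \<in> V" for v
  proof -
    have "G ^ c' * Var v - q' v = G ^ (c' - c v) * (G ^ c v * Var v - q v)"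
      using c'[OF v] by (simp add: q'_def algebra_simps flip: power_add)
    then show ?thesis
      using ideal_mult[OF id _ cq(2)[OF v]] SV[OF G(1)] by simp
  qed
  have "\<forall>v. \<exists>M. dle M (q' v)" using ex_dle by blast
  then obtain M where M: "\<And>v. dle (M v) (q' v)" by metis
  obtain M0 where M0: "dle M0 (G ^ c')" using ex_dle by blast
  define D where "D = M0 + (\<Sum>v\<in>V. M v)"
  have D: "dle D (q' v)" if "v \<in> V" for v
    using that V(1) member_le_sum[of v V M] by (intro dle_mono[OF M]) (auto simp: D_def)
  have DG: "dle D (G ^ c')" by (rule dle_mono[OF M0]) (simp add: D_def)
  \<comment> \<open>Each variable of the monomial costs one factor \<open>G ^ c'\<close> and raises
    the degree of the numerator by at most D, so both grow only linearly.\<close>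
  have exact: "\<exists>r\<in>Pol S. dle (tdeg s * D) r \<and> (G ^ c') ^ tdeg s * mon s - r \<in> P 0" if "keys s \<subseteq> V" for s
    using that
  proof (induction rule: mon_induct)
    case 0
    show ?case by (intro bexI[of _ 1]) (auto simp: ideal_0[OF id])
  next
    case (Var s v)
    then obtain r where r: "r \<in> Pol S" "dle (tdeg s * D) r" "(G ^ c') ^ tdeg s * mon s - r \<in> P 0" by blast
    have "(G ^ c') ^ tdeg s * mon s * (G ^ c' * Var v - q' v) + ((G ^ c') ^ tdeg s * mon s - r) * q' v \<in> P 0"
      using Var SV[OF G(1)] SV[OF q'S]
      by (intro ideal_add[OF id] ideal_mult[OF id] ideal_mult_right[OF id] r(3) q'P) auto
    then have "(G ^ c') ^ tdeg (s + single v 1) * mon (s + single v 1) - r * q' v \<in> P 0"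
      by (simp add: mon_add Var_def algebra_simps)
    moreover have "dle (tdeg (s + single v 1) * D) (r * q' v)"
      using dle_mult[OF r(2) D[OF Var(1)]] by (simp add: add.commute)
    ultimately show ?case
      using r(1) q'S[OF Var(1)] by (intro bexI[of _ "r * q' v"]) auto
  qed
  obtain B C where B: "hilbert_data S (P 0) \<delta> B C"
    using bound by (auto simp: hilbert_bound_def)
  show ?thesis
  proof (rule prime_chain_length_le[OF chain, where C = "C * (D + 1) ^ \<delta>"])
    fix N
    \<comment> \<open>This power clears the denominators of all monomials of degree at most N at
      once; the numerators have degree at most N D.\<close>
    let ?u = "(G ^ c') ^ N" and ?B = "\<Union>j\<le>N * D. B j"
    have "card ?B \<le> C * (N * D + 1) ^ \<delta>"
      using card_UN_le[of "{..N * D}" B] hilbert_dataD(5)[OF B, of "N * D"] by simp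
    also have "\<dots> \<le> C * ((D + 1) * (N + 1)) ^ \<delta>"
      by (intro mult_left_mono power_mono) (auto simp: algebra_simps)
    finally have card: "card ?B \<le> C * (D + 1) ^ \<delta> * (N + 1) ^ \<delta>"
      by (simp only: power_mult_distrib mult.assoc)
    have "?u * p \<in> mp.span (?B \<union> P 0)" if "p \<in> Pol V" "dle N p" for p
    proof (rule span_mult_left)
      show "p \<in> mp.span (mon ` keys p)"
        by (rule mpoly_in_span) (auto intro: mp.span_base)
      fix x assume "x \<in> mon ` keys p"
      with that obtain s where s: "x = mon s" "keys s \<subseteq> V" "tdeg s \<le> N"
        by (auto simp: Pol_iff dle_def)
      from exact[OF s(2)] obtain r where r: "r \<in> Pol S" "dle (tdeg s * D) r" "(G ^ c') ^ tdeg s * mon s - r \<in> P 0"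
        by blast
      define e where "e = (G ^ c') ^ (N - tdeg s)"
      have e: "e \<in> Pol S" using G(1) by (simp add: e_def)
      have "dle ((N - tdeg s) * D + tdeg s * D) (e * r)"
        unfolding e_def by (intro dle_mult dle_power DG r(2))
      then have "dle (N * D) (e * r)"
        using s(3) by (simp flip: add_mult_distrib)
      then have "e * r \<in> mp.span (?B \<union> P 0)"
        using e r(1) by (intro hilbert_data_span_dle[OF B]) auto
      moreover have "e * ((G ^ c') ^ tdeg s * mon s - r) \<in> mp.span (?B \<union> P 0)"
        by (intro mp.span_base UnI2 ideal_mult[OF id] SV[OF e] r(3))
      ultimately have "e * r + e * ((G ^ c') ^ tdeg s * mon s - r) \<in> mp.span (?B \<union> P 0)"
        by (rule mp.span_add)
      moreover have "e * r + e * ((G ^ c') ^ tdeg s * mon s - r) = (e * (G ^ c') ^ tdeg s) * mon s"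
        by (simp add: algebra_simps)
      moreover have "e * (G ^ c') ^ tdeg s = ?u"
        using s(3) unfolding e_def power_add[symmetric] by simp
      ultimately show "?u * x \<in> mp.span (?B \<union> P 0)" by (simp add: s(1))
    qed
    moreover have "?u \<notin> P 0"
      using prime_power[OF P SV[OF G(1)] G(2), of "c' * N"] by (simp add: power_mult)
    ultimately show "\<exists>u B. u \<in> Pol V \<and> u \<notin> P 0 \<and> finite B \<and> card B \<le> C * (D + 1) ^ \<delta> * (N + 1) ^ \<delta> \<and>
      (\<forall>p\<in>Pol V. dle N p \<longrightarrow> u * p \<in> mp.span (B \<union> P 0))"
      using card SV[OF G(1)] hilbert_dataD(1)[OF B] by (intro exI[of _ ?u] exI[of _ ?B]) auto
  qed
qed

lemma prime_chain_le_hilbert_bound: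
  assumes "prime_chain V I l P" "finite V" "hilbert_bound V (P 0) \<delta>"
  shows "l \<le> \<delta>"
proof (rule prime_chain_le_localized[OF assms(1,2) subset_refl Pol_1 _ _ assms(3)])
  have P: "primeideal (P 0) (mpoly_ring V)"
    using assms by (auto simp: prime_chain_def)
  show "1 \<notin> P 0" by (rule prime_1[OF P])
  show "\<exists>c q. q \<in> Pol V \<and> 1 ^ c * Var v - q \<in> P 0" if "v \<in> V" for v
    using that ideal_0[OF prime_ideal[OF P]] by (intro exI[of _ 0] exI[of _ "Var v"]) auto
qed

subsection \<open>Renaming of variables\<close>

definition ren :: "('v \<Rightarrow> 'w) \<Rightarrow> ('v, complex) mpoly \<Rightarrow> ('w, complex) mpoly" where
  "ren f = mpoly_eval Const (\<lambda>v. Var (f v))"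

lemmas Const_hom = Const_simps Const_add Const_mult

lemma ren_0 [simp]: "ren f 0 = 0" and ren_1 [simp]: "ren f 1 = 1"
  and ren_add: "ren f (p + q) = ren f p + ren f q"
  and ren_mult: "ren f (p * q) = ren f p * ren f q"
  and ren_Const [simp]: "ren f (Const c) = Const c" and ren_Var [simp]: "ren f (Var v) = Var (f v)"
  unfolding ren_def
  by (rule mpoly_eval_0[OF Const_hom] mpoly_eval_1[OF Const_hom] mpoly_eval_add[OF Const_hom]
    mpoly_eval_mult[OF Const_hom] mpoly_eval_Const[OF Const_hom] mpoly_eval_Var[OF Const_hom])+

lemma ren_sum: "ren f (sum g A) = (\<Sum>x\<in>A. ren f (g x))"
  by (induction A rule: infinite_finite_induct) (simp_all add: ren_add)

lemma Pol_UNIV [simp]: "p \<in> Pol UNIV"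
  by (simp add: Pol_iff)

lemma ren_Pol: "p \<in> Pol V \<Longrightarrow> f ` V \<subseteq> W \<Longrightarrow> ren f p \<in> Pol W"
  by (induction rule: mpoly_induct) (auto simp: ren_add ren_mult)

lemma ren_homogeneous:
  assumes "homogeneous d p"
  shows "homogeneous d (ren f p)"
  using Pol_UNIV assms
  by (rule homogeneous_induct) (auto simp: ren_add ren_mult intro: homogeneous_add homogeneous_mult)

lemma ren_inverse:
  assumes "p \<in> Pol V" "\<And>v. v \<in> V \<Longrightarrow> g (f v) = v"
  shows "ren g (ren f p) = p"
  using assms by (induction rule: mpoly_induct) (auto simp: ren_add ren_mult)

lemma ren_span: "p \<in> mp.span A \<Longrightarrow> ren f p \<in> mp.span (ren f ` A)"
proof (induction rule: mp.span_induct_alt)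
  case base
  then show ?case by (simp add: mp.span_zero)
next
  case (step c x y)
  then show ?case
    using mp.span_add[OF mp.span_scale[OF mp.span_base[OF imageI[of x A "ren f"]]]]
    by (simp add: ren_add ren_mult)
qed

lemma hilbert_bound_ren:
  assumes "hilbert_bound V I \<delta>" "\<And>v. v \<in> V \<Longrightarrow> g (f v) = v" "\<And>p. p \<in> I \<Longrightarrow> ren f p \<in> J"
  shows "hilbert_bound (f ` V) J \<delta>"
proof -
  obtain B C where B: "hilbert_data V I \<delta> B C"
    using assms(1) by (auto simp: hilbert_bound_def)
  show ?thesis
  proof (rule hilbert_boundI[of "\<lambda>N. ren f ` B N" _ _ C])
    show "finite (ren f ` B N)" for N using hilbert_dataD(1)[OF B] by simp
    show "b \<in> Pol (f ` V)" if "b \<in> ren f ` B N" for b N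
      using that hilbert_dataD(2)[OF B] by (auto intro: ren_Pol)
    show "homogeneous N b" if "b \<in> ren f ` B N" for b N
      using that hilbert_dataD(3)[OF B] by (auto intro: ren_homogeneous)
    show "(\<Sum>j\<le>N. card (ren f ` B j)) \<le> C * (N + 1) ^ \<delta>" for N
      by (rule order_trans[OF sum_mono hilbert_dataD(5)[OF B]]) (intro card_image_le hilbert_dataD(1)[OF B])
    fix s :: "_ \<Rightarrow>\<^sub>0 nat" assume s: "keys s \<subseteq> f ` V"
    have "ren g (mon s) \<in> mp.span (B (tdeg s) \<union> I)"
      using s assms(2) by (intro hilbert_data_span[OF B] ren_Pol[of _ "f ` V"] ren_homogeneous) auto
    from ren_span[OF this, of f] have "ren f (ren g (mon s)) \<in> mp.span (ren f ` B (tdeg s) \<union> J)"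
      using mp.span_mono[of "ren f ` (B (tdeg s) \<union> I)" "ren f ` B (tdeg s) \<union> J"] assms(3) by blast
    moreover have "ren f (ren g (mon s)) = mon s"
      using s assms(2) by (intro ren_inverse[of _ "f ` V"]) auto
    ultimately show "mon s \<in> mp.span (ren f ` B (tdeg s) \<union> J)" by simp
  qed
qed

subsection \<open>Partial derivatives\<close>

lemma partial_deriv_superset:
  assumes "finite S" "keys p \<subseteq> S"
  shows "partial_deriv v p = (\<Sum>s\<in>S. single (s - single v 1) (of_nat (lookup s v) * lookup p s))"
  unfolding partial_deriv_def using assms
  by (intro sum.mono_neutral_left) (auto simp: in_keys_iff)

lemma partial_deriv_0 [simp]: "partial_deriv v 0 = 0"
  by (simp add: partial_deriv_def)

lemma partial_deriv_add: "partial_deriv v (p + q) = partial_deriv v p + partial_deriv v q"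
  using Poly_Mapping.keys_add[of p q]
  by (subst (1 2 3) partial_deriv_superset[of "keys p \<union> keys q"])
    (auto simp: lookup_add distrib_left single_add sum.distrib)

lemma partial_deriv_sum: "partial_deriv v (sum f A) = (\<Sum>x\<in>A. partial_deriv v (f x))"
  by (induction A rule: infinite_finite_induct) (simp_all add: partial_deriv_add)

lemma partial_deriv_single:
  "partial_deriv v (single s c) = single (s - single v 1) (of_nat (lookup s v) * c)"
  by (subst partial_deriv_superset[of "{s}"]) auto

lemma partial_deriv_Const [simp]: "partial_deriv v (Const c) = 0"
  by (simp add: Const_def partial_deriv_single)

lemma partial_deriv_Var: "partial_deriv v (Var w) = (if v = w then 1 else 0)"
  by (simp add: Var_def partial_deriv_single lookup_single)

lemma partial_deriv_mult_single:
  fixes c e :: complex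
  shows "partial_deriv v (single s c * single t e) =
    partial_deriv v (single s c) * single t e + single s c * partial_deriv v (single t e)"
proof -
  \<comment> \<open>Truncated subtraction moves past the sum when v occurs in a; when it does not,
    the coefficient in question is zero.\<close>
  have shift: "a - single v 1 + b = a + b - single v 1" if "lookup a v \<noteq> 0" for a b :: "'a \<Rightarrow>\<^sub>0 nat"
    using that by (intro poly_mapping_eqI) (auto simp: lookup_add lookup_minus lookup_single when_def)
  have "single (s - single v 1 + t) (of_nat (lookup s v) * c * e) = single (s + t - single v 1) (of_nat (lookup s v) * c * e)"
    using shift[of s t] by (cases "lookup s v = 0") auto
  moreover have "single (s + (t - single v 1)) (c * (of_nat (lookup t v) * e)) = single (s + t - single v 1) (c * (of_nat (lookup t v) * e))"
    using shift[of t s] by (cases "lookup t v = 0") (auto simp: add.commute)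
  ultimately show ?thesis
    by (simp add: mult_single partial_deriv_single lookup_add algebra_simps flip: single_add)
qed

lemma partial_deriv_mult: "partial_deriv v (p * q) = partial_deriv v p * q + p * partial_deriv v q"
  for p q :: "('v, complex) mpoly"
proof -
  define P where "P s = single s (lookup p s)" for s
  define Q where "Q s = single s (lookup q s)" for s
  have p: "p = sum P (keys p)" and q: "q = sum Q (keys q)"
    by (simp_all add: P_def Q_def mpoly_sum_single)
  have "partial_deriv v (P s * Q t) = partial_deriv v (P s) * Q t + P s * partial_deriv v (Q t)" for s t
    unfolding P_def Q_def by (rule partial_deriv_mult_single)
  then have "partial_deriv v (sum P (keys p) * sum Q (keys q)) =
      partial_deriv v (sum P (keys p)) * sum Q (keys q) + sum P (keys p) * partial_deriv v (sum Q (keys q))"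
    by (simp add: sum_product partial_deriv_sum sum.distrib)
  then show ?thesis by (simp flip: p q)
qed

lemma partial_deriv_Pol: "p \<in> Pol V \<Longrightarrow> partial_deriv v p \<in> Pol V"
  by (induction rule: mpoly_induct) (auto simp: partial_deriv_add partial_deriv_mult partial_deriv_Var)

lemma partial_deriv_homogeneous:
  fixes p :: "('v, complex) mpoly"
  assumes "homogeneous d p"
  shows "homogeneous (d - 1) (partial_deriv v p)"
  unfolding partial_deriv_def
proof (rule homogeneous_sum)
  fix s assume s: "s \<in> keys p"
  show "homogeneous (d - 1) (single (s - single v 1) (of_nat (lookup s v) * lookup p s))"
  proof (cases "v \<in> keys s")
    case True
    then obtain t where t: "s = t + single v 1" by (rule keys_splitE)
    with s assms have "d = tdeg t + 1" by (auto simp: homogeneous_tdeg)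
    then show ?thesis by (simp add: t homogeneous_tdeg)
  qed (simp add: in_keys_iff)
qed

subsection \<open>Coefficients of the universal jet\<close>

lemma pCons_Const_hom:
  "[:Const 0:] = 0" "[:Const 1:] = 1" "[:Const (x + y):] = [:Const x:] + [:Const (y :: complex):]"
  "[:Const (x * y):] = [:Const x:] * [:Const y:]"
  by (simp_all add: Const_add Const_mult one_pCons)

lemma jet_coeff_0 [simp]: "jet_coeff m 0 k = 0"
  by (simp add: jet_coeff_def mpoly_eval_def)

lemma jet_coeff_add: "jet_coeff m (p + q) k = jet_coeff m p k + jet_coeff m q k"
  by (simp add: jet_coeff_def mpoly_eval_add[of "\<lambda>c. [:Const c:]", OF pCons_Const_hom])

lemma jet_coeff_mult: "jet_coeff m (p * q) k = (\<Sum>i\<le>k. jet_coeff m p i * jet_coeff m q (k - i))"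
  by (simp add: jet_coeff_def mpoly_eval_mult[of "\<lambda>c. [:Const c:]", OF pCons_Const_hom] coeff_mult)

lemma jet_coeff_Const: "jet_coeff m (Const c) k = (if k = 0 then Const c else 0)"
  by (simp add: jet_coeff_def mpoly_eval_Const[of "\<lambda>c. [:Const c:]", OF pCons_Const_hom] coeff_pCons
      split: nat.splits)

lemma jet_coeff_Var: "jet_coeff m (Var i) k = (if k \<le> m then Var (i, k) else 0)"
  by (simp add: jet_coeff_def mpoly_eval_Var[of "\<lambda>c. [:Const c:]", OF pCons_Const_hom] universal_jet_def
      coeff_sum when_def)

text \<open>Coefficient k sees only coordinates of order at most k, which both truncations retain.
  This identifies the equations of jets of different orders.\<close>

lemma jet_coeff_cong: "k \<le> m \<Longrightarrow> k \<le> m' \<Longrightarrow> jet_coeff m p k = jet_coeff m' p k"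
  using Pol_UNIV[of p]
proof (induction arbitrary: k rule: mpoly_induct)
  case (mult p q)
  then show ?case unfolding jet_coeff_mult by (intro sum.cong) auto
qed (auto simp: jet_coeff_Const jet_coeff_Var jet_coeff_add)

lemma jet_coeff_Pol:
  assumes "p \<in> Pol V"
  shows "jet_coeff m p k \<in> Pol (V \<times> {..k})"
  using assms
proof (induction arbitrary: k rule: mpoly_induct)
  case (mult p q)
  show ?case
    unfolding jet_coeff_mult
  proof (intro Pol_sum Pol_mult)
    fix i assume "i \<in> {..k}"
    then have "V \<times> {..i} \<subseteq> V \<times> {..k}" "V \<times> {..k - i} \<subseteq> V \<times> {..k}" by auto
    from Pol_mono[OF this(1) mult(3)] Pol_mono[OF this(2) mult(4)]
    show "jet_coeff m p i \<in> Pol (V \<times> {..k})" "jet_coeff m q (k - i) \<in> Pol (V \<times> {..k})" .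
  qed
qed (auto simp: jet_coeff_Const jet_coeff_Var jet_coeff_add)

text \<open>Every x(i, j) has weight one here, whatever its order j. This grading makes the jet
  ideal homogeneous.\<close>

lemma jet_coeff_homogeneous:
  assumes "homogeneous d p"
  shows "homogeneous d (jet_coeff m p k)"
proof -
  have "\<forall>k. homogeneous d (jet_coeff m p k)"
    using Pol_UNIV assms
  proof (rule homogeneous_induct)
    fix p q d e assume "\<forall>k. homogeneous d (jet_coeff m p k)" "\<forall>k. homogeneous e (jet_coeff m q k)"
    then show "\<forall>k. homogeneous (d + e) (jet_coeff m (p * q) k)"
      unfolding jet_coeff_mult by (intro allI homogeneous_sum homogeneous_mult) auto
  qed (auto simp: jet_coeff_Const jet_coeff_Var jet_coeff_add homogeneous_add)
  then show ?thesis by blast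
qed

lemma jet_coeff_0_ren: "jet_coeff m p 0 = ren (\<lambda>i. (i, 0)) p"
  using Pol_UNIV[of p]
  by (induction rule: mpoly_induct)
    (auto simp: jet_coeff_Const jet_coeff_Var jet_coeff_add jet_coeff_mult ren_add ren_mult)

text \<open>In the coefficient of t^k of a product, coordinates of order k enter only through the
  two extreme summands, and these reproduce the Leibniz rule.\<close>

lemma jet_coeff_linear_part:
  assumes "p \<in> Pol {..<n}" "1 \<le> k" "k \<le> m"
  shows "jet_coeff m p k - (\<Sum>i<n. jet_coeff m (partial_deriv i p) 0 * Var (i, k)) \<in> Pol ({..<n} \<times> {..<k})"
  using assms(1)
proof (induction rule: mpoly_induct)
  case (Const c)
  then show ?case using assms(2) by (simp add: jet_coeff_Const)
next
  case (Var v)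
  have "(\<Sum>i<n. jet_coeff m (partial_deriv i (Var v)) 0 * Var (i, k)) = (\<Sum>i<n. if i = v then Var (v, k) else 0)"
    using jet_coeff_Const[of m 1 0] by (intro sum.cong) (auto simp: partial_deriv_Var)
  then show ?case using Var assms(3) by (simp add: jet_coeff_Var)
next
  case (add p q)
  from Pol_add[OF add(3,4)] show ?case
    by (simp add: jet_coeff_add partial_deriv_add distrib_right sum.distrib algebra_simps)
next
  case (mult p q)
  let ?D = "\<lambda>p. \<Sum>i<n. jet_coeff m (partial_deriv i p) 0 * Var (i, k)"
  let ?J = "jet_coeff m"
  have "(\<Sum>i\<le>k. ?J p i * ?J q (k - i)) = (\<Sum>i\<in>{0, k}. ?J p i * ?J q (k - i)) + (\<Sum>i\<in>{..k} - {0, k}. ?J p i * ?J q (k - i))"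
    by (subst sum.union_disjoint[symmetric]) (auto intro!: sum.cong)
  also have "(\<Sum>i\<in>{0, k}. ?J p i * ?J q (k - i)) = ?J p 0 * ?J q k + ?J p k * ?J q 0"
    using assms(2) by simp
  finally have "?J (p * q) k - ?D (p * q) =
      ?J p 0 * (?J q k - ?D q) + ?J q 0 * (?J p k - ?D p) + (\<Sum>i\<in>{..k} - {0, k}. ?J p i * ?J q (k - i))"
    by (simp add: jet_coeff_mult[of m p q k] partial_deriv_mult jet_coeff_add jet_coeff_mult[of _ _ _ 0]
      sum_distrib_left sum_distrib_right sum.distrib algebra_simps)
  also have "\<dots> \<in> Pol ({..<n} \<times> {..<k})"
  proof (intro Pol_add Pol_mult Pol_sum mult(3,4))
    have *: "?J r i \<in> Pol ({..<n} \<times> {..<k})" if "r \<in> Pol {..<n}" "i < k" for r i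
      by (rule Pol_mono[OF _ jet_coeff_Pol[OF that(1)]]) (use that(2) in auto)
    show "?J p 0 \<in> Pol ({..<n} \<times> {..<k})" "?J q 0 \<in> Pol ({..<n} \<times> {..<k})"
      using * mult(1,2) assms(2) by auto
    fix i assume "i \<in> {..k} - {0, k}"
    then show "?J p i \<in> Pol ({..<n} \<times> {..<k})" "?J q (k - i) \<in> Pol ({..<n} \<times> {..<k})"
      using * mult(1,2) by auto
  qed
  finally show ?case .
qed

text \<open>Membership in the ideal generated by the variables from Z, read off from the monomials.
  With Z the coordinates of order 0, it means vanishing at x(0) = 0.\<close>

definition meets :: "'v set \<Rightarrow> ('v, complex) mpoly \<Rightarrow> bool" where
  "meets Z p \<longleftrightarrow> (\<forall>s\<in>keys p. keys s \<inter> Z \<noteq> {})"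

lemma meets_0 [simp]: "meets Z 0"
  by (simp add: meets_def)

lemma meets_add: "meets Z p \<Longrightarrow> meets Z q \<Longrightarrow> meets Z (p + q)"
  using Poly_Mapping.keys_add[of p q] by (auto simp: meets_def)

lemma meets_uminus [simp]: "meets Z (- p) \<longleftrightarrow> meets Z p"
  by (simp add: meets_def keys_def)

lemma meets_mult_right: "meets Z q \<Longrightarrow> meets Z (p * q)"
proof -
  assume q: "meets Z q"
  show ?thesis
    unfolding meets_def
  proof
    fix s assume "s \<in> keys (p * q)"
    then obtain t u where "s = t + u" "u \<in> keys q" using keys_mult[of p q] by blast
    with q show "keys s \<inter> Z \<noteq> {}" by (auto simp: meets_def keys_add_nat)
  qed
qed

lemma meets_mult_left: "meets Z p \<Longrightarrow> meets Z (p * q)"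
  using meets_mult_right[of Z p q] by (simp add: mult.commute)

lemma meets_sum: "(\<And>x. x \<in> A \<Longrightarrow> meets Z (f x)) \<Longrightarrow> meets Z (sum f A)"
  by (induction A rule: infinite_finite_induct) (auto intro: meets_add)

definition jet_shift :: "nat \<times> nat \<Rightarrow> nat \<times> nat" where
  "jet_shift v = (fst v, Suc (snd v))"

text \<open>At \<open>x(0) = 0\<close> the universal jet is \<open>t\<close> times a shifted universal jet, so \<open>F(x(t))\<close> acquires
  the factor \<open>t ^ d\<close>.\<close>

lemma jet_coeff_shift:
  assumes "homogeneous d p" "k + d \<le> m"
  shows "meets (UNIV \<times> {0}) (jet_coeff m p (k + d) - ren jet_shift (jet_coeff m p k))"
proof -
  let ?Z = "UNIV \<times> {0} :: (nat \<times> nat) set"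
  let ?J = "jet_coeff m"
  let ?\<sigma> = "ren jet_shift"
  \<comment> \<open>The vanishing of the coefficients below d at x(0) = 0 is part of the claim
    because products need it: outside the middle range of the convolution one factor has such a low
    index.\<close>
  define R where "R d p \<longleftrightarrow> (\<forall>k<d. meets ?Z (?J p k)) \<and> (\<forall>k. k + d \<le> m \<longrightarrow> meets ?Z (?J p (k + d) - ?\<sigma> (?J p k)))" for d p
  have "R d p"
    using Pol_UNIV assms(1)
  proof (rule homogeneous_induct)
    show "R d 0" for d by (simp add: R_def)
    show "R 0 (Const c)" for c by (simp add: R_def jet_coeff_Const)
    show "R 1 (Var v)" for v
      by (auto simp: R_def jet_coeff_Var jet_shift_def) (simp add: meets_def Var_def)
    show "R d (p + q)" if "R d p" "R d q" for d p q
      using that meets_add unfolding R_def jet_coeff_add ren_add add_diff_add by blast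
    show "R (d + e) (p * q)" if p: "R d p" and q: "R e q" for d e p q
      unfolding R_def
    proof (intro conjI allI impI)
      fix k assume k: "k < d + e"
      show "meets ?Z (?J (p * q) k)"
        unfolding jet_coeff_mult
      proof (rule meets_sum)
        fix i assume "i \<in> {..k}"
        then consider "i < d" | "k - i < e" using k by force
        then show "meets ?Z (?J p i * ?J q (k - i))"
          using p q by cases (auto simp: R_def intro: meets_mult_left meets_mult_right)
      qed
    next
      fix k assume k: "k + (d + e) \<le> m"
      let ?f = "\<lambda>i. ?J p i * ?J q (k + (d + e) - i)"
      have "?J (p * q) (k + (d + e)) = sum ?f ({..k + (d + e)} - {d..k + d}) + sum ?f {d..k + d}"
        unfolding jet_coeff_mult by (rule sum.subset_diff) auto
      also have "sum ?f {d..k + d} = (\<Sum>j\<le>k. ?J p (j + d) * ?J q ((k - j) + e))"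
        by (rule sum.reindex_bij_witness[of _ "\<lambda>j. j + d" "\<lambda>i. i - d"]) (auto simp: algebra_simps)
      finally have "?J (p * q) (k + (d + e)) - ?\<sigma> (?J (p * q) k) = sum ?f ({..k + (d + e)} - {d..k + d}) +
          (\<Sum>j\<le>k. ?J p (j + d) * ?J q ((k - j) + e) - ?\<sigma> (?J p j) * ?\<sigma> (?J q (k - j)))"
        by (simp add: jet_coeff_mult[of m p q k] ren_sum ren_mult sum_subtractf)
      also have "meets ?Z \<dots>"
      proof (intro meets_add meets_sum)
        fix i assume "i \<in> {..k + (d + e)} - {d..k + d}"
        then consider "i < d" | "k + (d + e) - i < e" by force
        then show "meets ?Z (?f i)"
          using p q by cases (auto simp: R_def intro: meets_mult_left meets_mult_right)
      next
        fix j assume j: "j \<in> {..k}"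
        have "?J p (j + d) * ?J q ((k - j) + e) - ?\<sigma> (?J p j) * ?\<sigma> (?J q (k - j)) =
            (?J p (j + d) - ?\<sigma> (?J p j)) * ?J q ((k - j) + e) + ?\<sigma> (?J p j) * (?J q ((k - j) + e) - ?\<sigma> (?J q (k - j)))"
          by (simp add: algebra_simps)
        also have "meets ?Z \<dots>"
        proof (intro meets_add)
          have "j + d \<le> m" "k - j + e \<le> m" using j k by auto
          then have h: "meets ?Z (?J p (j + d) - ?\<sigma> (?J p j))" "meets ?Z (?J q ((k - j) + e) - ?\<sigma> (?J q (k - j)))"
            using p q unfolding R_def by blast+
          show "meets ?Z ((?J p (j + d) - ?\<sigma> (?J p j)) * ?J q ((k - j) + e))"
            and "meets ?Z (?\<sigma> (?J p j) * (?J q ((k - j) + e) - ?\<sigma> (?J q (k - j))))"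
            by (rule meets_mult_left[OF h(1)], rule meets_mult_right[OF h(2)])
        qed
        finally show "meets ?Z (?J p (j + d) * ?J q ((k - j) + e) - ?\<sigma> (?J p j) * ?\<sigma> (?J q (k - j)))" .
      qed
      finally show "meets ?Z (?J (p * q) (k + (d + e)) - ?\<sigma> (?J (p * q) k))" .
    qed
  qed
  with assms(2) show ?thesis
    by (auto simp: R_def)
qed

subsection \<open>Jets over the smooth and over the singular locus\<close>

definition sing_ideal :: "nat \<Rightarrow> (nat, complex) mpoly \<Rightarrow> (nat, complex) mpoly set" where
  "sing_ideal n F = genideal (mpoly_ring {..<n}) (insert F ((\<lambda>i. partial_deriv i F) ` {..<n}))"

lemma sing_gens_Pol: "F \<in> Pol {..<n} \<Longrightarrow> insert F ((\<lambda>i. partial_deriv i F) ` {..<n}) \<subseteq> Pol {..<n}"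
  by (auto intro: partial_deriv_Pol)

lemma hom_ideal_sing_ideal:
  assumes "F \<in> Pol {..<n}" "homogeneous d F"
  shows "hom_ideal {..<n} (sing_ideal n F)"
  unfolding sing_ideal_def
  by (rule hom_ideal_genideal[OF sing_gens_Pol[OF assms(1)]])
    (use assms(2) partial_deriv_homogeneous[OF assms(2)] in blast)

lemma jet_gens_Pol: "F \<in> Pol {..<n} \<Longrightarrow> jet_coeff m F ` {..m} \<subseteq> Pol (jet_coords n m)"
  using jet_coeff_carrier by blast

lemma hom_ideal_jet_ideal:
  assumes "F \<in> Pol {..<n}" "homogeneous d F"
  shows "hom_ideal (jet_coords n m) (jet_ideal n m F)"
  unfolding jet_ideal_def
  by (rule hom_ideal_genideal[OF jet_gens_Pol[OF assms(1)]])
    (use jet_coeff_homogeneous[OF assms(2)] in blast)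

lemma jet_coeff_in_jet_ideal: "F \<in> Pol {..<n} \<Longrightarrow> k \<le> m \<Longrightarrow> jet_coeff m F k \<in> jet_ideal n m F"
  unfolding jet_ideal_def by (rule genideal_gen[OF jet_gens_Pol]) auto

lemma jet_coeff_0_mult: "jet_coeff m (p * q) 0 = jet_coeff m p 0 * jet_coeff m q 0"
  by (simp add: jet_coeff_mult)

lemma jet_coeff_0_Pol: "p \<in> Pol {..<n} \<Longrightarrow> jet_coeff m p 0 \<in> Pol ({..<n} \<times> {0})"
  using jet_coeff_Pol[of p "{..<n}" m 0] by simp

text \<open>The zero ideal prolongs every chain above (F) downwards, and the prolonged chain has
  length at most n by the growth of the full polynomial ring.\<close>

lemma hilbert_bound_hypersurface:
  fixes F :: "(nat, complex) mpoly"
  assumes F: "F \<in> Pol {..<n}" "homogeneous d F" "F \<noteq> 0"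
  shows "hilbert_bound {..<n} (genideal (mpoly_ring {..<n}) {F}) (n - 1)"
proof (rule hilbert_bound_of_prime_chains)
  let ?I = "genideal (mpoly_ring {..<n}) {F}"
  show "hom_ideal {..<n} ?I"
    by (rule hom_ideal_genideal) (use F in auto)
  fix l P assume P: "prime_chain {..<n} ?I l P"
  have zero: "primeideal {0} (mpoly_ring {..<n})"
    by (auto simp: primeideal_mpoly_iff ideal_mpoly_iff)
  have "F \<in> P 0"
    using P genideal_gen[of "{F}" "{..<n}" F] F(1) by (auto simp: prime_chain_def)
  moreover have "0 \<in> P 0"
    using P ideal_0[OF prime_ideal] by (auto simp: prime_chain_def)
  ultimately have "{0} \<subset> P 0" using F(3) by auto
  note chain = prime_chain_Suc[OF P zero this]
  have "hilbert_bound {..<n} {0} n"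
    using hilbert_bound_free[of "{..<n}" "{0}"] by simp
  with prime_chain_le_hilbert_bound[OF chain, of n] show "l \<le> n - 1" by simp
qed simp

text \<open>\<open>jet_coeff m p 0\<close> is p written in the coordinates x(0), so growth on affine
  space becomes growth in x(0) modulo an ideal of jets.\<close>

lemma hilbert_bound_base:
  assumes "hilbert_bound {..<n} I \<delta>" "\<And>p. p \<in> I \<Longrightarrow> jet_coeff m p 0 \<in> Q"
  shows "hilbert_bound ({..<n} \<times> {0}) Q \<delta>"
proof -
  have "hilbert_bound ((\<lambda>i. (i, 0)) ` {..<n}) Q \<delta>"
    using assms by (intro hilbert_bound_ren[of _ _ _ fst]) (auto simp: jet_coeff_0_ren)
  moreover have "(\<lambda>i. (i, 0)) ` {..<n} = {..<n} \<times> {0 :: nat}" by auto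
  ultimately show ?thesis by simp
qed

lemma genideal_base:
  assumes A: "A \<subseteq> Pol {..<n}" "\<And>p. p \<in> A \<Longrightarrow> jet_coeff m p 0 \<in> Q"
    and Q: "ideal Q (mpoly_ring (jet_coords n m))"
    and p: "p \<in> genideal (mpoly_ring {..<n}) A"
  shows "jet_coeff m p 0 \<in> Q"
  using p A(1)
proof (induction rule: genideal_induct)
  case (mult p q)
  then show ?case
    unfolding jet_coeff_0_mult using Pol_mono[OF _ jet_coeff_0_Pol[OF mult(1)], of "jet_coords n m" m]
    by (intro ideal_mult[OF Q]) auto
qed (auto simp: A(2) ideal_0[OF Q] jet_coeff_add intro: ideal_add[OF Q])

text \<open>The relation \<open>F\<^sub>k = 0\<close> expresses \<open>G x(i, k)\<close> by the variables of lower index and those of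
  index \<open>k\<close> other than \<open>x(i, k)\<close>.\<close>

lemma smooth_jets_bound:
  assumes F: "F \<in> Pol {..<n}" "homogeneous d F" "F \<noteq> 0"
    and chain: "prime_chain (jet_coords n m) (jet_ideal n m F) l P"
    and i: "i < n" and G: "jet_coeff m (partial_deriv i F) 0 \<notin> P 0"
  shows "l \<le> (m + 1) * (n - 1)"
proof -
  define V where "V = jet_coords n m"
  define Q where "Q = P 0"
  define G where "G = jet_coeff m (partial_deriv i F) 0"
  define X0 :: "(nat \<times> nat) set" where "X0 = {..<n} \<times> {0}"
  \<comment> \<open>The coordinates left after elimination. F(x(0)) is a relation among those of
    order 0, so they contribute n - 1; the m higher orders contribute n - 1 each.\<close>
  define S where "S = X0 \<union> ({..<n} - {i}) \<times> {1..m}"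
  have Q: "primeideal Q (mpoly_ring V)" and IQ: "jet_ideal n m F \<subseteq> Q"
    using chain by (auto simp: prime_chain_def Q_def V_def)
  note id = prime_ideal[OF Q]
  have FQ: "jet_coeff m F k \<in> Q" if "k \<le> m" for k
    using jet_coeff_in_jet_ideal[OF F(1) that] IQ by blast
  have SV: "S \<subseteq> V" by (auto simp: S_def V_def X0_def)
  have GX0: "G \<in> Pol X0"
    unfolding G_def X0_def using F(1) by (intro jet_coeff_0_Pol partial_deriv_Pol)
  then have GS: "G \<in> Pol S" using Pol_mono[of X0 S] by (auto simp: S_def)
  then have GV: "G \<in> Pol V" using Pol_mono[OF SV] by blast
  have "hilbert_bound X0 Q (n - 1)"
    unfolding X0_def
  proof (rule hilbert_bound_base[OF hilbert_bound_hypersurface[OF F]])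
    show "jet_coeff m p 0 \<in> Q" if "p \<in> genideal (mpoly_ring {..<n}) {F}" for p
      by (rule genideal_base[OF _ _ id[unfolded V_def] that]) (use F(1) FQ in auto)
  qed
  from hilbert_bound_Un[OF id _ _ this hilbert_bound_free[of "({..<n} - {i}) \<times> {1..m}" Q]]
  have "hilbert_bound S Q ((n - 1) + card (({..<n} - {i}) \<times> {1..m}))"
    using SV unfolding S_def X0_def by (force simp del: card_cartesian_product)
  moreover have "card (({..<n} - {i}) \<times> {1..m}) = (n - 1) * m"
    using i by (simp add: card_cartesian_product)
  moreover have "(n - 1) + (n - 1) * m = (m + 1) * (n - 1)"
    by (metis Suc_eq_plus1 mult.commute mult_Suc)
  ultimately have bound: "hilbert_bound S Q ((m + 1) * (n - 1))"
    by (simp only:)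
  \<comment> \<open>The polynomials that, modulo Q and after inverting G, lie in the subring
    generated by S. They are closed under sums and products, so it is enough to treat the missing
    variables x(i, k).\<close>
  define L where "L p \<longleftrightarrow> (\<exists>c q. q \<in> Pol S \<and> G ^ c * p - q \<in> Q)" for p
  have L_S: "L p" if "p \<in> Pol S" for p
    unfolding L_def using that ideal_0[OF id] by (intro exI[of _ 0] exI[of _ p]) auto
  have L_add: "L (p + q)" if Lp: "L p" and Lq: "L q" for p q
  proof -
    obtain c p' where p': "p' \<in> Pol S" "G ^ c * p - p' \<in> Q" using Lp by (auto simp: L_def)
    obtain e q' where q': "q' \<in> Pol S" "G ^ e * q - q' \<in> Q" using Lq by (auto simp: L_def)
    have "G ^ (c + e) * (p + q) - (G ^ e * p' + G ^ c * q') = G ^ e * (G ^ c * p - p') + G ^ c * (G ^ e * q - q')"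
      by (simp add: power_add algebra_simps)
    also have "\<dots> \<in> Q"
      using GV by (intro ideal_add[OF id] ideal_mult[OF id] p' q') auto
    finally show ?thesis
      unfolding L_def using GS p'(1) q'(1) by (intro exI[of _ "c + e"] exI[of _ "G ^ e * p' + G ^ c * q'"]) auto
  qed
  have L_mult: "L (p * q)" if Lp: "L p" and Lq: "L q" and pV: "p \<in> Pol V" for p q
  proof -
    obtain c p' where p': "p' \<in> Pol S" "G ^ c * p - p' \<in> Q" using Lp by (auto simp: L_def)
    obtain e q' where q': "q' \<in> Pol S" "G ^ e * q - q' \<in> Q" using Lq by (auto simp: L_def)
    have "G ^ (c + e) * (p * q) - p' * q' = q' * (G ^ c * p - p') + (G ^ c * p) * (G ^ e * q - q')"
      by (simp add: power_add algebra_simps)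
    also have "\<dots> \<in> Q"
      using GV pV Pol_mono[OF SV q'(1)] by (intro ideal_add[OF id] ideal_mult[OF id] p' q') auto
    finally show ?thesis
      unfolding L_def using p'(1) q'(1) by (intro exI[of _ "c + e"] exI[of _ "p' * q'"]) auto
  qed
  have L_Pol: "L p" if "p \<in> Pol W" "W \<subseteq> V" "\<And>w. w \<in> W \<Longrightarrow> L (Var w)" for p W
    using that
  proof (induction rule: mpoly_induct)
    case (Const c)
    show ?case by (rule L_S) simp
  next
    case (mult p q)
    then show ?case using Pol_mono[OF mult(5) mult(1)] by (intro L_mult) auto
  qed (auto intro: L_add)
  have L_i: "L (Var (i, k))" if "k \<le> m" for k
    using that
  proof (induction k rule: less_induct)
    case (less k)
    show ?case
    proof (cases "k = 0")
      case True
      then show ?thesis using i by (intro L_S) (auto simp: S_def X0_def)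
    next
      case False
      \<comment> \<open>The coordinates that can occur in \<open>H\<close>, the rest of F_k after
        removal of G x(i, k): those of smaller order, covered by induction, and those of order k
        lying in S.\<close>
      define W where "W = {..<n} \<times> {..<k} \<union> ({..<n} - {i}) \<times> {k}"
      define H where "H = jet_coeff m F k - G * Var (i, k)"
      have "L (Var w)" if "w \<in> W" for w
        using that less False unfolding W_def
        by (cases "w \<in> S") (auto simp: S_def X0_def intro: L_S)
      moreover have "H \<in> Pol W"
      proof -
        have "(\<Sum>j<n. jet_coeff m (partial_deriv j F) 0 * Var (j, k)) =
            G * Var (i, k) + (\<Sum>j\<in>{..<n} - {i}. jet_coeff m (partial_deriv j F) 0 * Var (j, k))"
          using i by (subst sum.remove[of _ i]) (auto simp: G_def)
        then have H: "H = (jet_coeff m F k - (\<Sum>j<n. jet_coeff m (partial_deriv j F) 0 * Var (j, k)))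
            + (\<Sum>j\<in>{..<n} - {i}. jet_coeff m (partial_deriv j F) 0 * Var (j, k))"
          by (simp add: H_def)
        have W: "{..<n} \<times> {..<k} \<subseteq> W" "{..<n} \<times> {0} \<subseteq> W" using False by (auto simp: W_def)
        show ?thesis
          unfolding H
        proof (intro Pol_add Pol_sum Pol_mult)
          show "jet_coeff m F k - (\<Sum>j<n. jet_coeff m (partial_deriv j F) 0 * Var (j, k)) \<in> Pol W"
            using jet_coeff_linear_part[OF F(1)] False less(2) by (intro Pol_mono[OF W(1)]) auto
          show "jet_coeff m (partial_deriv j F) 0 \<in> Pol W" for j
            by (intro Pol_mono[OF W(2)] jet_coeff_0_Pol partial_deriv_Pol F(1))
          show "Var (j, k) \<in> Pol W" if "j \<in> {..<n} - {i}" for j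
            using that by (auto simp: W_def)
        qed
      qed
      moreover have "W \<subseteq> V" using less(2) by (auto simp: W_def V_def)
      ultimately have "L H" by (intro L_Pol[of H W]) auto
      then obtain c q where cq: "q \<in> Pol S" "G ^ c * H - q \<in> Q" by (auto simp: L_def)
      have "G ^ Suc c * Var (i, k) - (- q) = G ^ c * jet_coeff m F k - (G ^ c * H - q)"
        by (simp add: H_def algebra_simps)
      also have "\<dots> \<in> Q"
        using GV less(2) by (intro ideal_diff[OF id] ideal_mult[OF id] FQ cq) auto
      finally show ?thesis
        unfolding L_def using cq(1) by (intro exI[of _ "Suc c"] exI[of _ "- q"]) auto
    qed
  qed
  show ?thesis
  proof (rule prime_chain_le_localized[OF chain _ SV[unfolded V_def] GS])
    show "G \<notin> P 0" using G by (simp add: G_def)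
    show "hilbert_bound S (P 0) ((m + 1) * (n - 1))" using bound by (simp add: Q_def)
    fix v assume v: "v \<in> jet_coords n m"
    have "L (Var v)"
    proof (cases "v \<in> S")
      case False
      with v have "v = (i, snd v)" "snd v \<le> m" by (auto simp: S_def X0_def)
      with L_i[of "snd v"] show ?thesis by simp
    qed (auto intro: L_S)
    then show "\<exists>c q. q \<in> Pol S \<and> G ^ c * Var v - q \<in> P 0" by (simp add: L_def Q_def)
  qed simp
qed

text \<open>The jets of order \<open>m' + d\<close> over the origin are jets of order \<open>m'\<close>, up to the last \<open>n (d - 1)\<close>
  coordinates, and the jets over the other singular points degenerate to them.\<close>

lemma singular_jets_bound:
  fixes \<rho> :: nat
  assumes F: "F \<in> Pol {..<n}" "homogeneous d F" and d: "1 \<le> d" and m: "m = m' + d"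
    and Q: "primeideal Q (mpoly_ring (jet_coords n m))" "jet_ideal n m F \<subseteq> Q"
    and base: "hilbert_bound ({..<n} \<times> {0}) Q \<rho>"
    and IH: "hilbert_bound (jet_coords n m') (jet_ideal n m' F) e"
  shows "hilbert_bound (jet_coords n m) Q (\<rho> + n * (d - 1) + e)"
proof -
  define V where "V = jet_coords n m"
  \<comment> \<open>X1 consists of the m' + 1 orders in the image of the shift. X2 collects the d -
    1 orders above them, whose coordinates are treated as free.\<close>
  define X0 :: "(nat \<times> nat) set" where "X0 = {..<n} \<times> {0}"
  define X1 where "X1 = {..<n} \<times> {1..m' + 1}"
  define X2 where "X2 = {..<n} \<times> {m' + 2..m}"
  define \<sigma> where "\<sigma> = ren jet_shift"
  note id = prime_ideal[OF Q(1)]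
  have V: "X0 \<union> X2 \<union> X1 = V" using m d by (auto simp: V_def X0_def X1_def X2_def)
  have disj: "(X0 \<union> X2) \<inter> X1 = {}" "X0 \<inter> X2 = {}" by (auto simp: X0_def X1_def X2_def)
  have card: "card X2 = n * (d - 1)" using m by (simp add: X2_def card_cartesian_product)
  have bound0: "hilbert_bound (X0 \<union> X2) Q (\<rho> + n * (d - 1))"
    unfolding card[symmetric]
    by (rule hilbert_bound_Un[OF id disj(2) _ base[folded X0_def] hilbert_bound_free])
      (use V V_def in \<open>auto simp: X2_def\<close>)
  have \<sigma>_Pol: "\<sigma> p \<in> Pol X1" if "p \<in> Pol (jet_coords n m')" for p
    unfolding \<sigma>_def using that by (rule ren_Pol) (auto simp: X1_def jet_shift_def)
  have X1V: "p \<in> Pol V" if "p \<in> Pol X1" for p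
    using that V by (intro Pol_mono[of X1 V]) auto
  \<comment> \<open>Congruent modulo Q to a form of degree N that vanishes at x(0) = 0: the error
    that the degeneration tolerates.\<close>
  define Low where "Low N p \<longleftrightarrow> (\<exists>q\<in>Pol V. homogeneous N q \<and> meets (UNIV \<times> {0}) q \<and> p - q \<in> Q)" for N p
  have Low_0: "Low N 0" for N
    unfolding Low_def using ideal_0[OF id] by (intro bexI[of _ 0]) auto
  have Low_add: "Low N (p + q)" if "Low N p" "Low N q" for N p q
  proof -
    obtain p' q' where "p' \<in> Pol V" "homogeneous N p'" "meets (UNIV \<times> {0}) p'" "p - p' \<in> Q"
      "q' \<in> Pol V" "homogeneous N q'" "meets (UNIV \<times> {0}) q'" "q - q' \<in> Q"
      using \<open>Low N p\<close> \<open>Low N q\<close> unfolding Low_def by blast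
    then show ?thesis
      unfolding Low_def using ideal_add[OF id, of "p - p'" "q - q'"]
      by (intro bexI[of _ "p' + q'"]) (auto intro: homogeneous_add meets_add simp: algebra_simps)
  qed
  have Low_sum: "Low N (sum f A)" if "\<And>x. x \<in> A \<Longrightarrow> Low N (f x)" for N f and A :: "nat set"
    using that by (induction A rule: infinite_finite_induct) (auto intro: Low_0 Low_add)
  have Low_mult: "Low (M + N) (p * q)" if "p \<in> Pol V" "homogeneous M p" "Low N q" for M N p q
  proof -
    obtain q' where "q' \<in> Pol V" "homogeneous N q'" "meets (UNIV \<times> {0}) q'" "q - q' \<in> Q"
      using \<open>Low N q\<close> unfolding Low_def by blast
    with that(1,2) show ?thesis
      unfolding Low_def using ideal_mult[OF id, of p "q - q'"]
      by (intro bexI[of _ "p * q'"]) (auto intro: homogeneous_mult meets_mult_right simp: algebra_simps V_def)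
  qed
  \<comment> \<open>Every component is tracked, since members of the jet ideal need not be
    homogeneous and \<open>Low\<close> concerns a single degree.\<close>
  have Low_jets: "\<forall>N. Low N (\<sigma> (hcomp N p))" if p: "p \<in> jet_ideal n m' F" for p
    using p[unfolded jet_ideal_def] jet_gens_Pol[OF F(1)]
  proof (induction rule: genideal_induct)
    case (gen p)
    then obtain k where k: "k \<le> m'" "p = jet_coeff m' F k" by blast
    then have p: "p = jet_coeff m F k" using m by (simp add: jet_coeff_cong[of k m' m])
    have hom: "homogeneous d p" using F(2) by (simp add: p jet_coeff_homogeneous)
    have "Low d (\<sigma> p)"
      unfolding Low_def
    proof (intro bexI conjI)
      \<comment> \<open>F_(k + d) belongs to Q and differs from the shifted F_k by terms vanishing
        at x(0) = 0, so the shifted F_k is congruent to minus this difference.\<close>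
      let ?q = "- (jet_coeff m F (k + d) - \<sigma> p)"
      have km: "k + d \<le> m" using k m by simp
      show "meets (UNIV \<times> {0}) ?q"
        using jet_coeff_shift[OF F(2) km] by (simp only: meets_uminus \<sigma>_def p)
      have "homogeneous d (\<sigma> p)" unfolding \<sigma>_def using hom by (rule ren_homogeneous)
      then show "homogeneous d ?q"
        using jet_coeff_homogeneous[OF F(2)] homogeneous_diff homogeneous_uminus by blast
      have "p \<in> Pol (jet_coords n m')" using gen jet_gens_Pol[OF F(1)] by blast
      then show "?q \<in> Pol V"
        using jet_coeff_carrier[OF F(1)] X1V[OF \<sigma>_Pol] by (auto simp: V_def)
      show "\<sigma> p - ?q \<in> Q"
        using jet_coeff_in_jet_ideal[OF F(1) km] Q(2) by auto
    qed
    then show ?case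
      using Low_0 by (simp add: hcomp_homogeneous[OF hom]) (simp add: \<sigma>_def)
  next
    case 0
    then show ?case using Low_0 by (simp add: \<sigma>_def)
  next
    case (add p q)
    then show ?case using Low_add by (simp add: hcomp_add \<sigma>_def ren_add)
  next
    case (mult p q)
    show ?case
    proof
      fix N
      have "Low (a + (N - a)) (\<sigma> (hcomp a p) * \<sigma> (hcomp (N - a) q))" for a
        by (rule Low_mult) (use mult in \<open>auto simp: \<sigma>_def intro: X1V[OF \<sigma>_Pol, unfolded \<sigma>_def] ren_homogeneous\<close>)
      then have "Low N (\<sigma> (hcomp a p) * \<sigma> (hcomp (N - a) q))" if "a \<le> N" for a
        using that by (metis le_add_diff_inverse)
      then show "Low N (\<sigma> (hcomp N (p * q)))"
        unfolding hcomp_mult \<sigma>_def ren_sum ren_mult by (intro Low_sum) auto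
    qed
  qed
  obtain B C where B: "hilbert_data (jet_coords n m') (jet_ideal n m' F) e B C"
    using IH by (auto simp: hilbert_bound_def)
  note idm' = hom_idealD[OF hom_ideal_jet_ideal[OF F]]
  have "hilbert_bound ((X0 \<union> X2) \<union> X1) Q ((\<rho> + n * (d - 1)) + e)"
  proof (rule hilbert_bound_degeneration[OF id disj(1) _ bound0, of "\<lambda>N. \<sigma> ` B N" C])
    show "X0 \<union> X2 \<union> X1 \<subseteq> jet_coords n m" using V by (simp add: V_def)
    show "finite (\<sigma> ` B N)" for N using hilbert_dataD(1)[OF B] by simp
    show "b \<in> Pol X1" if "b \<in> \<sigma> ` B N" for b N
      using that hilbert_dataD(2)[OF B] \<sigma>_Pol by blast
    show "homogeneous N b" if "b \<in> \<sigma> ` B N" for b N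
      using that hilbert_dataD(3)[OF B] by (auto simp: \<sigma>_def intro: ren_homogeneous)
    show "(\<Sum>j\<le>N. card (\<sigma> ` B j)) \<le> C * (N + 1) ^ e" for N
      by (rule order_trans[OF sum_mono hilbert_dataD(5)[OF B]]) (intro card_image_le hilbert_dataD(1)[OF B])
    fix s :: "nat \<times> nat \<Rightarrow>\<^sub>0 nat" assume s: "keys s \<subseteq> X1"
    \<comment> \<open>The monomial with all orders lowered by one, that is, its preimage under the
      shift; there the spanning set for jets of order m' is available.\<close>
    define p where "p = ren (\<lambda>v. (fst v, snd v - 1)) (mon s)"
    have p_Pol: "p \<in> Pol (jet_coords n m')"
      unfolding p_def using s by (intro ren_Pol[of _ X1]) (auto simp: X1_def)
    have p_hom: "homogeneous (tdeg s) p"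
      unfolding p_def by (rule ren_homogeneous) simp
    have "\<sigma> p = mon s"
      unfolding p_def \<sigma>_def using s
      by (intro ren_inverse[of _ X1]) (auto simp: X1_def jet_shift_def)
    obtain b i where bi: "b \<in> mp.span (B (tdeg s))" "i \<in> jet_ideal n m' F" "p = b + i"
      by (rule span_Un_ideal[OF idm'(1) hilbert_data_span[OF B p_Pol p_hom]])
    have "homogeneous (tdeg s) b"
      using hilbert_dataD(3)[OF B] bi(1) by (rule span_homogeneous)
    then have "homogeneous (tdeg s) i"
      using homogeneous_diff[OF p_hom, of b] bi(3) by simp
    then have "hcomp (tdeg s) i = i" by (simp add: hcomp_homogeneous)
    with Low_jets[OF bi(2)] have "Low (tdeg s) (\<sigma> i)" by metis
    then obtain q where q: "q \<in> Pol V" "homogeneous (tdeg s) q" "meets (UNIV \<times> {0}) q" "\<sigma> i - q \<in> Q"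
      by (auto simp: Low_def)
    have "mon s - \<sigma> b - q = \<sigma> i - q"
      by (simp add: \<open>\<sigma> p = mon s\<close>[symmetric] bi(3) \<sigma>_def ren_add)
    moreover have "keys u \<inter> (X0 \<union> X2) \<noteq> {}" if "u \<in> keys q" for u
    proof -
      from q(3) that obtain j where j: "(j, 0) \<in> keys u" by (auto simp: meets_def)
      with q(1) that have "j < n" by (auto simp: Pol_iff V_def)
      with j show ?thesis by (auto simp: X0_def)
    qed
    ultimately show "\<exists>b\<in>mp.span (\<sigma> ` B (tdeg s)). \<exists>q\<in>Pol (X0 \<union> X2 \<union> X1). homogeneous (tdeg s) q \<and>
        (\<forall>u\<in>keys q. keys u \<inter> (X0 \<union> X2) \<noteq> {}) \<and> mon s - b - q \<in> Q"
      using q ren_span[OF bi(1), of jet_shift] unfolding V \<sigma>_def[symmetric]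
      by (intro bexI[of _ "\<sigma> b"] bexI[of _ q]) auto
  qed
  then show ?thesis by (simp add: V V_def)
qed

subsection \<open>Dimension of the jet schemes\<close>

lemma prime_chain_Sing:
  assumes F: "F \<in> Pol {..<n}" and chain: "prime_chain {..<n} (sing_ideal n F) l P"
  shows "ereal (real l) \<le> krull_dim (Sing n F)"
proof -
  have gens: "F \<in> sing_ideal n F" "\<And>i. i < n \<Longrightarrow> partial_deriv i F \<in> sing_ideal n F"
    unfolding sing_ideal_def by (intro genideal_gen sing_gens_Pol F; simp)+
  have P: "P i \<in> Sing n F" if "i \<le> l" for i
    using chain that gens by (auto simp: prime_chain_def Sing_def Spec_def)
  have "ereal (real l) \<le> (SUP l\<in>{l. \<exists>P::nat \<Rightarrow> _ set. (\<forall>i\<le>l. P i \<in> Sing n F) \<and> (\<forall>i<l. P i \<subset> P (Suc i))}. ereal (real l))"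
    by (rule SUP_upper) (use P chain in \<open>auto simp: prime_chain_def\<close>)
  then show ?thesis
    using P[of 0] unfolding krull_dim_def by (auto split: if_splits)
qed

text \<open>Primes of the quotient pull back to primes above I, and strict inclusions stay strict
  because the quotient map is onto. Nonnegativity of c takes care of an empty spectrum, of dimension
  -1.\<close>

lemma krull_dim_quotient_le:
  assumes I: "ideal I (mpoly_ring V)" and c: "0 \<le> c"
    and chains: "\<And>l P. prime_chain V I l P \<Longrightarrow> real l \<le> c"
  shows "krull_dim (Spec (mpoly_ring V Quot I)) \<le> ereal c"
proof -
  let ?R = "mpoly_ring V" and ?S = "mpoly_ring V Quot I"
  let ?h = "(+>\<^bsub>?R\<^esub>) I"
  interpret I: ideal I ?R by (rule I)
  interpret h: ring_hom_ring ?R ?S ?h by (rule I.rcos_ring_hom_ring)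
  interpret cring ?R by (rule cring_mpoly_ring)
  define pre where "pre P = {p \<in> Pol V. ?h p \<in> P}" for P
  have prime: "primeideal (pre P) ?R" and contains: "I \<subseteq> pre P" if P: "primeideal P ?S" for P
  proof -
    interpret P: primeideal P ?S by (rule P)
    have ideal: "ideal (pre P) ?R"
      unfolding pre_def by (rule h.ideal_vimage[OF P.is_ideal])
    have "?h \<one>\<^bsub>?R\<^esub> \<notin> P"
      unfolding h.hom_one using P.one_imp_carrier P.I_notcarr by metis
    then have "1 \<notin> pre P" by (simp add: pre_def)
    moreover have "p \<in> pre P \<or> q \<in> pre P" if "p \<in> Pol V" "q \<in> Pol V" "p * q \<in> pre P" for p q
    proof -
      have "?h p \<otimes>\<^bsub>?S\<^esub> ?h q = ?h (p * q)" using that(1,2) h.hom_mult[of p q] by simp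
      then have "?h p \<otimes>\<^bsub>?S\<^esub> ?h q \<in> P" using that(3) by (simp add: pre_def)
      then show ?thesis using P.I_prime[of "?h p" "?h q"] that(1,2) by (auto simp: pre_def)
    qed
    ultimately show "primeideal (pre P) ?R"
      using ideal by (auto simp: primeideal_mpoly_iff)
    have "I \<in> P"
      using additive_subgroup.zero_closed[OF P.is_additive_subgroup] by (simp add: FactRing_def)
    then show "I \<subseteq> pre P"
      using ideal_subset[OF I] I.a_rcos_const by (auto simp: pre_def)
  qed
  have strict: "pre P \<subset> pre Q" if PQ: "P \<subset> Q" and "primeideal P ?S" "primeideal Q ?S" for P Q
  proof -
    obtain x where x: "x \<in> Q" "x \<notin> P" using PQ by blast
    have "x \<in> carrier ?S"
      using x(1) ideal.Icarr[OF primeideal.axioms(1)[OF that(3)]] by blast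
    then obtain p where "p \<in> Pol V" "x = ?h p"
      by (auto simp: FactRing_def A_RCOSETS_def')
    with x that(1) show ?thesis by (auto simp: pre_def)
  qed
  show ?thesis
  proof (cases "Spec ?S = {}")
    case True
    then show ?thesis using c by (simp add: krull_dim_def one_ereal_def)
  next
    case False
    have "ereal (real l) \<le> ereal c" if "\<forall>i\<le>l. P i \<in> Spec ?S" "\<forall>i<l. P i \<subset> P (Suc i)" for l P
    proof -
      have "primeideal (P i) ?S" if "i \<le> l" for i
        using that \<open>\<forall>i\<le>l. P i \<in> Spec ?S\<close> by (auto simp: Spec_def)
      then have "prime_chain V I l (\<lambda>i. pre (P i))"
        using that(2) prime contains strict by (auto simp: prime_chain_def)
      then show ?thesis using chains by simp
    qed
    then show ?thesis
      using False unfolding krull_dim_def by (auto intro!: SUP_least)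
  qed
qed

text \<open>The two demands on s are the costs of the two cases: n - 1 per order over the smooth
  locus, and \<rho> + n (d - 1) per d orders over the singular locus. The latter is made only if
  there are singular points.\<close>

lemma jet_chain_length:
  fixes s :: real and F :: "(nat, complex) mpoly"
  assumes n: "1 \<le> n" and d: "1 \<le> d" and F: "F \<in> Pol {..<n}" "homogeneous d F" "F \<noteq> 0"
    and s: "real n - 1 \<le> s"
    and sing: "Sing n F \<noteq> {} \<Longrightarrow> \<exists>\<rho>\<le>n. (\<forall>l P. prime_chain {..<n} (sing_ideal n F) l P \<longrightarrow> l \<le> \<rho>) \<and>
      real n * real d - real n + real \<rho> \<le> real d * s"
    and chain: "prime_chain (jet_coords n m) (jet_ideal n m F) l P"
  shows "real l \<le> real (m + 1) * s"
  using chain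
proof (induction m arbitrary: l P rule: less_induct)
  case (less m)
  let ?V = "jet_coords n m"
  define Q where "Q = P 0"
  have Q: "primeideal Q (mpoly_ring ?V)" and IQ: "jet_ideal n m F \<subseteq> Q"
    using less(2) by (auto simp: prime_chain_def Q_def)
  note id = prime_ideal[OF Q]
  have s0: "0 \<le> s" using s n by linarith
  show ?case
  proof (cases "\<forall>i<n. jet_coeff m (partial_deriv i F) 0 \<in> Q")
    case False
    then obtain i where "i < n" "jet_coeff m (partial_deriv i F) 0 \<notin> P 0" by (auto simp: Q_def)
    from smooth_jets_bound[OF F less(2) this] have "real l \<le> real ((m + 1) * (n - 1))" by (simp only: of_nat_le_iff)
    also have "\<dots> = real (m + 1) * (real n - 1)" using n by (cases n) (simp_all add: algebra_simps)
    also have "\<dots> \<le> real (m + 1) * s" using s by (intro mult_left_mono) auto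
    finally show ?thesis .
  next
    case True
    have F0: "jet_coeff m F 0 \<in> Q" using jet_coeff_in_jet_ideal[OF F(1), of 0 m] IQ by blast
    have J0V: "jet_coeff m p 0 \<in> Pol ?V" if "p \<in> Pol {..<n}" for p
      by (rule Pol_mono[OF _ jet_coeff_0_Pol[OF that]]) auto
    \<comment> \<open>The trace of Q on the coordinates x(0). It is a point of the singular locus,
      which makes \<open>sing\<close> applicable.\<close>
    define T where "T = {p \<in> Pol {..<n}. jet_coeff m p 0 \<in> Q}"
    have "primeideal T (mpoly_ring {..<n})"
      unfolding primeideal_mpoly_iff ideal_mpoly_iff
    proof (intro conjI ballI impI)
      show "1 \<notin> T" using prime_1[OF Q] jet_coeff_Const[of m 1 0] by (simp add: T_def)
      show "p * q \<in> T" if "p \<in> Pol {..<n}" "q \<in> T" for p q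
        using that ideal_mult[OF id J0V] by (auto simp: T_def jet_coeff_0_mult)
      show "p \<in> T \<or> q \<in> T" if "p \<in> Pol {..<n}" "q \<in> Pol {..<n}" "p * q \<in> T" for p q
        using that prime_mult[OF Q J0V J0V] by (auto simp: T_def jet_coeff_0_mult)
    qed (auto simp: T_def ideal_0[OF id] jet_coeff_add intro: ideal_add[OF id])
    then have "T \<in> Sing n F"
      using F(1) F0 True by (auto simp: Sing_def Spec_def T_def intro: partial_deriv_Pol)
    then obtain \<rho> where \<rho>: "\<rho> \<le> n" "\<And>l P. prime_chain {..<n} (sing_ideal n F) l P \<Longrightarrow> l \<le> \<rho>"
      "real n * real d - real n + real \<rho> \<le> real d * s"
      using sing by blast
    have "hilbert_bound {..<n} (sing_ideal n F) \<rho>"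
      by (rule hilbert_bound_of_prime_chains[OF _ hom_ideal_sing_ideal[OF F(1,2)] \<rho>(2)]) simp
    then have base: "hilbert_bound ({..<n} \<times> {0}) Q \<rho>"
    proof (rule hilbert_bound_base)
      fix p assume "p \<in> sing_ideal n F"
      then show "jet_coeff m p 0 \<in> Q"
        unfolding sing_ideal_def
        by (rule genideal_base[OF sing_gens_Pol[OF F(1)] _ id, rotated]) (use F0 True in auto)
    qed
    show ?thesis
    proof (cases "m < d")
      case True
      have "hilbert_bound ({..<n} \<times> {0} \<union> {..<n} \<times> {1..m}) Q (\<rho> + card ({..<n} \<times> {1..m}))"
        by (rule hilbert_bound_Un[OF id _ _ base hilbert_bound_free]) auto
      moreover have "{..<n} \<times> {0} \<union> {..<n} \<times> {1..m} = ?V" by auto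
      ultimately have "hilbert_bound ?V (P 0) (\<rho> + n * m)"
        by (simp add: card_cartesian_product Q_def)
      from prime_chain_le_hilbert_bound[OF less(2) _ this] have "l \<le> \<rho> + n * m" by simp
      then have l: "real l \<le> real \<rho> + real n * real m"
        by (metis of_nat_add of_nat_le_iff of_nat_mult)
      \<comment> \<open>This product is (m + 1) (n d - n + \<rho>) minus d (\<rho> + n m); its sign
        uses \<rho> \<le> n and m < d.\<close>
      have "0 \<le> (real n - real \<rho>) * (real d - real (m + 1))"
        using \<rho>(1) True by (intro mult_nonneg_nonneg) auto
      moreover have "real (m + 1) * (real n * real d - real n + real \<rho>) \<le> real (m + 1) * (real d * s)"
        using \<rho>(3) by (intro mult_left_mono) auto
      ultimately have "real d * (real \<rho> + real n * real m) \<le> real d * (real (m + 1) * s)"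
        by (simp add: algebra_simps)
      then have "real \<rho> + real n * real m \<le> real (m + 1) * s"
        using d by simp
      with l show ?thesis by linarith
    next
      case False
      define m' where "m' = m - d"
      have m: "m = m' + d" using False by (simp add: m'_def)
      \<comment> \<open>Growth orders are natural numbers, so the real bound from the induction
        hypothesis is rounded down.\<close>
      define e where "e = nat \<lfloor>real (m' + 1) * s\<rfloor>"
      have e: "real e \<le> real (m' + 1) * s" unfolding e_def using s0 by simp
      have "hilbert_bound (jet_coords n m') (jet_ideal n m' F) e"
      proof (rule hilbert_bound_of_prime_chains[OF _ hom_ideal_jet_ideal[OF F(1,2)]])
        fix l P assume "prime_chain (jet_coords n m') (jet_ideal n m' F) l P"
        with less(1)[of m'] d m have "real l \<le> real (m' + 1) * s" by simp
        then show "l \<le> e" unfolding e_def by (simp add: le_nat_floor)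
      qed simp
      from singular_jets_bound[OF F(1,2) d m Q IQ base this]
      have "hilbert_bound ?V (P 0) (\<rho> + n * (d - 1) + e)" by (simp add: Q_def)
      from prime_chain_le_hilbert_bound[OF less(2) _ this] have "l \<le> \<rho> + n * (d - 1) + e" by simp
      then have "real l \<le> real (\<rho> + n * (d - 1) + e)" by (simp only: of_nat_le_iff)
      also have "\<dots> = real \<rho> + real n * (real d - 1) + real e" using d by (simp add: of_nat_diff)
      also have "\<dots> \<le> real d * s + real (m' + 1) * s"
        using \<rho>(3) e by (simp add: algebra_simps)
      also have "\<dots> = real (m + 1) * s" by (simp add: m algebra_simps)
      finally show ?thesis .
    qed
  qed
qed

lemma lct_ge:
  assumes "F \<in> Pol {..<n}" "0 \<le> s"
    and "\<And>m l P. prime_chain (jet_coords n m) (jet_ideal n m F) l P \<Longrightarrow> real l \<le> real (m + 1) * s"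
  shows "ereal (real n - s) \<le> lct n F"
proof -
  have "(SUP m. krull_dim (Spec (jet_ring n m F)) / ereal (real (m + 1))) \<le> ereal s"
  proof (rule SUP_least)
    fix m
    have "ideal (jet_ideal n m F) (mpoly_ring (jet_coords n m))"
      unfolding jet_ideal_def by (rule genideal_ideal[OF jet_gens_Pol[OF assms(1)]])
    then have "krull_dim (Spec (jet_ring n m F)) \<le> ereal (real (m + 1) * s)"
      unfolding jet_ring_def using assms by (intro krull_dim_quotient_le) auto
    then have "krull_dim (Spec (jet_ring n m F)) / ereal (real (m + 1)) \<le> ereal (real (m + 1) * s) / ereal (real (m + 1))"
      by (rule ereal_divide_right_mono) simp
    then show "krull_dim (Spec (jet_ring n m F)) / ereal (real (m + 1)) \<le> ereal s"
      by simp
  qed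
  from ereal_minus_mono[OF order_refl this, of "ereal (real n)"] show ?thesis
    by (simp add: lct_def)
qed

theorem theorem1p1:
  fixes n d :: nat and F :: "(nat, complex) mpoly" and r :: ereal
  assumes "n \<ge> 2" and "d \<ge> 1"
    and "F \<in> carrier (mpoly_ring {..<n})" and "F \<noteq> 0" and "homogeneous d F"
    and "r = krull_dim (Sing n F)"
  shows "lct n F \<ge> min ((ereal (real n) - r) / ereal (real d)) 1"
proof (cases "Sing n F = {}")
  case True
  \<comment> \<open>Without singular points s = n - 1 suffices, and the threshold is at least 1,
    which dominates the minimum.\<close>
  have "ereal (real n - (real n - 1)) \<le> lct n F"
    using assms True by (intro lct_ge[OF assms(3)] jet_chain_length[of n d F]) auto
  then have "1 \<le> lct n F" by (simp add: one_ereal_def)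
  then show ?thesis by (rule min.coboundedI2)
next
  case False
  then obtain T where T: "T \<in> Sing n F" by blast
  have chain_le: "ereal (real l) \<le> r" if "prime_chain {..<n} (sing_ideal n F) l P" for l P
    using prime_chain_Sing[OF assms(3) that] assms(6) by simp
  have prime: "primeideal T (mpoly_ring {..<n})" and sub: "insert F ((\<lambda>i. partial_deriv i F) ` {..<n}) \<subseteq> T"
    using T by (auto simp: Sing_def Spec_def)
  \<comment> \<open>One singular prime is a chain of length 0, so r is nonnegative.\<close>
  have "prime_chain {..<n} (sing_ideal n F) 0 (\<lambda>_. T)"
    using prime ring.genideal_minimal[OF cring.axioms(1)[OF cring_mpoly_ring] prime_ideal[OF prime] sub]
    unfolding prime_chain_def sing_ideal_def by blast
  from chain_le[OF this] have r0: "0 \<le> r" by (simp add: zero_ereal_def)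
  show ?thesis
  proof (cases r)
    case PInf
    \<comment> \<open>The right-hand side is then -\<infinity>.\<close>
    then show ?thesis using assms(2) by simp
  next
    case MInf
    then show ?thesis using r0 by simp
  next
    case (real x)
    \<comment> \<open>Chosen so that n - s is the claimed minimum.\<close>
    define s where "s = max (real n - 1) (real n - (real n - x) / real d)"
    \<comment> \<open>Chain lengths are integers, so x may be rounded down; the cap n, valid for all
      chains in n variables, provides the \<rho> \<le> n that \<open>jet_chain_length\<close> asks
      for.\<close>
    define \<rho> where "\<rho> = min n (nat \<lfloor>x\<rfloor>)"
    have x0: "0 \<le> x" using r0 real by simp
    have le_\<rho>: "l \<le> \<rho>" if P: "prime_chain {..<n} (sing_ideal n F) l P" for l P
    proof -
      have "l \<le> n"
        using prime_chain_le_hilbert_bound[OF P _ hilbert_bound_free] by simp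
      moreover have "real l \<le> x" using chain_le[OF P] real by simp
      ultimately show ?thesis by (simp add: \<rho>_def le_nat_floor)
    qed
    have "real \<rho> \<le> real (nat \<lfloor>x\<rfloor>)" by (simp add: \<rho>_def)
    with x0 have "real \<rho> \<le> x" using of_nat_floor[of x] by linarith
    moreover have "real n * real d - (real n - x) \<le> real d * s"
    proof -
      have "real n * real d - (real n - x) = real d * (real n - (real n - x) / real d)"
        using assms(2) by (simp add: field_simps)
      also have "\<dots> \<le> real d * s"
        by (intro mult_left_mono) (auto simp: s_def)
      finally show ?thesis .
    qed
    ultimately have \<rho>: "\<exists>\<rho>\<le>n. (\<forall>l P. prime_chain {..<n} (sing_ideal n F) l P \<longrightarrow> l \<le> \<rho>) \<and>
      real n * real d - real n + real \<rho> \<le> real d * s"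
      using le_\<rho> by (intro exI[of _ \<rho>]) (auto simp: \<rho>_def)
    have "ereal (real n - s) \<le> lct n F"
      using assms \<rho> by (intro lct_ge[OF assms(3)] jet_chain_length[of n d F]) (auto simp: s_def)
    moreover have "ereal (real n - s) = min ((ereal (real n) - r) / ereal (real d)) 1"
    proof -
      have "real n - s = min ((real n - x) / real d) 1" by (auto simp: s_def min_def max_def)
      then show ?thesis using assms(2) by (simp add: real one_ereal_def)
    qed
    ultimately show ?thesis by simp
  qed
qed

end
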